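(* Let $G$ be a locally compact group, $\mu$ a regular Borel probability measure on $G$, $E$ a Banach space with a separable predual $E_*$, and $\pi$ a representation of $G$ in $E$ which is the adjoint of a strongly continuous representation $\pi_*$ of $G$ by isometries in $E_*$. Then the mapping $R_\pi:\mathbb{L}_{\mu\pi}\to E$ given by $$R_\pi f=\int_{G^\infty} f(\omega)\,Q_e(d\omega)$$ is an isometric isomorphism of $\mathbb{L}_{\mu\pi}$ onto $\mathcal{H}_{\mu\pi}=\{x\in E: \pi(\mu)x=x\}$. Furthermore, given $x\in\mathcal{H}_{\mu\pi}$, the sequence $\pi(\omega_n)x$ converges weakly* universally almost everywhere (in $\omega=\{\omega_n\}_{n=0}^\infty\in G^\infty$) to $R_\pi^{-1}x$.
   Context: Representation: $\langle x_*,x\rangle$ is the duality between $E_*$ and $E=(E_* )^*$; $\pi(g)=[\pi_*(g^{-1})]^*$. For a complex measure $\sigma\in M(G)$, $\pi(\sigma)$ is the bounded operator on $E$ with $\langle x_*,\pi(\sigma)x\rangle=\int_G\langle x_*,\pi(g)x\rangle\,\sigma(dg)$. Random walk: $\mathcal{B}$ is the Borel $\sigma$-algebra of $G$, $G^\infty=\prod_{n=0}^\infty G$ with product $\sigma$-algebra $\mathcal{B}^\infty=\prod_{n=0}^\infty\mathcal{B}$; points are $\omega=\{\omega_n\}_{n=0}^\infty$. For $g\in G$, $Q_g$ is the probability measure on $(G^\infty,\mathcal{B}^\infty)$ that is the law of the Markov chain with transition probability $\Pi(g',A)=\mu(g'^{-1}A)$ started at $g$; $e$ is the identity of $G$. $G$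 acts on $G^\infty$ by $g\{\omega_n\}=\{g\omega_n\}$. The shift is $\vartheta(\{\omega_n\}_{n=0}^\infty)=\{\omega_{n+1}\}_{n=0}^\infty$, and $\mathcal{B}^{(i)}=\{A\in\mathcal{B}^\infty:\vartheta^{-1}(A)=A\}$ is the invariant $\sigma$-algebra. A set $A\in\mathcal{B}^{(i)}$ is universally null (resp. universally conull) if $Q_g(A)=0$ (resp. $Q_g(A)=1$) for every $g\in G$; $\mathcal{N}_u$ is the family of universally null sets. A property holds universally almost everywhere (u.a.e.) if it holds on a universally conull set. $E$ carries the Borel structure of the weak* topology, and integrals of bounded Borel $E$-valued functions are weak* integrals: $\langle x_*,\int f\,d\sigma\rangle=\int\langle x_*,f\rangle\,d\sigma$. $\mathbb{L}^\infty_i(\mu,E)$ is the space of $\mathcal{B}^{(i)}$-measurable $f:G^\infty\to E$ with $\|f\|_u=\inf_{\Delta\in\mathcal{N}_u}\sup_{\omega\in G^\infty-\Delta}\|f(\omega)\|<\infty$, modulo equality u.a.e., with norm $\|\cdot\|_u$. Write $(gf)(\omega)=f(g^{-1}\omega)$ and $(\hat\pi(g)f)(\omega)=\pi(g)f(\omega)$. Then $\mathbb{L}_{\mu\pi}=\{f\in\mathbb{L}^\infty_i(\mu,E): g^{-1}f=\hat\pi(g)f\text{ for every }g\in G\}$, i.e. for each $g\in G$, $f(g\omega)=\pi(g)f(\omega)$ u.a.e. *)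

theory Defs
  imports "HOL-Probability.Probability"
begin

text \<open>
  Groups are written additively, because the library class of (not necessarily commutative)
  topological groups, \<^class>\<open>topological_group_add\<close>, is: \<open>g + h\<close> is the product \<open>gh\<close>, \<open>- g\<close> the
  inverse, \<open>0\<close> the identity \<open>e\<close>.
\<close>

subsection \<open>The predual and the Banach space $E = (E_*)^*$\<close>

text \<open>
  The scalar field is \<open>'k :: {real_normed_field, euclidean_space}\<close>, of which \<^typ>\<open>real\<close> and
  \<^typ>\<open>complex\<close> are instances (and, by the theorem of Frobenius, up to isometric
  isomorphism the only ones). The library has no class of complex normed spaces, so the multiplication by
  scalars on \<open>E_*\<close> is the explicit parameter \<open>smul\<close>.
\<close>

locale normed_space_over = vector_space smul
  for smul :: "'k::real_normed_field \<Rightarrow> 'a::real_normed_vector \<Rightarrow> 'a" +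
  assumes scale_of_real: "smul (of_real r) v = r *\<^sub>R v"
    and norm_scale: "norm (smul c v) = norm c * norm v"

text \<open>
  \<^typ>\<open>'a \<Rightarrow>\<^sub>L 'k\<close> consists of the bounded real-linear maps; \<open>E\<close> is the subset of those that are
  linear over \<open>'k\<close>, with the operator norm.
\<close>

definition dual :: "('k::real_normed_field \<Rightarrow> 'a::real_normed_vector \<Rightarrow> 'a) \<Rightarrow> ('a \<Rightarrow>\<^sub>L 'k) set"
  where "dual smul = {x. \<forall>c v. blinfun_apply x (smul c v) = c * blinfun_apply x v}"

definition scale_dual :: "'k::real_normed_field \<Rightarrow> ('a::real_normed_vector \<Rightarrow>\<^sub>L 'k) \<Rightarrow> ('a \<Rightarrow>\<^sub>L 'k)"
  where "scale_dual c x = blinfun_mult_right c o\<^sub>L x"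

text \<open>For functionals, the strong operator topology is the topology of pointwise convergence.\<close>

definition weak_star :: "('k::real_normed_field \<Rightarrow> 'a::real_normed_vector \<Rightarrow> 'a) \<Rightarrow> ('a \<Rightarrow>\<^sub>L 'k) topology"
  where "weak_star smul = subtopology strong_operator_topology (dual smul)"

definition weak_star_borel :: "('k::real_normed_field \<Rightarrow> 'a::real_normed_vector \<Rightarrow> 'a) \<Rightarrow> ('a \<Rightarrow>\<^sub>L 'k) measure"
  where "weak_star_borel smul = sigma (dual smul) {U. openin (weak_star smul) U}"

text \<open>\<open>Blinfun\<close> is meaningful here when the integral is bounded and linear in \<open>v\<close>, as it is for
  (essentially) bounded weak* measurable \<open>f\<close> and finite \<open>M\<close>.\<close>

definition weak_star_integral ::
    "'w measure \<Rightarrow> ('w \<Rightarrow> 'a::real_normed_vector \<Rightarrow>\<^sub>L 'k::{real_normed_field, euclidean_space}) \<Rightarrow> 'a \<Rightarrow>\<^sub>L 'k"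
  where "weak_star_integral M f = Blinfun (\<lambda>v. \<integral>\<omega>. blinfun_apply (f \<omega>) v \<partial>M)"


subsection \<open>Representations\<close>

locale isometric_representation = normed_space_over smul
  for smul :: "'k::real_normed_field \<Rightarrow> 'a::real_normed_vector \<Rightarrow> 'a" +
  fixes rep :: "'g::topological_group_add \<Rightarrow> 'a \<Rightarrow>\<^sub>L 'a"
  assumes rep_scale: "blinfun_apply (rep g) (smul c v) = smul c (blinfun_apply (rep g) v)"
    and rep_zero: "rep 0 = id_blinfun"
    and rep_add: "rep (g + h) = rep g o\<^sub>L rep h"
    and norm_rep: "norm (blinfun_apply (rep g) v) = norm v"
    and continuous_rep: "continuous_on UNIV (\<lambda>g. blinfun_apply (rep g) v)"

text \<open>$\pi(g) = [\pi_*(g^{-1})]^*$\<close>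

definition adjoint_rep ::
    "('g::group_add \<Rightarrow> 'a::real_normed_vector \<Rightarrow>\<^sub>L 'a) \<Rightarrow> 'g \<Rightarrow> ('a \<Rightarrow>\<^sub>L 'k::real_normed_field) \<Rightarrow> ('a \<Rightarrow>\<^sub>L 'k)"
  where "adjoint_rep rep g x = x o\<^sub>L rep (- g)"

text \<open>$\pi(\sigma)$, for positive \<open>\<sigma>\<close>\<close>

definition rep_measure ::
    "('g::group_add \<Rightarrow> 'a::real_normed_vector \<Rightarrow>\<^sub>L 'a) \<Rightarrow> 'g measure \<Rightarrow>
      ('a \<Rightarrow>\<^sub>L 'k::{real_normed_field, euclidean_space}) \<Rightarrow> ('a \<Rightarrow>\<^sub>L 'k)"
  where "rep_measure rep \<sigma> x = weak_star_integral \<sigma> (\<lambda>g. adjoint_rep rep g x)"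

definition harmonic ::
    "('k::{real_normed_field, euclidean_space} \<Rightarrow> 'a::real_normed_vector \<Rightarrow> 'a) \<Rightarrow>
      ('g::group_add \<Rightarrow> 'a \<Rightarrow>\<^sub>L 'a) \<Rightarrow> 'g measure \<Rightarrow> ('a \<Rightarrow>\<^sub>L 'k) set"
  where "harmonic smul rep \<mu> = {x \<in> dual smul. rep_measure rep \<mu> x = x}"


subsection \<open>The random walk\<close>

definition regular_borel_prob :: "'g::topological_space measure \<Rightarrow> bool"
  where "regular_borel_prob \<mu> \<longleftrightarrow> prob_space \<mu> \<and> sets \<mu> = sets borel \<and>
    (\<forall>A\<in>sets borel.
      emeasure \<mu> A = (SUP K\<in>{K. K \<subseteq> A \<and> compact K}. emeasure \<mu> K) \<and>
      emeasure \<mu> A = (INF U\<in>{U. A \<subseteq> U \<and> open U}. emeasure \<mu> U))"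

abbreviation path_algebra :: "(nat \<Rightarrow> 'g::topological_space) measure"
  where "path_algebra \<equiv> PiM UNIV (\<lambda>_. borel)"

text \<open>$\Pi(g', A) = \mu(g'^{-1}A)$; note that \<open>g'\<^sup>-\<^sup>1A = (+) g' -` A\<close>.\<close>

definition transition :: "'g::topological_group_add measure \<Rightarrow> 'g \<Rightarrow> 'g measure"
  where "transition \<mu> g' = distr \<mu> borel ((+) g')"

text \<open>The kernels of the chain started at \<open>g\<close>: \<open>step_kernel \<mu> g n \<omega>\<close> is the conditional law of
  the \<open>n\<close>-th coordinate given the coordinates \<open>\<omega>\<^sub>0, \<dots>, \<omega>\<^bsub>n-1\<^esub>\<close>.\<close>

definition step_kernel :: "'g::topological_group_add measure \<Rightarrow> 'g \<Rightarrow> nat \<Rightarrow> (nat \<Rightarrow> 'g) \<Rightarrow> 'g measure"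
  where "step_kernel \<mu> g n \<omega> = (case n of 0 \<Rightarrow> return borel g | Suc m \<Rightarrow> transition \<mu> (\<omega> m))"

text \<open>$Q_g$ is the measure on the path space that the Ionescu-Tulcea theorem provides. Its
  hypotheses are verified in \<open>Ionescu_Tulcea_step_kernel\<close> below.\<close>

definition walk_law :: "'g::topological_group_add measure \<Rightarrow> 'g \<Rightarrow> (nat \<Rightarrow> 'g) measure"
  where "walk_law \<mu> g =
    projective_family.lim UNIV (Ionescu_Tulcea.CI (step_kernel \<mu> g) (\<lambda>_. borel)) (\<lambda>_. borel)"

lemma open_emeasure_translate_greater:
  fixes \<mu> :: "'g::{topological_group_add, t2_space} measure"
  assumes r: "regular_borel_prob \<mu>" and U: "open U"
  shows "open {g. a < emeasure \<mu> ((+) g -` U)}"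
proof (rule topological_space_class.openI)
  fix g assume "g \<in> {g. a < emeasure \<mu> ((+) g -` U)}"
  then have a: "a < emeasure \<mu> ((+) g -` U)" by simp
  have cont: "continuous_on UNIV (\<lambda>(x::'g,y). x + y)"
    unfolding split_beta by (intro continuous_intros)
  have op: "open ((\<lambda>(x::'g,y). x + y) -` U)"
    using continuous_on_open_vimage[of UNIV, OF open_UNIV] cont U by fastforce
  have cl: "continuous_on UNIV ((+) h)" for h :: 'g
    by (auto simp: continuous_on_def intro!: tendsto_add tendsto_ident_at)
  have opg: "open ((+) h -` U)" for h
    using continuous_on_open_vimage[of UNIV "(+) h", OF open_UNIV] cl U by fastforce
  have "emeasure \<mu> ((+) g -` U) = (SUP K\<in>{K. K \<subseteq> (+) g -` U \<and> compact K}. emeasure \<mu> K)"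
    using r opg[of g] unfolding regular_borel_prob_def by auto
  with a have "a < (SUP K\<in>{K. K \<subseteq> (+) g -` U \<and> compact K}. emeasure \<mu> K)" by metis
  then obtain K where K: "K \<subseteq> (+) g -` U" "compact K" "a < emeasure \<mu> K"
    unfolding less_SUP_iff by blast
  have sub: "{g} \<times> K \<subseteq> (\<lambda>(x::'g,y). x + y) -` U" using K by auto
  have "\<exists>X0. g \<in> X0 \<and> open X0 \<and> X0 \<times> K \<subseteq> (\<lambda>(x::'g,y). x + y) -` U"
    using Elementary_Topology.tube_lemma[OF K(2) op sub] .
  then obtain V where V: "g \<in> V" "open V" "V \<times> K \<subseteq> (\<lambda>(x::'g,y). x + y) -` U" by auto
  have "V \<subseteq> {g. a < emeasure \<mu> ((+) g -` U)}"
  proof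
    fix h assume "h \<in> V"
    then have "K \<subseteq> (+) h -` U" using V by auto
    moreover have "(+) h -` U \<in> sets \<mu>" using opg r unfolding regular_borel_prob_def by auto
    ultimately have "emeasure \<mu> K \<le> emeasure \<mu> ((+) h -` U)" by (rule emeasure_mono)
    with K show "h \<in> {g. a < emeasure \<mu> ((+) g -` U)}" by auto
  qed
  with V show "\<exists>T. open T \<and> g \<in> T \<and> T \<subseteq> {g. a < emeasure \<mu> ((+) g -` U)}" by auto
qed

lemma measurable_add_left [measurable]: "(+) (h::'g::topological_group_add) \<in> borel \<rightarrow>\<^sub>M borel"
  by (intro borel_measurable_continuous_onI) (auto simp: continuous_on_def intro!: tendsto_add tendsto_ident_at)

lemma measurable_transition:
  fixes \<mu> :: "'g::{topological_group_add, t2_space} measure"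
  assumes r: "regular_borel_prob \<mu>"
  shows "transition \<mu> \<in> borel \<rightarrow>\<^sub>M subprob_algebra borel"
proof (rule measurable_prob_algebraD, rule measurable_prob_algebra_generated[where \<Omega>=UNIV and G="{U. open U}"])
  interpret prob_space \<mu> using r unfolding regular_borel_prob_def by auto
  have s[measurable_cong]: "sets \<mu> = sets borel" using r unfolding regular_borel_prob_def by auto
  show "sets borel = sigma_sets UNIV {U::'g set. open U}" by (simp add: borel_def)
  show "Int_stable {U::'g set. open U}" by (auto simp: Int_stable_def)
  show "prob_space (transition \<mu> a)" for a unfolding transition_def by (rule prob_space_distr) simp
  show "sets (transition \<mu> a) = sets borel" for a unfolding transition_def by simp
  fix A assume A: "A \<in> {U::'g set. open U}"
  have "emeasure (transition \<mu> a) A = emeasure \<mu> ((+) a -` A)" for a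
    unfolding transition_def using A sets_eq_imp_space_eq[OF s] by (subst emeasure_distr) auto
  then show "(\<lambda>a. emeasure (transition \<mu> a) A) \<in> borel_measurable borel"
    using open_emeasure_translate_greater[OF r, of A] A by (auto intro!: borel_measurableI_greater)
qed auto

lemma Ionescu_Tulcea_step_kernel:
  fixes \<mu> :: "'g::{topological_group_add, t2_space} measure"
  assumes r: "regular_borel_prob \<mu>"
  shows "Ionescu_Tulcea (step_kernel \<mu> g) (\<lambda>_. borel)"
proof (rule Ionescu_Tulcea.intro)
  interpret prob_space \<mu> using r unfolding regular_borel_prob_def by auto
  have s[measurable_cong]: "sets \<mu> = sets borel" using r unfolding regular_borel_prob_def by auto
  note measurable_transition[OF r, measurable]
  show "step_kernel \<mu> g i \<in> PiM {0..<i} (\<lambda>_. borel) \<rightarrow>\<^sub>M subprob_algebra borel" for i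
    unfolding step_kernel_def[abs_def] by (cases i) auto
  show "prob_space (step_kernel \<mu> g i x)" for i x
    unfolding step_kernel_def transition_def
    by (cases i) (auto intro!: prob_space_return prob_space_distr)
qed
definition shift :: "(nat \<Rightarrow> 'g) \<Rightarrow> (nat \<Rightarrow> 'g)"
  where "shift \<omega> = (\<lambda>n. \<omega> (Suc n))"

definition translate :: "'g::plus \<Rightarrow> (nat \<Rightarrow> 'g) \<Rightarrow> (nat \<Rightarrow> 'g)"
  where "translate g \<omega> = (\<lambda>n. g + \<omega> n)"

definition invariant_sets :: "(nat \<Rightarrow> 'g::topological_space) set set"
  where "invariant_sets = {A \<in> sets path_algebra. shift -` A = A}"

definition invariant_algebra :: "(nat \<Rightarrow> 'g::topological_space) measure"
  where "invariant_algebra = sigma UNIV invariant_sets"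

definition universally_null :: "'g::topological_group_add measure \<Rightarrow> (nat \<Rightarrow> 'g) set set"
  where "universally_null \<mu> = {A \<in> invariant_sets. \<forall>g. emeasure (walk_law \<mu> g) A = 0}"

definition universally_conull :: "'g::topological_group_add measure \<Rightarrow> (nat \<Rightarrow> 'g) set set"
  where "universally_conull \<mu> = {A \<in> invariant_sets. \<forall>g. emeasure (walk_law \<mu> g) A = 1}"

definition uae :: "'g::topological_group_add measure \<Rightarrow> ((nat \<Rightarrow> 'g) \<Rightarrow> bool) \<Rightarrow> bool"
  where "uae \<mu> P \<longleftrightarrow> (\<exists>A\<in>universally_conull \<mu>. \<forall>\<omega>\<in>A. P \<omega>)"


subsection \<open>The spaces $L^\infty_i(\mu,E)$ and $L_{\mu\pi}$\<close>

text \<open>Both are sets of equivalence classes of functions modulo equality u.a.e. The suffix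
  \<open>_fun\<close> marks the corresponding sets of functions.\<close>

definition norm_u :: "'g::topological_group_add measure \<Rightarrow> ((nat \<Rightarrow> 'g) \<Rightarrow> 'e::real_normed_vector) \<Rightarrow> ennreal"
  where "norm_u \<mu> f = (INF \<Delta>\<in>universally_null \<mu>. SUP \<omega>\<in>- \<Delta>. ennreal (norm (f \<omega>)))"

definition Linf_fun ::
    "('k::real_normed_field \<Rightarrow> 'a::real_normed_vector \<Rightarrow> 'a) \<Rightarrow> 'g::topological_group_add measure \<Rightarrow>
      ((nat \<Rightarrow> 'g) \<Rightarrow> 'a \<Rightarrow>\<^sub>L 'k) set"
  where "Linf_fun smul \<mu> =
    {f \<in> invariant_algebra \<rightarrow>\<^sub>M weak_star_borel smul. norm_u \<mu> f < \<infinity>}"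

definition uae_eq ::
    "('k::real_normed_field \<Rightarrow> 'a::real_normed_vector \<Rightarrow> 'a) \<Rightarrow> 'g::topological_group_add measure \<Rightarrow>
      ((nat \<Rightarrow> 'g) \<Rightarrow> 'a \<Rightarrow>\<^sub>L 'k) rel"
  where "uae_eq smul \<mu> =
    {(f, h). f \<in> Linf_fun smul \<mu> \<and> h \<in> Linf_fun smul \<mu> \<and> uae \<mu> (\<lambda>\<omega>. f \<omega> = h \<omega>)}"

definition L_fun ::
    "('k::real_normed_field \<Rightarrow> 'a::real_normed_vector \<Rightarrow> 'a) \<Rightarrow>
      ('g::topological_group_add \<Rightarrow> 'a \<Rightarrow>\<^sub>L 'a) \<Rightarrow> 'g measure \<Rightarrow> ((nat \<Rightarrow> 'g) \<Rightarrow> 'a \<Rightarrow>\<^sub>L 'k) set"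
  where "L_fun smul rep \<mu> =
    {f \<in> Linf_fun smul \<mu>. \<forall>g. uae \<mu> (\<lambda>\<omega>. f (translate g \<omega>) = adjoint_rep rep g (f \<omega>))}"

definition L_space ::
    "('k::real_normed_field \<Rightarrow> 'a::real_normed_vector \<Rightarrow> 'a) \<Rightarrow>
      ('g::topological_group_add \<Rightarrow> 'a \<Rightarrow>\<^sub>L 'a) \<Rightarrow> 'g measure \<Rightarrow> ((nat \<Rightarrow> 'g) \<Rightarrow> 'a \<Rightarrow>\<^sub>L 'k) set set"
  where "L_space smul rep \<mu> = L_fun smul rep \<mu> // uae_eq smul \<mu>"

definition class_add ::
    "('k::real_normed_field \<Rightarrow> 'a::real_normed_vector \<Rightarrow> 'a) \<Rightarrow> 'g::topological_group_add measure \<Rightarrow>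
      ((nat \<Rightarrow> 'g) \<Rightarrow> 'a \<Rightarrow>\<^sub>L 'k) set \<Rightarrow> ((nat \<Rightarrow> 'g) \<Rightarrow> 'a \<Rightarrow>\<^sub>L 'k) set \<Rightarrow> ((nat \<Rightarrow> 'g) \<Rightarrow> 'a \<Rightarrow>\<^sub>L 'k) set"
  where "class_add smul \<mu> F H = (\<Union>f\<in>F. \<Union>h\<in>H. uae_eq smul \<mu> `` {\<lambda>\<omega>. f \<omega> + h \<omega>})"

definition class_scale ::
    "('k::real_normed_field \<Rightarrow> 'a::real_normed_vector \<Rightarrow> 'a) \<Rightarrow> 'g::topological_group_add measure \<Rightarrow>
      'k \<Rightarrow> ((nat \<Rightarrow> 'g) \<Rightarrow> 'a \<Rightarrow>\<^sub>L 'k) set \<Rightarrow> ((nat \<Rightarrow> 'g) \<Rightarrow> 'a \<Rightarrow>\<^sub>L 'k) set"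
  where "class_scale smul \<mu> c F = (\<Union>f\<in>F. uae_eq smul \<mu> `` {\<lambda>\<omega>. scale_dual c (f \<omega>)})"

text \<open>Common values on the representatives of a class.\<close>

definition class_norm ::
    "'g::topological_group_add measure \<Rightarrow> ((nat \<Rightarrow> 'g) \<Rightarrow> 'a::real_normed_vector \<Rightarrow>\<^sub>L 'k::real_normed_field) set \<Rightarrow> real"
  where "class_norm \<mu> F = the_elem ((\<lambda>f. enn2real (norm_u \<mu> f)) ` F)"

definition R_map ::
    "'g::topological_group_add measure \<Rightarrow>
      ((nat \<Rightarrow> 'g) \<Rightarrow> 'a::real_normed_vector \<Rightarrow>\<^sub>L 'k::{real_normed_field, euclidean_space}) set \<Rightarrow> 'a \<Rightarrow>\<^sub>L 'k"
  where "R_map \<mu> F = the_elem ((\<lambda>f. weak_star_integral (walk_law \<mu> 0) f) ` F)"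

end

theory Submission
  imports Defs
begin

text \<open>
  Let \<open>x\<close> be harmonic and let \<open>v\<close> be a vector of the predual. The equation \<open>\<pi>(\<mu>)x = x\<close> says that the
  coefficient \<open>g \<mapsto> \<langle>v, \<pi>(g)x\<rangle>\<close> satisfies the mean value property for \<open>\<mu>\<close>. Evaluated along the random
  walk it is therefore a bounded martingale under every \<open>Q\<^sub>g\<close>, and it converges almost surely. Let \<open>v\<close>
  run through a countable dense set: since \<open>\<parallel>\<pi>(g)x\<parallel> \<le> \<parallel>x\<parallel>\<close>, the sequence \<open>\<pi>(\<omega>\<^sub>n)x\<close> converges weakly* to
  some \<open>f(\<omega>)\<close> outside one universally null set. The limit does not change under the shift, and since
  \<open>\<pi>(g)\<close> is an adjoint, hence weak* continuous, \<open>f(g\<omega>) = \<pi>(g)f(\<omega>)\<close>. A martingale has constant expectation,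
  so \<open>R f = x\<close>. This is the surjectivity of \<open>R\<close> (lemma \<open>boundary_function_exists\<close>).

  Conversely let \<open>f\<close> be bounded, shift invariant and equivariant. As \<open>Q\<^sub>g\<close> is the translate of \<open>Q\<^sub>e\<close> by \<open>g\<close>,
  equivariance turns the Poisson integral of \<open>\<langle>v, f\<rangle>\<close> into a coefficient of \<open>R f\<close>: its value at \<open>g\<close>, which is
  the integral of \<open>\<langle>v, f\<rangle>\<close> over \<open>Q\<^sub>g\<close>, equals \<open>\<langle>v, \<pi>(g)R f\<rangle>\<close> (lemma \<open>poisson_integral_evaluation\<close>). By shift
  invariance and the Markov property, \<open>\<langle>v, \<pi>(\<omega>\<^sub>n)R f\<rangle>\<close> is the conditional expectation of \<open>\<langle>v, f\<rangle>\<close> given the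
  path up to time \<open>n\<close>. Two things follow: \<open>R f\<close> is harmonic, and by Levy's theorem \<open>\<pi>(\<omega>\<^sub>n)R f\<close> converges
  weakly* to \<open>f(\<omega>)\<close> universally almost everywhere (lemma \<open>uae_limit\<close>). So \<open>f\<close> is determined by \<open>R f\<close>, and
  \<open>\<parallel>f(\<omega>)\<parallel> \<le> \<parallel>R f\<parallel>\<close> almost everywhere. The opposite inequality holds because \<open>R\<close> is an average. Hence \<open>R\<close>
  is injective and isometric, and its inverse is given by the limit.

  Two remarks on the route. For a group without a countable base, the addition need not be measurable for
  the product of the Borel algebras, so the walk is in general not available as a sum of independent increments; all
  facts about \<open>Q\<^sub>g\<close> are derived from its transition kernel, through the probabilities of cylinders, which
  are given by a recursion. And since all martingales here are bounded, their convergence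
  follows from the orthogonality of increments and a maximal inequality of Kolmogorov type.
\<close>

section \<open>Bounded martingales\<close>

text \<open>
  The martingale property is stated by integrals over past events, which is the form in which the
  Markov property yields it.
\<close>

locale bounded_martingale = prob_space M for M :: "'w measure" +
  fixes F :: "nat \<Rightarrow> 'w measure" and X :: "nat \<Rightarrow> 'w \<Rightarrow> real" and C :: real
  assumes subalg: "subalgebra M (F n)"
    and filtration: "m \<le> n \<Longrightarrow> sets (F m) \<subseteq> sets (F n)"
    and adapted: "X n \<in> borel_measurable (F n)"
    and bounded: "\<omega> \<in> space M \<Longrightarrow> \<bar>X n \<omega>\<bar> \<le> C"
    and step: "A \<in> sets (F n) \<Longrightarrow> (\<integral>\<omega>\<in>A. X (Suc n) \<omega> \<partial>M) = (\<integral>\<omega>\<in>A. X n \<omega> \<partial>M)"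
begin

lemma space_filtration [simp]: "space (F n) = space M"
  using subalg[of n] unfolding subalgebra_def by simp

lemma measurable_filtration_mono: "m \<le> n \<Longrightarrow> Z \<in> borel_measurable (F m) \<Longrightarrow> Z \<in> borel_measurable (F n)"
  by (rule measurable_from_subalg[of "F n" "F m"]) (use filtration[of m n] in \<open>simp_all add: subalgebra_def\<close>)

lemma adapted_mono: "m \<le> n \<Longrightarrow> X m \<in> borel_measurable (F n)"
  by (rule measurable_filtration_mono[OF _ adapted])

lemma measurable_X [measurable]: "X n \<in> borel_measurable M"
  using measurable_from_subalg[OF subalg adapted] .

lemma measurable_filtration: "Z \<in> borel_measurable (F n) \<Longrightarrow> Z \<in> borel_measurable M"
  using measurable_from_subalg[OF subalg] .

lemma sets_filtration: "A \<in> sets (F n) \<Longrightarrow> A \<in> sets M"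
  using subalg unfolding subalgebra_def by auto

lemma integrable_mult_bounded:
  assumes Z: "Z \<in> borel_measurable M" and K: "\<And>\<omega>. \<omega> \<in> space M \<Longrightarrow> \<bar>Z \<omega>\<bar> \<le> K"
  shows "integrable M (\<lambda>\<omega>. Z \<omega> * X n \<omega>)"
proof (rule integrable_const_bound[where B="K * C"])
  show "AE \<omega> in M. norm (Z \<omega> * X n \<omega>) \<le> K * C"
  proof (rule AE_I2)
    fix \<omega> assume "\<omega> \<in> space M"
    then show "norm (Z \<omega> * X n \<omega>) \<le> K * C"
      using mult_mono[OF K bounded, of \<omega> \<omega> n] order_trans[OF abs_ge_zero K, of \<omega>] by (simp add: abs_mult)
  qed
qed (use Z in measurable)

lemma integrable_X: "integrable M (X n)"
  using integrable_mult_bounded[of "\<lambda>_. 1" 1 n] by simp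

text \<open>
  The martingale property against test functions instead of events. It makes later increments
  orthogonal to everything that is determined earlier, for instance to an earlier value, or to an earlier
  increment cut off to a past event.
\<close>

lemma integral_mult_adapted:
  assumes Z: "Z \<in> borel_measurable (F m)" and K: "\<And>\<omega>. \<omega> \<in> space M \<Longrightarrow> \<bar>Z \<omega>\<bar> \<le> K"
    and mn: "m \<le> n"
  shows "(\<integral>\<omega>. Z \<omega> * X n \<omega> \<partial>M) = (\<integral>\<omega>. Z \<omega> * X m \<omega> \<partial>M)"
  using mn
proof (induction rule: dec_induct)
  case (step n)
  interpret fs: finite_measure_subalgebra M "F n"
    by unfold_locales (rule subalg)
  have Zn: "Z \<in> borel_measurable (F n)"
    by (rule measurable_filtration_mono[OF step.hyps(1) Z])
  have ZM [measurable]: "Z \<in> borel_measurable M" using measurable_filtration[OF Z] .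
  have "AE \<omega> in M. real_cond_exp M (F n) (X (Suc n)) \<omega> = X n \<omega>"
    by (rule fs.real_cond_exp_charact) (auto intro: bounded_martingale.step bounded_martingale_axioms integrable_X adapted)
  then have ae: "AE \<omega> in M. Z \<omega> * real_cond_exp M (F n) (X (Suc n)) \<omega> = Z \<omega> * X n \<omega>"
    by eventually_elim simp
  have "(\<integral>\<omega>. Z \<omega> * X (Suc n) \<omega> \<partial>M) = (\<integral>\<omega>. Z \<omega> * real_cond_exp M (F n) (X (Suc n)) \<omega> \<partial>M)"
    by (rule fs.real_cond_exp_intg(2)[symmetric]) (auto intro: integrable_mult_bounded K Zn)
  also have "\<dots> = (\<integral>\<omega>. Z \<omega> * X n \<omega> \<partial>M)"
    by (rule integral_cong_AE) (use ae in auto)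
  finally show ?case using step by simp
qed simp

lemma integrable_square_diff:
  "A \<in> sets M \<Longrightarrow> integrable M (\<lambda>\<omega>. indicator A \<omega> * (X n \<omega> - X m \<omega>)\<^sup>2)"
proof (rule integrable_const_bound[where B="(2*C)\<^sup>2"])
  have "(X n \<omega> - X m \<omega>)\<^sup>2 \<le> (2*C)\<^sup>2" if "\<omega> \<in> space M" for \<omega>
    using bounded[OF that, of n] bounded[OF that, of m] by (intro abs_le_square_iff[THEN iffD1]) auto
  then show "AE \<omega> in M. norm (indicator A \<omega> * (X n \<omega> - X m \<omega>)\<^sup>2) \<le> (2*C)\<^sup>2"
    by (intro AE_I2) (auto simp: indicator_def)
qed simp

text \<open>
  The cross term of the square vanishes because the increment from \<open>n\<close> to \<open>k\<close> is orthogonal to the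
  increment from \<open>m\<close> to \<open>n\<close> even after restriction to an event known at time \<open>n\<close>.
\<close>

lemma pythagoras_increments:
  assumes A: "A \<in> sets (F n)" and mn: "m \<le> n" and nk: "n \<le> k"
  shows "(\<integral>\<omega>. indicator A \<omega> * (X k \<omega> - X m \<omega>)\<^sup>2 \<partial>M) =
    (\<integral>\<omega>. indicator A \<omega> * (X n \<omega> - X m \<omega>)\<^sup>2 \<partial>M) + (\<integral>\<omega>. indicator A \<omega> * (X k \<omega> - X n \<omega>)\<^sup>2 \<partial>M)"
proof -
  define Z where "Z = (\<lambda>\<omega>. indicator A \<omega> * (X n \<omega> - X m \<omega>))"
  have [measurable]: "A \<in> sets (F n)" "X n \<in> borel_measurable (F n)" "X m \<in> borel_measurable (F n)"
    using A adapted adapted_mono[OF mn] by auto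
  have Z: "Z \<in> borel_measurable (F n)" unfolding Z_def by measurable
  have K: "\<bar>Z \<omega>\<bar> \<le> 2 * C" if "\<omega> \<in> space M" for \<omega>
    using bounded[OF that, of n] bounded[OF that, of m] unfolding Z_def by (auto simp: indicator_def)
  note int = integrable_mult_bounded[OF measurable_filtration[OF Z] K]
  have AM: "A \<in> sets M" using sets_filtration[OF A] .
  have "(\<integral>\<omega>. indicator A \<omega> * (X k \<omega> - X m \<omega>)\<^sup>2 \<partial>M) =
    (\<integral>\<omega>. indicator A \<omega> * (X n \<omega> - X m \<omega>)\<^sup>2 + indicator A \<omega> * (X k \<omega> - X n \<omega>)\<^sup>2
        + 2 * (Z \<omega> * X k \<omega> - Z \<omega> * X n \<omega>) \<partial>M)"
    by (rule Bochner_Integration.integral_cong) (auto simp: Z_def power2_eq_square algebra_simps)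
  also have "\<dots> = (\<integral>\<omega>. indicator A \<omega> * (X n \<omega> - X m \<omega>)\<^sup>2 \<partial>M) + (\<integral>\<omega>. indicator A \<omega> * (X k \<omega> - X n \<omega>)\<^sup>2 \<partial>M)
      + 2 * ((\<integral>\<omega>. Z \<omega> * X k \<omega> \<partial>M) - (\<integral>\<omega>. Z \<omega> * X n \<omega> \<partial>M))"
    using int integrable_square_diff[OF AM] by simp
  also have "(\<integral>\<omega>. Z \<omega> * X k \<omega> \<partial>M) = (\<integral>\<omega>. Z \<omega> * X n \<omega> \<partial>M)"
    by (rule integral_mult_adapted[OF Z K nk])
  finally show ?thesis by simp
qed

lemma integral_square_diff:
  assumes mn: "m \<le> n"
  shows "(\<integral>\<omega>. (X n \<omega> - X m \<omega>)\<^sup>2 \<partial>M) = (\<integral>\<omega>. X n \<omega> * X n \<omega> \<partial>M) - (\<integral>\<omega>. X m \<omega> * X m \<omega> \<partial>M)"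
proof -
  note int = integrable_mult_bounded[OF measurable_X bounded]
  have "(\<integral>\<omega>. (X n \<omega> - X m \<omega>)\<^sup>2 \<partial>M) =
    (\<integral>\<omega>. X n \<omega> * X n \<omega> + X m \<omega> * X m \<omega> - 2 * (X m \<omega> * X n \<omega>) \<partial>M)"
    by (rule Bochner_Integration.integral_cong) (auto simp: power2_eq_square algebra_simps)
  also have "\<dots> = (\<integral>\<omega>. X n \<omega> * X n \<omega> \<partial>M) + (\<integral>\<omega>. X m \<omega> * X m \<omega> \<partial>M) - 2 * (\<integral>\<omega>. X m \<omega> * X n \<omega> \<partial>M)"
    using int by simp
  also have "(\<integral>\<omega>. X m \<omega> * X n \<omega> \<partial>M) = (\<integral>\<omega>. X m \<omega> * X m \<omega> \<partial>M)"
    by (rule integral_mult_adapted[OF adapted bounded mn])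
  finally show ?thesis by simp
qed

definition deviation :: "real \<Rightarrow> nat \<Rightarrow> nat \<Rightarrow> 'w set" where
  "deviation \<epsilon> m n = {\<omega> \<in> space M. \<exists>j\<in>{m..n}. \<epsilon> < \<bar>X j \<omega> - X m \<omega>\<bar>}"

lemma sets_deviation: assumes "m \<le> n" shows "deviation \<epsilon> m n \<in> sets (F n)"
proof -
  have "{\<omega> \<in> space (F n). \<epsilon> < \<bar>X j \<omega> - X m \<omega>\<bar>} \<in> sets (F n)" if "j \<in> {m..n}" for j
  proof -
    have [measurable]: "X j \<in> borel_measurable (F n)" "X m \<in> borel_measurable (F n)"
      using adapted_mono that by auto
    show ?thesis by measurable
  qed
  then have "(\<Union>j\<in>{m..n}. {\<omega> \<in> space (F n). \<epsilon> < \<bar>X j \<omega> - X m \<omega>\<bar>}) \<in> sets (F n)"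
    by (intro sets.finite_UN) auto
  also have "(\<Union>j\<in>{m..n}. {\<omega> \<in> space (F n). \<epsilon> < \<bar>X j \<omega> - X m \<omega>\<bar>}) = deviation \<epsilon> m n"
    unfolding deviation_def by auto
  finally show ?thesis .
qed

text \<open>
  Induction on \<open>n\<close>. On the paths that have deviated before, the second moment can only grow, by
  orthogonality; on a path that deviates for the first time at \<open>n + 1\<close>, the integrand is itself at least
  \<open>\<epsilon>\<^sup>2\<close>. This avoids summing over the time of the first deviation.
\<close>

lemma maximal_inequality_on_deviation:
  assumes e: "0 < \<epsilon>" and mn: "m \<le> n"
  shows "\<epsilon>\<^sup>2 * prob (deviation \<epsilon> m n) \<le> (\<integral>\<omega>. indicator (deviation \<epsilon> m n) \<omega> * (X n \<omega> - X m \<omega>)\<^sup>2 \<partial>M)"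
  using mn
proof (induction rule: dec_induct)
  case base
  have "deviation \<epsilon> m m = {}" using e by (auto simp: deviation_def)
  then show ?case by simp
next
  case (step n)
  let ?D = "deviation \<epsilon> m n" and ?D' = "deviation \<epsilon> m (Suc n)"
  have D: "?D \<in> sets (F n)" "?D' \<in> sets (F (Suc n))" using sets_deviation step by auto
  have DM [measurable]: "?D \<in> sets M" "?D' \<in> sets M" using D sets_filtration by auto
  have sub: "?D \<subseteq> ?D'" unfolding deviation_def by force
  have new: "\<epsilon>\<^sup>2 \<le> (X (Suc n) \<omega> - X m \<omega>)\<^sup>2" if "\<omega> \<in> ?D' - ?D" for \<omega>
  proof -
    from that obtain j where j: "j \<in> {m..Suc n}" "\<epsilon> < \<bar>X j \<omega> - X m \<omega>\<bar>" "\<omega> \<in> space M"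
      unfolding deviation_def by auto
    have "j \<notin> {m..n}" using that j unfolding deviation_def by auto
    then have "j = Suc n" using j by auto
    then show ?thesis using j e by (intro abs_le_square_iff[THEN iffD1]) auto
  qed
  have "\<epsilon>\<^sup>2 * prob ?D' = \<epsilon>\<^sup>2 * prob ?D + \<epsilon>\<^sup>2 * prob (?D' - ?D)"
    using finite_measure_Diff[OF DM(2,1) sub] by (simp add: distrib_left[symmetric])
  also have "\<epsilon>\<^sup>2 * prob ?D \<le> (\<integral>\<omega>. indicator ?D \<omega> * (X (Suc n) \<omega> - X m \<omega>)\<^sup>2 \<partial>M)"
    using step.IH pythagoras_increments[OF D(1) step.hyps(1), of "Suc n"]
    by (simp add: add_increasing2)
  also have "\<epsilon>\<^sup>2 * prob (?D' - ?D) = (\<integral>\<omega>. indicator (?D' - ?D) \<omega> * \<epsilon>\<^sup>2 \<partial>M)"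
    by simp
  also have "\<dots> \<le> (\<integral>\<omega>. indicator (?D' - ?D) \<omega> * (X (Suc n) \<omega> - X m \<omega>)\<^sup>2 \<partial>M)"
  proof (rule integral_mono)
    show "integrable M (\<lambda>\<omega>. indicator (?D' - ?D) \<omega> * \<epsilon>\<^sup>2)"
      by (intro integrable_mult_left integrable_real_indicator) (auto simp: less_top[symmetric])
  qed (use new integrable_square_diff[of "?D' - ?D"] in \<open>auto simp: indicator_def\<close>)
  also have "(\<integral>\<omega>. indicator ?D \<omega> * (X (Suc n) \<omega> - X m \<omega>)\<^sup>2 \<partial>M) +
      (\<integral>\<omega>. indicator (?D' - ?D) \<omega> * (X (Suc n) \<omega> - X m \<omega>)\<^sup>2 \<partial>M) =
    (\<integral>\<omega>. indicator ?D \<omega> * (X (Suc n) \<omega> - X m \<omega>)\<^sup>2 + indicator (?D' - ?D) \<omega> * (X (Suc n) \<omega> - X m \<omega>)\<^sup>2 \<partial>M)"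
    using integrable_square_diff by (intro Bochner_Integration.integral_add[symmetric]) auto
  also have "\<dots> = (\<integral>\<omega>. indicator ?D' \<omega> * (X (Suc n) \<omega> - X m \<omega>)\<^sup>2 \<partial>M)"
    using sub by (intro Bochner_Integration.integral_cong) (auto simp: indicator_def)
  finally show ?case by simp
qed

lemma maximal_inequality:
  assumes e: "0 < \<epsilon>" and mn: "m \<le> n"
  shows "\<epsilon>\<^sup>2 * prob (deviation \<epsilon> m n) \<le> (\<integral>\<omega>. X n \<omega> * X n \<omega> \<partial>M) - (\<integral>\<omega>. X m \<omega> * X m \<omega> \<partial>M)"
proof -
  have "(\<integral>\<omega>. indicator (deviation \<epsilon> m n) \<omega> * (X n \<omega> - X m \<omega>)\<^sup>2 \<partial>M) \<le> (\<integral>\<omega>. (X n \<omega> - X m \<omega>)\<^sup>2 \<partial>M)"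
    using integrable_square_diff[OF sets_filtration[OF sets_deviation[OF mn]]] integrable_square_diff[OF sets.top, of n m]
    by (intro integral_mono) (auto simp: indicator_def cong: Bochner_Integration.integrable_cong)
  then show ?thesis
    using maximal_inequality_on_deviation[OF assms] integral_square_diff[OF mn] by linarith
qed

text \<open>
  The second moments increase and are bounded, so they converge, and the maximal inequality bounds the
  probability of an \<open>\<epsilon>\<close>-deviation after time \<open>m\<close> by their remaining growth. Hence almost every path is
  Cauchy.
\<close>

theorem AE_convergent: "AE \<omega> in M. convergent (\<lambda>n. X n \<omega>)"
proof -
  define a where "a n = (\<integral>\<omega>. X n \<omega> * X n \<omega> \<partial>M)" for n
  have inc: "incseq a"
  proof (rule incseq_SucI)
    fix n
    have "0 \<le> (\<integral>\<omega>. (X (Suc n) \<omega> - X n \<omega>)\<^sup>2 \<partial>M)" by simp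
    then show "a n \<le> a (Suc n)" using integral_square_diff[of n "Suc n"] unfolding a_def by simp
  qed
  have bd: "a n \<le> C * C" for n
  proof -
    have "a n \<le> (\<integral>\<omega>. C * C \<partial>M)"
      unfolding a_def
    proof (rule integral_mono)
      show "integrable M (\<lambda>\<omega>. X n \<omega> * X n \<omega>)" by (rule integrable_mult_bounded[OF measurable_X bounded])
      show "X n \<omega> * X n \<omega> \<le> C * C" if "\<omega> \<in> space M" for \<omega>
        using bounded[OF that, of n] mult_mono[of "\<bar>X n \<omega>\<bar>" C "\<bar>X n \<omega>\<bar>" C] by auto
    qed simp
    then show ?thesis by (simp add: prob_space)
  qed
  obtain L where L: "a \<longlonglongrightarrow> L" "\<And>n. a n \<le> L"
    using incseq_convergent[OF inc] bd by blast
  have ae: "AE \<omega> in M. \<exists>m. \<forall>j\<ge>m. \<bar>X j \<omega> - X m \<omega>\<bar> \<le> \<epsilon>" if e: "0 < \<epsilon>" for \<epsilon>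
  proof -
    define B where "B m = {\<omega> \<in> space M. \<exists>j\<ge>m. \<epsilon> < \<bar>X j \<omega> - X m \<omega>\<bar>}" for m
    have [measurable]: "B m \<in> sets M" for m unfolding B_def by measurable
    have PB: "\<epsilon>\<^sup>2 * prob (B m) \<le> L - a m" for m
    proof -
      have "B m = (\<Union>n. deviation \<epsilon> m (m + n))"
        unfolding B_def deviation_def by (fastforce simp: le_iff_add)
      moreover have "(\<lambda>n. prob (deviation \<epsilon> m (m + n))) \<longlonglongrightarrow> prob (\<Union>n. deviation \<epsilon> m (m + n))"
        using sets_filtration[OF sets_deviation]
        by (intro finite_Lim_measure_incseq) (force simp: incseq_def deviation_def)+
      ultimately have "(\<lambda>n. \<epsilon>\<^sup>2 * prob (deviation \<epsilon> m (m + n))) \<longlonglongrightarrow> \<epsilon>\<^sup>2 * prob (B m)"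
        by (auto intro!: tendsto_intros)
      then show ?thesis
      proof (rule LIMSEQ_le_const2, intro exI allI impI)
        fix n
        show "\<epsilon>\<^sup>2 * prob (deviation \<epsilon> m (m + n)) \<le> L - a m"
          using maximal_inequality[OF e, of m "m + n"] L(2)[of "m + n"] unfolding a_def by simp
      qed
    qed
    have "prob (\<Inter>m. B m) \<le> x" if "0 < x" for x
    proof -
      have "eventually (\<lambda>m. L - \<epsilon>\<^sup>2 * x < a m) sequentially"
        using L(1) e that by (intro order_tendstoD) auto
      then obtain m where "L - \<epsilon>\<^sup>2 * x < a m" by (auto simp: eventually_sequentially)
      with PB[of m] have "\<epsilon>\<^sup>2 * prob (B m) \<le> \<epsilon>\<^sup>2 * x" by linarith
      then have "prob (B m) \<le> x" using e by simp
      moreover have "prob (\<Inter>m. B m) \<le> prob (B m)" by (rule finite_measure_mono) auto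
      ultimately show ?thesis by simp
    qed
    then have "prob (\<Inter>m. B m) = 0"
      by (meson dense_ge measure_nonneg antisym)
    then have "AE \<omega> in M. \<omega> \<notin> (\<Inter>m. B m)"
      by (intro AE_not_in) (auto simp: null_sets_def emeasure_eq_measure)
    then show ?thesis
      by (rule AE_mp) (auto intro!: AE_I2 simp: B_def not_less)
  qed
  have "AE \<omega> in M. \<forall>k::nat. \<exists>m. \<forall>j\<ge>m. \<bar>X j \<omega> - X m \<omega>\<bar> \<le> 1 / Suc k"
    by (subst AE_all_countable) (intro allI ae, simp)
  then show ?thesis
  proof (rule AE_mp, intro AE_I2 impI)
    fix \<omega> assume *: "\<forall>k::nat. \<exists>m. \<forall>j\<ge>m. \<bar>X j \<omega> - X m \<omega>\<bar> \<le> 1 / Suc k"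
    have "Cauchy (\<lambda>n. X n \<omega>)"
    proof (rule metric_CauchyI)
      fix e :: real assume "0 < e"
      then obtain k where k: "1 / Suc k < e / 2"
        using nat_approx_posE[of "e/2"] by auto
      obtain m where m: "\<And>j. j \<ge> m \<Longrightarrow> \<bar>X j \<omega> - X m \<omega>\<bar> \<le> 1 / Suc k" using * by blast
      have "dist (X i \<omega>) (X j \<omega>) < e" if "i \<ge> m" "j \<ge> m" for i j
        using m[OF that(1)] m[OF that(2)] k by (auto simp: dist_real_def)
      then show "\<exists>m. \<forall>i\<ge>m. \<forall>j\<ge>m. dist (X i \<omega>) (X j \<omega>) < e" by blast
    qed
    then show "convergent (\<lambda>n. X n \<omega>)" by (rule Cauchy_convergent)
  qed
qed

end

text \<open>
  The limit \<open>Y\<close> of the martingale exists, and dominated convergence gives \<open>Y\<close> and \<open>\<phi>\<close> the same integral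
  over every event of every \<open>F m\<close>. These events form a generating system stable under intersections, so
  the measures with densities \<open>Y\<close> and \<open>\<phi>\<close>, made nonnegative by a constant \<open>D\<close>, coincide.
\<close>

lemma levy_upward:
  fixes \<phi> :: "'w \<Rightarrow> real"
  assumes X: "bounded_martingale M F X C"
    and generates: "sets M = sigma_sets (space M) (\<Union>n. sets (F n))"
    and \<phi>: "\<phi> \<in> borel_measurable M" "AE \<omega> in M. \<bar>\<phi> \<omega>\<bar> \<le> K"
    and closed: "\<And>n A. A \<in> sets (F n) \<Longrightarrow> (\<integral>\<omega>\<in>A. X n \<omega> \<partial>M) = (\<integral>\<omega>\<in>A. \<phi> \<omega> \<partial>M)"
  shows "AE \<omega> in M. (\<lambda>n. X n \<omega>) \<longlonglongrightarrow> \<phi> \<omega>"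
proof -
  interpret bounded_martingale M F X C by fact
  note [measurable] = \<phi>(1)
  define Y where "Y \<omega> = lim (\<lambda>n. X n \<omega>)" for \<omega>
  have [measurable]: "Y \<in> borel_measurable M" unfolding Y_def by measurable
  have conv: "AE \<omega> in M. (\<lambda>n. X n \<omega>) \<longlonglongrightarrow> Y \<omega>"
    using AE_convergent by eventually_elim (simp add: Y_def convergent_LIMSEQ_iff)
  have Yb: "AE \<omega> in M. \<bar>Y \<omega>\<bar> \<le> C"
    using conv AE_space
  proof eventually_elim
    case (elim \<omega>)
    show ?case using bounded[OF elim(2)] by (intro LIMSEQ_le_const2[OF tendsto_rabs[OF elim(1)]]) auto
  qed
  define D where "D = max 0 (max C K)"
  have intY: "integrable M Y" using Yb by (intro integrable_const_bound[where B=C]) auto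
  have int\<phi>: "integrable M \<phi>" using \<phi> by (intro integrable_const_bound[where B=K]) auto
  have eq: "(\<integral>\<omega>\<in>A. Y \<omega> \<partial>M) = (\<integral>\<omega>\<in>A. \<phi> \<omega> \<partial>M)" if A: "A \<in> sets (F m)" for A m
  proof -
    have AM [measurable]: "A \<in> sets M" using sets_filtration[OF A] .
    have "(\<lambda>n. \<integral>\<omega>\<in>A. X n \<omega> \<partial>M) \<longlonglongrightarrow> (\<integral>\<omega>\<in>A. Y \<omega> \<partial>M)"
      unfolding set_lebesgue_integral_def
    proof (rule integral_dominated_convergence[where w="\<lambda>_. C"])
      show "AE \<omega> in M. (\<lambda>n. indicator A \<omega> *\<^sub>R X n \<omega>) \<longlonglongrightarrow> indicator A \<omega> *\<^sub>R Y \<omega>"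
        using conv by eventually_elim (auto intro!: tendsto_intros)
      show "AE \<omega> in M. norm (indicator A \<omega> *\<^sub>R X n \<omega>) \<le> C" for n
        using bounded order_trans[OF abs_ge_zero bounded] by (intro AE_I2) (auto simp: indicator_def)
    qed auto
    moreover have "(\<lambda>n. \<integral>\<omega>\<in>A. X n \<omega> \<partial>M) \<longlonglongrightarrow> (\<integral>\<omega>\<in>A. \<phi> \<omega> \<partial>M)"
    proof (rule tendsto_eventually, unfold eventually_sequentially, intro exI allI impI)
      fix n assume "m \<le> n"
      then show "(\<integral>\<omega>\<in>A. X n \<omega> \<partial>M) = (\<integral>\<omega>\<in>A. \<phi> \<omega> \<partial>M)"
        using A filtration[of m n] by (intro closed) auto
    qed
    ultimately show ?thesis by (rule LIMSEQ_unique)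
  qed
  have dens: "emeasure (density M (\<lambda>\<omega>. ennreal (f \<omega> + D))) A = ennreal ((\<integral>\<omega>\<in>A. f \<omega> \<partial>M) + D * prob A)"
    if [measurable]: "A \<in> sets M" and f: "integrable M f" "AE \<omega> in M. \<bar>f \<omega>\<bar> \<le> D" for f A
  proof -
    have [measurable]: "f \<in> borel_measurable M" using f by auto
    have "emeasure (density M (\<lambda>\<omega>. ennreal (f \<omega> + D))) A = (\<integral>\<^sup>+\<omega>. ennreal (indicator A \<omega> * f \<omega> + indicator A \<omega> * D) \<partial>M)"
      by (subst emeasure_density) (auto intro!: nn_integral_cong simp: indicator_def)
    also have "\<dots> = ennreal (\<integral>\<omega>. indicator A \<omega> * f \<omega> + indicator A \<omega> * D \<partial>M)"
    proof (rule nn_integral_eq_integral)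
      show "integrable M (\<lambda>\<omega>. indicator A \<omega> * f \<omega> + indicator A \<omega> * D)"
        using integrable_mult_indicator[OF that(1) f(1)]
        by (intro Bochner_Integration.integrable_add integrable_mult_left integrable_real_indicator)
          (auto simp: less_top[symmetric])
      show "AE \<omega> in M. 0 \<le> indicator A \<omega> * f \<omega> + indicator A \<omega> * D"
        using f(2) by eventually_elim (auto simp: indicator_def)
    qed
    also have "(\<integral>\<omega>. indicator A \<omega> * f \<omega> + indicator A \<omega> * D \<partial>M) = (\<integral>\<omega>\<in>A. f \<omega> \<partial>M) + D * prob A"
      unfolding set_lebesgue_integral_def using integrable_mult_indicator[OF that(1) f(1)]
      by (subst Bochner_Integration.integral_add) (auto intro!: integrable_mult_left integrable_real_indicator simp del: integrable_mult_left_iff simp: less_top[symmetric])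
    finally show ?thesis .
  qed
  have YD: "AE \<omega> in M. \<bar>Y \<omega>\<bar> \<le> D" using Yb by eventually_elim (simp add: D_def)
  have \<phi>D: "AE \<omega> in M. \<bar>\<phi> \<omega>\<bar> \<le> D" using \<phi>(2) by eventually_elim (simp add: D_def)
  have "density M (\<lambda>\<omega>. ennreal (Y \<omega> + D)) = density M (\<lambda>\<omega>. ennreal (\<phi> \<omega> + D))"
  proof (rule measure_eqI_generator_eq[where E="\<Union>n. sets (F n)" and A="\<lambda>_. space M" and \<Omega>="space M"])
    show "Int_stable (\<Union>n. sets (F n))"
    proof (rule Int_stableI)
      fix A B assume "A \<in> (\<Union>n. sets (F n))" "B \<in> (\<Union>n. sets (F n))"
      then obtain m n where "A \<in> sets (F m)" "B \<in> sets (F n)" by auto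
      then have "A \<inter> B \<in> sets (F (max m n))"
        using filtration[of m "max m n"] filtration[of n "max m n"] by (intro sets.Int) auto
      then show "A \<inter> B \<in> (\<Union>n. sets (F n))" by auto
    qed
    show "(\<Union>n. sets (F n)) \<subseteq> Pow (space M)" using sets_filtration sets.sets_into_space by blast
    show "emeasure (density M (\<lambda>\<omega>. ennreal (Y \<omega> + D))) A = emeasure (density M (\<lambda>\<omega>. ennreal (\<phi> \<omega> + D))) A"
      if "A \<in> (\<Union>n. sets (F n))" for A
      using that eq sets_filtration by (auto simp: dens intY int\<phi> YD \<phi>D)
    show "range (\<lambda>_. space M) \<subseteq> (\<Union>n. sets (F n))"
      using sets.top[of "F 0"] by (simp add: space_filtration) blast
    show "emeasure (density M (\<lambda>\<omega>. ennreal (Y \<omega> + D))) (space M) \<noteq> \<infinity>"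
      by (subst dens) (auto simp: intY YD)
  qed (auto simp: generates)
  then have "AE \<omega> in M. ennreal (Y \<omega> + D) = ennreal (\<phi> \<omega> + D)"
    by (intro density_unique) auto
  with YD \<phi>D conv show ?thesis
  proof eventually_elim
    case (elim \<omega>)
    then have "Y \<omega> + D = \<phi> \<omega> + D" by (subst (asm) ennreal_inj) auto
    with elim show ?case by simp
  qed
qed

section \<open>Cylinders and the past in path space\<close>

lemma integral_density_indicator:
  fixes f :: "'w \<Rightarrow> real"
  assumes "A \<in> sets M" "f \<in> borel_measurable M"
  shows "(\<integral>\<omega>. f \<omega> \<partial>density M (indicator A)) = (\<integral>\<omega>\<in>A. f \<omega> \<partial>M)"
proof -
  have "density M (indicator A) = density M (\<lambda>\<omega>. ennreal (indicator A \<omega>))"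
    by (rule arg_cong2[where f=density]) (auto simp: indicator_def)
  then show ?thesis
    using assms unfolding set_lebesgue_integral_def by (simp add: integral_density)
qed

text \<open>
  Adding the bound \<open>K\<close> makes \<open>\<phi>\<close> nonnegative, which reduces the claim to the rule for nonnegative
  integrals.
\<close>

lemma integral_bind_bounded:
  fixes \<phi> :: "'b \<Rightarrow> real"
  assumes M: "finite_measure M" "space M \<noteq> {}" and \<kappa>: "\<kappa> \<in> M \<rightarrow>\<^sub>M prob_algebra N"
    and \<phi>: "\<phi> \<in> borel_measurable N" "\<And>y. \<bar>\<phi> y\<bar> \<le> K"
  shows "(\<integral>y. \<phi> y \<partial>(M \<bind> \<kappa>)) = (\<integral>x. (\<integral>y. \<phi> y \<partial>\<kappa> x) \<partial>M)"
proof -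
  interpret finite_measure M by fact
  note \<kappa>' = measurable_prob_algebraD[OF \<kappa>]
  note [measurable] = \<kappa>'
  have sk: "sets (\<kappa> x) = sets N" "prob_space (\<kappa> x)" if "x \<in> space M" for x
    using measurable_space[OF \<kappa> that] by (auto simp: space_prob_algebra)
  have sb: "sets (M \<bind> \<kappa>) = sets N" by (rule sets_bind[OF _ M(2)]) (use sk in auto)
  have mass: "emeasure (M \<bind> \<kappa>) (space (M \<bind> \<kappa>)) = emeasure M (space M)"
  proof -
    have "emeasure (M \<bind> \<kappa>) (space N) = (\<integral>\<^sup>+x. emeasure (\<kappa> x) (space N) \<partial>M)"
      by (rule emeasure_bind[OF M(2) \<kappa>']) simp
    also have "\<dots> = (\<integral>\<^sup>+x. 1 \<partial>M)"
      using sk by (intro nn_integral_cong) (metis prob_space.emeasure_space_1 sets_eq_imp_space_eq)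
    finally show ?thesis using sets_eq_imp_space_eq[OF sb] by simp
  qed
  interpret B: finite_measure "M \<bind> \<kappa>"
    by (rule finite_measureI) (simp add: mass)
  have K0: "0 \<le> K" using \<phi>(2)[of undefined] by linarith
  have nonneg: "0 \<le> \<phi> y + K" for y using \<phi>(2)[of y] by linarith
  have m1: "(\<lambda>x. \<integral>y. \<phi> y \<partial>\<kappa> x) \<in> borel_measurable M"
    using integral_measurable_subprob_algebra[OF \<phi>(1)] \<kappa>' by (rule measurable_compose[rotated])
  have bd: "\<bar>\<integral>y. \<phi> y \<partial>\<kappa> x\<bar> \<le> K" and int: "integrable (\<kappa> x) \<phi>" if "x \<in> space M" for x
  proof -
    interpret k: prob_space "\<kappa> x" using sk that by auto
    have [measurable]: "\<phi> \<in> borel_measurable (\<kappa> x)" using \<phi>(1) measurable_cong_sets[OF sk(1)[OF that] refl] by auto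
    show "integrable (\<kappa> x) \<phi>" by (rule k.integrable_const_bound[where B=K]) (auto intro: \<phi>(2))
    then have "- K \<le> (\<integral>y. \<phi> y \<partial>\<kappa> x)" "(\<integral>y. \<phi> y \<partial>\<kappa> x) \<le> K"
      using \<phi>(2) by (auto intro!: k.integral_ge_const k.integral_le_const AE_I2 simp: abs_le_iff minus_le_iff)
    then show "\<bar>\<integral>y. \<phi> y \<partial>\<kappa> x\<bar> \<le> K" by simp
  qed
  have nonneg': "0 \<le> (\<integral>y. \<phi> y \<partial>\<kappa> x) + K" if "x \<in> space M" for x
    using bd[OF that] by linarith
  have intM: "integrable M (\<lambda>x. \<integral>y. \<phi> y \<partial>\<kappa> x)"
    using bd m1 by (intro integrable_const_bound[where B=K]) auto
  have \<phi>B: "\<phi> \<in> borel_measurable (M \<bind> \<kappa>)" using \<phi>(1) measurable_cong_sets[OF sb refl] by auto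
  have intB: "integrable (M \<bind> \<kappa>) \<phi>"
    using \<phi>B \<phi>(2) by (intro B.integrable_const_bound[where B=K]) auto
  have "ennreal (\<integral>y. \<phi> y + K \<partial>(M \<bind> \<kappa>)) = (\<integral>\<^sup>+y. ennreal (\<phi> y + K) \<partial>(M \<bind> \<kappa>))"
    using intB nonneg by (intro nn_integral_eq_integral[symmetric] AE_I2) auto
  also have "\<dots> = (\<integral>\<^sup>+x. \<integral>\<^sup>+y. ennreal (\<phi> y + K) \<partial>\<kappa> x \<partial>M)"
    by (rule nn_integral_bind[OF _ \<kappa>']) (use \<phi>(1) in measurable)
  also have "\<dots> = (\<integral>\<^sup>+x. ennreal ((\<integral>y. \<phi> y \<partial>\<kappa> x) + K) \<partial>M)"
  proof (rule nn_integral_cong)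
    fix x assume x: "x \<in> space M"
    interpret k: prob_space "\<kappa> x" using sk x by auto
    have "(\<integral>\<^sup>+y. ennreal (\<phi> y + K) \<partial>\<kappa> x) = ennreal (\<integral>y. \<phi> y + K \<partial>\<kappa> x)"
      using int[OF x] nonneg by (intro nn_integral_eq_integral AE_I2) auto
    then show "(\<integral>\<^sup>+y. ennreal (\<phi> y + K) \<partial>\<kappa> x) = ennreal ((\<integral>y. \<phi> y \<partial>\<kappa> x) + K)"
      using int[OF x] by (simp add: k.prob_space)
  qed
  also have "\<dots> = ennreal (\<integral>x. (\<integral>y. \<phi> y \<partial>\<kappa> x) + K \<partial>M)"
    using intM nonneg' by (intro nn_integral_eq_integral AE_I2) auto
  finally have "(\<integral>y. \<phi> y + K \<partial>(M \<bind> \<kappa>)) = (\<integral>x. (\<integral>y. \<phi> y \<partial>\<kappa> x) + K \<partial>M)"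
    using nonneg nonneg' by (subst (asm) ennreal_inj) (auto intro!: integral_nonneg_AE AE_I2)
  then show ?thesis using intB intM mass by (simp add: measure_def)
qed

text \<open>
  Cylinders are indexed by lists, one set for each of the consecutive times \<open>m, m + 1, \<dots>\<close>, so that their
  probabilities can be computed by recursion along the chain.
\<close>

definition cylinder :: "nat \<Rightarrow> 'g set list \<Rightarrow> (nat \<Rightarrow> 'g) set" where
  "cylinder m As = {\<omega>. \<forall>j<length As. \<omega> (m + j) \<in> As ! j}"

lemma cylinder_Nil [simp]: "cylinder m [] = UNIV"
  by (simp add: cylinder_def)

lemma cylinder_Cons: "cylinder m (A # As) = {\<omega>. \<omega> m \<in> A} \<inter> cylinder (Suc m) As"
  by (auto simp: cylinder_def less_Suc_eq_0_disj)

lemma space_path [simp]: "space path_algebra = UNIV"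
  by (simp add: space_PiM)

lemma UNIV_path [simp]: "UNIV \<in> sets path_algebra"
  using sets.top[of path_algebra] by simp

lemma measurable_comp_coordinate:
  assumes "u \<in> N \<rightarrow>\<^sub>M L" "i \<in> I" shows "(\<lambda>\<omega>. u (\<omega> i)) \<in> PiM I (\<lambda>_. N) \<rightarrow>\<^sub>M L"
proof -
  have "(\<lambda>\<omega>. \<omega> i) \<in> PiM I (\<lambda>_. N) \<rightarrow>\<^sub>M N"
    using measurable_component_singleton[of i I "\<lambda>_. N"] assms(2) .
  then show ?thesis using assms(1) by (rule measurable_compose)
qed

lemma coordinate_set: "A \<in> sets borel \<Longrightarrow> {\<omega>. \<omega> n \<in> A} \<in> sets path_algebra"
  using measurable_sets[OF measurable_component_singleton[of n UNIV "\<lambda>_. borel"], of A]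
  by (simp add: vimage_def)

lemma sets_cylinder: "set As \<subseteq> sets borel \<Longrightarrow> cylinder m As \<in> sets path_algebra"
proof (induction As arbitrary: m)
  case (Cons A As)
  have "{\<omega>. \<omega> m \<in> A} \<in> sets path_algebra" using Cons.prems by (intro coordinate_set) auto
  with Cons show ?case unfolding cylinder_Cons by (intro sets.Int) auto
qed (use sets.top[of path_algebra] in simp)

lemma prod_emb_eq_cylinder:
  assumes J: "finite J" and E: "\<And>i. i \<in> J \<Longrightarrow> E i \<in> sets (borel::'g::topological_space measure)"
  obtains As where "set As \<subseteq> sets borel" "prod_emb UNIV (\<lambda>_. borel::'g measure) J (Pi\<^sub>E J E) = cylinder 0 As"
proof
  \<comment> \<open>\<open>0\<close> is inserted because \<open>J\<close> may be empty and then has no maximum\<close>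
  let ?As = "map (\<lambda>j. if j \<in> J then E j else UNIV) [0..<Suc (Max (insert 0 J))]"
  have le: "j < Suc (Max (insert 0 J))" if "j \<in> J" for j
    using J that by (simp add: less_Suc_eq_le)
  show "set ?As \<subseteq> sets borel" using E by auto
  show "prod_emb UNIV (\<lambda>_. borel::'g measure) J (Pi\<^sub>E J E) = cylinder 0 ?As"
    using le by (auto simp: prod_emb_def cylinder_def PiE_iff space_PiM nth_map_upt simp del: upt_Suc
      split: if_splits)
qed

text \<open>
  Times without a condition can be filled with the whole space, so the cylinders are all
  the rectangles that generate the path algebra.
\<close>

lemma path_measure_eqI:
  fixes P Q :: "(nat \<Rightarrow> 'g::topological_space) measure"
  assumes "sets P = sets path_algebra" "sets Q = sets path_algebra" "finite_measure P"
    and eq: "\<And>As. set As \<subseteq> sets borel \<Longrightarrow> emeasure P (cylinder 0 As) = emeasure Q (cylinder 0 As)"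
  shows "P = Q"
proof (rule measure_eqI_PiM_infinite[OF assms(1,2) _ assms(3)])
  fix A :: "nat \<Rightarrow> 'g set" and J :: "nat set"
  assume "finite J" "\<And>i. i \<in> J \<Longrightarrow> A i \<in> sets borel"
  then obtain As where "set As \<subseteq> sets borel" "prod_emb UNIV (\<lambda>_. borel::'g measure) J (Pi\<^sub>E J A) = cylinder 0 As"
    by (rule prod_emb_eq_cylinder)
  with eq show "emeasure P (prod_emb UNIV (\<lambda>_. borel::'g measure) J (Pi\<^sub>E J A)) =
      emeasure Q (prod_emb UNIV (\<lambda>_. borel::'g measure) J (Pi\<^sub>E J A))" by metis
qed

text \<open>
  The algebra of the times \<open>0, \<dots>, n - 1\<close>; thus the position at time \<open>n\<close> is known from \<open>past (Suc n)\<close>.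
\<close>

definition past :: "nat \<Rightarrow> (nat \<Rightarrow> 'g::topological_space) measure" where
  "past n = vimage_algebra UNIV (\<lambda>\<omega>. restrict \<omega> {0..<n}) (PiM {0..<n} (\<lambda>_. borel))"

lemma space_past [simp]: "space (past n) = UNIV"
  by (simp add: past_def)

lemma sets_past: "sets (past n) = {(\<lambda>\<omega>. restrict \<omega> {0..<n}) -` B | B. B \<in> sets (PiM {0..<n} (\<lambda>_. borel))}"
  unfolding past_def by (subst sets_vimage_algebra2) (auto simp: space_PiM)

lemma measurable_restrict_past: "(\<lambda>\<omega>. restrict \<omega> {0..<n}) \<in> past n \<rightarrow>\<^sub>M PiM {0..<n} (\<lambda>_. borel)"
  unfolding past_def by (rule measurable_vimage_algebra1) (auto simp: space_PiM)

lemma measurable_restrict_path: "(\<lambda>\<omega>. restrict \<omega> {0..<n}) \<in> path_algebra \<rightarrow>\<^sub>M PiM {0..<n} (\<lambda>_. borel)"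
  by (rule measurable_restrict_subset) simp

lemma subalgebra_past: "subalgebra path_algebra (past n)"
  unfolding subalgebra_def using measurable_sets[OF measurable_restrict_path[of n]] by (auto simp: sets_past)

lemma sets_past_mono: assumes "m \<le> n" shows "sets (past m) \<subseteq> sets (past n)"
proof
  fix A assume "A \<in> sets (past m)"
  then obtain B where B: "A = (\<lambda>\<omega>. restrict \<omega> {0..<m}) -` B" "B \<in> sets (PiM {0..<m} (\<lambda>_. borel))"
    by (auto simp: sets_past)
  let ?r = "\<lambda>\<omega>. restrict \<omega> {0..<m}"
  have "?r \<in> PiM {0..<n} (\<lambda>_. borel) \<rightarrow>\<^sub>M PiM {0..<m} (\<lambda>_. borel)"
    using assms by (intro measurable_restrict_subset) auto
  then have "?r -` B \<inter> space (PiM {0..<n} (\<lambda>_. borel)) \<in> sets (PiM {0..<n} (\<lambda>_. borel))"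
    using B(2) by (rule measurable_sets)
  moreover have "A = (\<lambda>\<omega>. restrict \<omega> {0..<n}) -` (?r -` B \<inter> space (PiM {0..<n} (\<lambda>_. borel)))"
    using assms unfolding B(1) by (auto simp: space_PiM restrict_restrict Int_absorb1 inf.absorb2)
  ultimately show "A \<in> sets (past n)" unfolding sets_past by blast
qed

lemma measurable_coordinate_past:
  assumes "j < n" shows "(\<lambda>\<omega>. \<omega> j) \<in> past n \<rightarrow>\<^sub>M borel"
proof -
  have "(\<lambda>\<omega>. restrict \<omega> {0..<n} j) \<in> past n \<rightarrow>\<^sub>M borel"
    using measurable_restrict_past measurable_component_singleton[of j "{0..<n}" "\<lambda>_. borel"] assms
    by (intro measurable_compose[OF measurable_restrict_past measurable_component_singleton]) auto
  then show ?thesis using assms by simp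
qed

lemma sets_path_eq_sigma_past:
  "sets (path_algebra :: (nat \<Rightarrow> 'g::topological_space) measure) = sigma_sets UNIV (\<Union>n. sets (past n))"
proof
  show "sigma_sets UNIV (\<Union>n. sets (past n)) \<subseteq> sets (path_algebra :: (nat \<Rightarrow> 'g) measure)"
    using subalgebra_past sets.sigma_sets_subset[of "\<Union>n. sets (past n)" path_algebra]
    by (auto simp: subalgebra_def)
  have "sets path_algebra = sigma_sets UNIV {{\<omega>. \<omega> i \<in> A} |(i::nat) A. A \<in> sets (borel::'g measure)}"
    by (simp add: sets_PiM_single)
  also have "\<dots> \<subseteq> sigma_sets UNIV (\<Union>n. sets (past n))"
  proof (rule sigma_sets_mono', rule subsetI)
    fix X assume "X \<in> {{\<omega>. \<omega> i \<in> A} |(i::nat) A. A \<in> sets (borel::'g measure)}"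
    then obtain i :: nat and A where A: "A \<in> sets borel" "X = {\<omega>. \<omega> i \<in> A}" by auto
    have "(\<lambda>\<omega>. \<omega> i) -` A \<inter> space (past (Suc i)) \<in> sets (past (Suc i))"
      using measurable_coordinate_past[of i "Suc i"] A(1) by (intro measurable_sets) auto
    then show "X \<in> (\<Union>n. sets (past n))" unfolding A(2) by (auto simp: vimage_def)
  qed
  finally show "sets (path_algebra :: (nat \<Rightarrow> 'g) measure) \<subseteq> sigma_sets UNIV (\<Union>n. sets (past n))" .
qed

section \<open>The Markov property of the random walk\<close>

locale random_walk =
  fixes \<mu> :: "'g::{topological_group_add, t2_space} measure"
  assumes regular: "regular_borel_prob \<mu>"
begin

lemma prob_space_\<mu>: "prob_space \<mu>" and sets_\<mu> [measurable_cong]: "sets \<mu> = sets borel"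
  using regular unfolding regular_borel_prob_def by auto

lemma sets_walk_law [simp, measurable_cong]: "sets (walk_law \<mu> g) = sets path_algebra"
proof -
  interpret IT: Ionescu_Tulcea "step_kernel \<mu> g" "\<lambda>_. borel" by (rule Ionescu_Tulcea_step_kernel[OF regular])
  show ?thesis unfolding walk_law_def by simp
qed

lemma space_walk_law [simp]: "space (walk_law \<mu> g) = UNIV"
  using sets_eq_imp_space_eq[OF sets_walk_law[of g]] by simp

lemma prob_space_walk_law: "prob_space (walk_law \<mu> g)"
proof -
  interpret IT: Ionescu_Tulcea "step_kernel \<mu> g" "\<lambda>_. borel" by (rule Ionescu_Tulcea_step_kernel[OF regular])
  have "prob_space (distr (walk_law \<mu> g) (PiM {} (\<lambda>_. borel)) (\<lambda>\<omega>. restrict \<omega> {}))"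
    unfolding walk_law_def using IT.distr_lim[of "{}"] IT.PF.prob_space_P[of "{}"] by simp
  then show ?thesis
    by (rule prob_space_distrD[rotated]) (auto intro!: measurable_restrict)
qed

text \<open>
  By the construction of Ionescu-Tulcea, the law of the first \<open>n + 1\<close> positions arises from that of
  the first \<open>n\<close> by one application of the kernel.
\<close>

lemma nn_integral_prefix:
  assumes F: "F \<in> borel_measurable (PiM {0..<Suc n} (\<lambda>_. borel))"
  shows "(\<integral>\<^sup>+\<omega>. F (restrict \<omega> {0..<Suc n}) \<partial>walk_law \<mu> g) =
    (\<integral>\<^sup>+\<omega>. (\<integral>\<^sup>+y. F ((restrict \<omega> {0..<n})(n := y)) \<partial>step_kernel \<mu> g n (restrict \<omega> {0..<n})) \<partial>walk_law \<mu> g)"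
proof -
  interpret IT: Ionescu_Tulcea "step_kernel \<mu> g" "\<lambda>_. borel" by (rule Ionescu_Tulcea_step_kernel[OF regular])
  let ?S = "\<lambda>n. PiM {0..<n} (\<lambda>_. borel) :: (nat \<Rightarrow> 'g) measure"
  let ?u = "\<lambda>_. undefined"
  have u: "?u \<in> space (?S 0)" by (simp add: space_PiM)
  have distr: "distr (walk_law \<mu> g) (?S n) (\<lambda>\<omega>. restrict \<omega> {0..<n}) = IT.C 0 n ?u" for n
  proof (rule measure_eqI)
    show "sets (distr (walk_law \<mu> g) (?S n) (\<lambda>\<omega>. restrict \<omega> {0..<n})) = sets (IT.C 0 n ?u)"
      using IT.sets_C[OF u, of n] by simp
    fix A assume "A \<in> sets (distr (walk_law \<mu> g) (?S n) (\<lambda>\<omega>. restrict \<omega> {0..<n}))"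
    then have A: "A \<in> sets (?S n)" by simp
    have "distr (walk_law \<mu> g) (?S n) (\<lambda>\<omega>. restrict \<omega> {0..<n}) = IT.CI {0..<n}"
      unfolding walk_law_def by (rule IT.distr_lim) simp
    moreover have "emeasure (IT.CI {0..<n}) A = emeasure (IT.C 0 n ?u) A"
    proof -
      have "prod_emb {0..<n} (\<lambda>_. borel) {0..<n} A = A"
        using sets.sets_into_space[OF A] by (intro prod_emb_id) (simp add: space_PiM)
      then show ?thesis using A IT.emeasure_CI[of "{0..<n}" n A] by simp
    qed
    ultimately show "emeasure (distr (walk_law \<mu> g) (?S n) (\<lambda>\<omega>. restrict \<omega> {0..<n})) A = emeasure (IT.C 0 n ?u) A"
      by simp
  qed
  have r: "(\<lambda>\<omega>. restrict \<omega> {0..<n}) \<in> walk_law \<mu> g \<rightarrow>\<^sub>M ?S n" for n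
    using measurable_restrict_path[of n] measurable_cong_sets[OF sets_walk_law[of g] refl] by auto
  have eP: "IT.eP n \<in> ?S n \<rightarrow>\<^sub>M subprob_algebra (?S (Suc n))" by (rule IT.measurable_eP)
  have spC: "space (IT.C 0 n ?u) = space (?S n)" using IT.space_C[OF u, of n] by simp
  have setsC: "sets (IT.C 0 n ?u) = sets (?S n)" using IT.sets_C[OF u, of n] by simp
  have "(\<integral>\<^sup>+\<omega>. F (restrict \<omega> {0..<Suc n}) \<partial>walk_law \<mu> g) = (\<integral>\<^sup>+\<omega>. F \<omega> \<partial>IT.C 0 (Suc n) ?u)"
    using F by (simp only: distr[symmetric]) (rule nn_integral_distr[OF r, symmetric], simp)
  also have "\<dots> = (\<integral>\<^sup>+\<omega>. (\<integral>\<^sup>+\<eta>. F \<eta> \<partial>IT.eP n \<omega>) \<partial>IT.C 0 n ?u)"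
    using eP setsC by (simp, intro nn_integral_bind[OF F]) (simp add: measurable_cong_sets[OF setsC refl])
  also have "\<dots> = (\<integral>\<^sup>+\<omega>. (\<integral>\<^sup>+\<eta>. F \<eta> \<partial>IT.eP n (restrict \<omega> {0..<n})) \<partial>walk_law \<mu> g)"
    unfolding distr[symmetric] using measurable_compose[OF eP nn_integral_measurable_subprob_algebra[OF F]]
    by (intro nn_integral_distr[OF r]) simp
  also have "\<dots> = (\<integral>\<^sup>+\<omega>. (\<integral>\<^sup>+y. F ((restrict \<omega> {0..<n})(n := y)) \<partial>step_kernel \<mu> g n (restrict \<omega> {0..<n})) \<partial>walk_law \<mu> g)"
    by (intro nn_integral_cong IT.nn_integral_eP F) (auto simp: space_PiM)
  finally show ?thesis .
qed

lemma nn_integral_start: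
  assumes u: "u \<in> borel_measurable borel"
  shows "(\<integral>\<^sup>+\<omega>. u (\<omega> 0) \<partial>walk_law \<mu> g) = u g"
proof -
  interpret prob_space "walk_law \<mu> g" by (rule prob_space_walk_law)
  have "(\<lambda>\<eta>. u (\<eta> 0)) \<in> borel_measurable (PiM {0..<Suc 0} (\<lambda>_. borel))"
    by (rule measurable_comp_coordinate[OF u]) simp
  from nn_integral_prefix[OF this, of g] show ?thesis
    using u by (simp add: step_kernel_def nn_integral_return emeasure_space_1[simplified])
qed

text \<open>
  The Markov property for one step.
\<close>

lemma nn_integral_step:
  assumes A: "A \<in> sets (past (Suc n))" and u: "u \<in> borel_measurable borel"
  shows "(\<integral>\<^sup>+\<omega>. indicator A \<omega> * u (\<omega> (Suc n)) \<partial>walk_law \<mu> g) =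
    (\<integral>\<^sup>+\<omega>. indicator A \<omega> * (\<integral>\<^sup>+y. u y \<partial>transition \<mu> (\<omega> n)) \<partial>walk_law \<mu> g)"
proof -
  obtain B where B: "A = (\<lambda>\<omega>. restrict \<omega> {0..<Suc n}) -` B" "B \<in> sets (PiM {0..<Suc n} (\<lambda>_. borel))"
    using A unfolding sets_past by blast
  define F where "F \<eta> = indicator B (restrict \<eta> {0..<Suc n}) * u (\<eta> (Suc n))" for \<eta> :: "nat \<Rightarrow> 'g"
  have "(\<lambda>\<eta>. restrict \<eta> {0..<Suc n}) \<in> PiM {0..<Suc (Suc n)} (\<lambda>_. borel) \<rightarrow>\<^sub>M PiM {0..<Suc n} (\<lambda>_. borel::'g measure)"
    by (rule measurable_restrict_subset) auto
  moreover have "(\<lambda>\<eta>. u (\<eta> (Suc n))) \<in> borel_measurable (PiM {0..<Suc (Suc n)} (\<lambda>_. borel))"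
    by (rule measurable_comp_coordinate[OF u]) simp
  ultimately have F: "F \<in> borel_measurable (PiM {0..<Suc (Suc n)} (\<lambda>_. borel))"
    unfolding F_def using B(2) by (intro borel_measurable_times_ennreal measurable_compose[OF _ borel_measurable_indicator]) auto
  have r: "restrict (restrict \<omega> {0..<Suc (Suc n)}) {0..<Suc n} = restrict \<omega> {0..<Suc n}" for \<omega> :: "nat \<Rightarrow> 'g"
    by auto
  have r': "restrict ((restrict \<omega> {0..<Suc n})(Suc n := y)) {0..<Suc n} = restrict \<omega> {0..<Suc n}" for \<omega> :: "nat \<Rightarrow> 'g" and y
    by auto
  have meas: "u \<in> borel_measurable (transition \<mu> h)" for h using u unfolding transition_def by simp
  have "(\<integral>\<^sup>+\<omega>. indicator A \<omega> * u (\<omega> (Suc n)) \<partial>walk_law \<mu> g) = (\<integral>\<^sup>+\<omega>. F (restrict \<omega> {0..<Suc (Suc n)}) \<partial>walk_law \<mu> g)"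
    unfolding F_def r by (rule nn_integral_cong) (auto simp: B(1) indicator_def)
  also have "\<dots> = (\<integral>\<^sup>+\<omega>. (\<integral>\<^sup>+y. indicator A \<omega> * u y \<partial>transition \<mu> (\<omega> n)) \<partial>walk_law \<mu> g)"
    unfolding nn_integral_prefix[OF F] unfolding F_def r' by (rule nn_integral_cong) (auto simp: B(1) indicator_def step_kernel_def)
  also have "\<dots> = (\<integral>\<^sup>+\<omega>. indicator A \<omega> * (\<integral>\<^sup>+y. u y \<partial>transition \<mu> (\<omega> n)) \<partial>walk_law \<mu> g)"
    using meas by (simp add: nn_integral_cmult)
  finally show ?thesis .
qed

fun cylinder_prob :: "'g \<Rightarrow> 'g set list \<Rightarrow> ennreal" where
  "cylinder_prob g [] = 1"
| "cylinder_prob g (A # As) = indicator A g * (\<integral>\<^sup>+y. cylinder_prob y As \<partial>transition \<mu> g)"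

lemma measurable_cylinder_prob:
  "set As \<subseteq> sets borel \<Longrightarrow> (\<lambda>g. cylinder_prob g As) \<in> borel_measurable borel"
proof (induction As)
  case (Cons A As)
  then show ?case
    using measurable_compose[OF measurable_transition[OF regular] nn_integral_measurable_subprob_algebra]
    by (auto intro!: borel_measurable_times_ennreal)
qed simp

text \<open>
  The Markov property for cylinders. The induction on the list absorbs the condition at time \<open>m\<close> into the
  past event and moves to time \<open>m + 1\<close>, where the one-step property brings the remaining probability back
  to time \<open>m\<close>.
\<close>

lemma nn_integral_cylinder:
  assumes "A \<in> sets (past (Suc m))" "set As \<subseteq> sets borel"
  shows "(\<integral>\<^sup>+\<omega>. indicator (A \<inter> cylinder m As) \<omega> \<partial>walk_law \<mu> g) =
    (\<integral>\<^sup>+\<omega>. indicator A \<omega> * cylinder_prob (\<omega> m) As \<partial>walk_law \<mu> g)"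
  using assms
proof (induction As arbitrary: A m)
  case (Cons B As)
  have "{\<omega>. \<omega> m \<in> B} = (\<lambda>\<omega>. \<omega> m) -` B \<inter> space (past (Suc m))" by auto
  also have "\<dots> \<in> sets (past (Suc m))"
    using measurable_coordinate_past[of m "Suc m"] Cons.prems by (intro measurable_sets) auto
  finally have AB: "A \<inter> {\<omega>. \<omega> m \<in> B} \<in> sets (past (Suc m))" using Cons.prems by auto
  have AB': "A \<inter> {\<omega>. \<omega> m \<in> B} \<in> sets (past (Suc (Suc m)))"
    using AB sets_past_mono[of "Suc m" "Suc (Suc m)"] by auto
  have "(\<integral>\<^sup>+\<omega>. indicator (A \<inter> cylinder m (B # As)) \<omega> \<partial>walk_law \<mu> g) =
      (\<integral>\<^sup>+\<omega>. indicator ((A \<inter> {\<omega>. \<omega> m \<in> B}) \<inter> cylinder (Suc m) As) \<omega> \<partial>walk_law \<mu> g)"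
    unfolding cylinder_Cons Int_assoc ..
  also have "\<dots> = (\<integral>\<^sup>+\<omega>. indicator (A \<inter> {\<omega>. \<omega> m \<in> B}) \<omega> * cylinder_prob (\<omega> (Suc m)) As \<partial>walk_law \<mu> g)"
    using Cons.prems by (intro Cons.IH AB') auto
  also have "\<dots> = (\<integral>\<^sup>+\<omega>. indicator (A \<inter> {\<omega>. \<omega> m \<in> B}) \<omega> * (\<integral>\<^sup>+y. cylinder_prob y As \<partial>transition \<mu> (\<omega> m)) \<partial>walk_law \<mu> g)"
    using Cons.prems by (intro nn_integral_step[OF AB] measurable_cylinder_prob) auto
  also have "\<dots> = (\<integral>\<^sup>+\<omega>. indicator A \<omega> * cylinder_prob (\<omega> m) (B # As) \<partial>walk_law \<mu> g)"
    by (intro nn_integral_cong) (auto simp: indicator_def)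
  finally show ?case .
qed simp

lemma emeasure_cylinder:
  assumes As: "set As \<subseteq> sets borel"
  shows "emeasure (walk_law \<mu> g) (cylinder 0 As) = cylinder_prob g As"
proof -
  have U: "UNIV \<in> sets (past (Suc 0))" using sets.top[of "past (Suc 0)"] by simp
  have "emeasure (walk_law \<mu> g) (cylinder 0 As) = (\<integral>\<^sup>+\<omega>. cylinder_prob (\<omega> 0) As \<partial>walk_law \<mu> g)"
    using nn_integral_cylinder[OF U As, of g] sets_cylinder[OF As, of 0] by simp
  also have "\<dots> = cylinder_prob g As"
    by (rule nn_integral_start[OF measurable_cylinder_prob[OF As]])
  finally show ?thesis .
qed

text \<open>
  Dependence on the starting point is measurable because it is so for cylinders, by the recursion.
\<close>

lemma walk_law_prob_algebra: "walk_law \<mu> \<in> borel \<rightarrow>\<^sub>M prob_algebra path_algebra"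
proof (rule measurable_prob_algebra_generated)
  show "sets path_algebra = sigma_sets (UNIV \<rightarrow>\<^sub>E space borel) (prod_algebra UNIV (\<lambda>_. borel))"
    by (rule sets_PiM)
  show "Int_stable (prod_algebra UNIV (\<lambda>_. borel))" by (rule Int_stable_prod_algebra)
  show "prod_algebra UNIV (\<lambda>_. borel) \<subseteq> Pow (UNIV \<rightarrow>\<^sub>E space borel)" by (rule prod_algebra_sets_into_space)
  fix A :: "(nat \<Rightarrow> 'g) set" assume "A \<in> prod_algebra UNIV (\<lambda>_. borel)"
  then obtain J E where JE: "A = prod_emb UNIV (\<lambda>_. borel) J (Pi\<^sub>E J E)" "finite J" "\<And>i. i \<in> J \<Longrightarrow> E i \<in> sets borel"
    unfolding prod_algebra_def by auto
  obtain As where "set As \<subseteq> sets borel" "prod_emb UNIV (\<lambda>_. borel) J (Pi\<^sub>E J E) = cylinder 0 As"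
    by (rule prod_emb_eq_cylinder[OF JE(2,3)])
  with JE(1) show "(\<lambda>g. emeasure (walk_law \<mu> g) A) \<in> borel_measurable borel"
    using measurable_cylinder_prob by (simp add: emeasure_cylinder)
qed (auto intro: prob_space_walk_law)

lemma measurable_translate [measurable]: "translate g \<in> path_algebra \<rightarrow>\<^sub>M (path_algebra :: (nat \<Rightarrow> 'g) measure)"
  unfolding translate_def
  by (rule measurable_PiM_single') (auto intro: measurable_comp_coordinate[OF measurable_add_left])

text \<open>
  The steps of the walk act on the right, so they commute with left translations.
\<close>

lemma distr_walk_law_translate: "distr (walk_law \<mu> h) path_algebra (translate g) = walk_law \<mu> (g + h)"
proof (rule path_measure_eqI)
  interpret prob_space "walk_law \<mu> h" by (rule prob_space_walk_law)
  show "finite_measure (distr (walk_law \<mu> h) path_algebra (translate g))"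
    by (rule finite_measure_distr) measurable
  fix As :: "'g set list" assume As: "set As \<subseteq> sets borel"
  have translate_cylinder: "translate g -` cylinder 0 As = cylinder 0 (map ((-`) ((+) g)) As)"
    by (auto simp: cylinder_def translate_def)
  have vim: "(+) g -` A \<in> sets borel" if "A \<in> sets borel" for A :: "'g set"
    using measurable_sets[OF measurable_add_left that, of g] by simp
  then have As': "set (map ((-`) ((+) g)) As) \<subseteq> sets borel" using As by auto
  have prob: "cylinder_prob h (map ((-`) ((+) g)) As) = cylinder_prob (g + h) As" for h
    using As
  proof (induction As arbitrary: h)
    case (Cons A As)
    have "(\<integral>\<^sup>+y. cylinder_prob y As \<partial>transition \<mu> (g + h)) = (\<integral>\<^sup>+s. cylinder_prob (g + h + s) As \<partial>\<mu>)"
      unfolding transition_def using Cons.prems measurable_cylinder_prob by (subst nn_integral_distr) auto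
    also have "\<dots> = (\<integral>\<^sup>+s. cylinder_prob (h + s) (map ((-`) ((+) g)) As) \<partial>\<mu>)"
      using Cons by (simp add: add.assoc)
    also have "\<dots> = (\<integral>\<^sup>+y. cylinder_prob y (map ((-`) ((+) g)) As) \<partial>transition \<mu> h)"
    proof -
      have "set (map ((-`) ((+) g)) As) \<subseteq> sets borel" using Cons.prems vim by auto
      then show ?thesis
        unfolding transition_def using measurable_cylinder_prob by (subst nn_integral_distr) auto
    qed
    finally show ?case by (simp add: indicator_def)
  qed simp
  have "emeasure (distr (walk_law \<mu> h) path_algebra (translate g)) (cylinder 0 As) =
      emeasure (walk_law \<mu> h) (translate g -` cylinder 0 As)"
    using sets_cylinder[OF As] by (subst emeasure_distr) auto
  also have "\<dots> = emeasure (walk_law \<mu> (g + h)) (cylinder 0 As)"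
    unfolding translate_cylinder emeasure_cylinder[OF As'] emeasure_cylinder[OF As] by (rule prob)
  finally show "emeasure (distr (walk_law \<mu> h) path_algebra (translate g)) (cylinder 0 As) =
    emeasure (walk_law \<mu> (g + h)) (cylinder 0 As)" .
qed auto

lemma sets_past_walk_law: "A \<in> sets (past n) \<Longrightarrow> A \<in> sets (walk_law \<mu> g)"
  using subalgebra_past[of n] by (auto simp: subalgebra_def)

lemma finite_measure_walk_law_on: "finite_measure (density (walk_law \<mu> g) (indicator A))" if "A \<in> sets path_algebra"
proof (rule finite_measureI)
  interpret prob_space "walk_law \<mu> g" by (rule prob_space_walk_law)
  show "emeasure (density (walk_law \<mu> g) (indicator A)) (space (density (walk_law \<mu> g) (indicator A))) \<noteq> \<infinity>"
    using that emeasure_finite[of A] by (subst emeasure_density) auto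
qed

text \<open>
  The path after time \<open>m\<close>, on a past event \<open>A\<close>, is a fresh walk from the position at time \<open>m\<close>: both sides
  are finite measures with the same values on cylinders.
\<close>

lemma markov_property:
  assumes A: "A \<in> sets (past (Suc m))"
  shows "distr (density (walk_law \<mu> g) (indicator A)) path_algebra (\<lambda>\<omega> n. \<omega> (m + n)) =
    density (walk_law \<mu> g) (indicator A) \<bind> (\<lambda>\<omega>. walk_law \<mu> (\<omega> m))"
    (is "?L = ?R")
proof (rule path_measure_eqI)
  have AM [measurable]: "A \<in> sets path_algebra" using sets_past_walk_law[OF A] by simp
  have sh [measurable]: "(\<lambda>\<omega> n. \<omega> (m + n)) \<in> path_algebra \<rightarrow>\<^sub>M (path_algebra :: (nat \<Rightarrow> 'g) measure)"
    by (rule measurable_PiM_single') (auto intro: measurable_component_singleton)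
  have K: "(\<lambda>\<omega>. walk_law \<mu> (\<omega> m)) \<in> path_algebra \<rightarrow>\<^sub>M subprob_algebra path_algebra"
    by (rule measurable_comp_coordinate[OF measurable_prob_algebraD[OF walk_law_prob_algebra]]) simp
  interpret D: finite_measure "density (walk_law \<mu> g) (indicator A)" by (rule finite_measure_walk_law_on[OF AM])
  show "finite_measure ?L" by (rule D.finite_measure_distr) measurable
  show "sets ?R = sets path_algebra" by (rule sets_bind) auto
  fix As :: "'g set list" assume As: "set As \<subseteq> sets borel"
  have [measurable]: "(\<lambda>\<omega>. cylinder_prob (\<omega> m) As) \<in> borel_measurable path_algebra"
    by (rule measurable_comp_coordinate[OF measurable_cylinder_prob[OF As]]) simp
  note C = sets_cylinder[OF As, of m] sets_cylinder[OF As, of 0]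
  have "emeasure ?L (cylinder 0 As) = emeasure (density (walk_law \<mu> g) (indicator A)) (cylinder m As)"
  proof -
    have "(\<lambda>\<omega> n. \<omega> (m + n)) -` cylinder 0 As = (cylinder m As :: (nat \<Rightarrow> 'g) set)" by (auto simp: cylinder_def)
    then show ?thesis using C by (subst emeasure_distr) auto
  qed
  also have "\<dots> = (\<integral>\<^sup>+\<omega>. indicator (A \<inter> cylinder m As) \<omega> \<partial>walk_law \<mu> g)"
    by (subst emeasure_density) (simp, use C in simp, rule nn_integral_cong, simp add: indicator_inter_arith)
  also have "\<dots> = (\<integral>\<^sup>+\<omega>. indicator A \<omega> * cylinder_prob (\<omega> m) As \<partial>walk_law \<mu> g)"
    by (rule nn_integral_cylinder[OF A As])
  also have "\<dots> = (\<integral>\<^sup>+\<omega>. cylinder_prob (\<omega> m) As \<partial>density (walk_law \<mu> g) (indicator A))"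
    by (subst nn_integral_density) auto
  also have "\<dots> = emeasure ?R (cylinder 0 As)"
    using K C by (subst emeasure_bind[where N=path_algebra]) (auto simp: emeasure_cylinder[OF As])
  finally show "emeasure ?L (cylinder 0 As) = emeasure ?R (cylinder 0 As)" .
qed auto

lemma set_integral_markov:
  fixes \<phi> :: "(nat \<Rightarrow> 'g) \<Rightarrow> real"
  assumes A: "A \<in> sets (past (Suc m))" and \<phi>: "\<phi> \<in> borel_measurable path_algebra" "\<And>\<omega>. \<bar>\<phi> \<omega>\<bar> \<le> K"
  shows "(\<integral>\<omega>\<in>A. \<phi> (\<lambda>n. \<omega> (m + n)) \<partial>walk_law \<mu> g) = (\<integral>\<omega>\<in>A. (\<integral>\<eta>. \<phi> \<eta> \<partial>walk_law \<mu> (\<omega> m)) \<partial>walk_law \<mu> g)"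
proof -
  have AM [measurable]: "A \<in> sets path_algebra" using sets_past_walk_law[OF A] by simp
  have sh [measurable]: "(\<lambda>\<omega> n. \<omega> (m + n)) \<in> path_algebra \<rightarrow>\<^sub>M (path_algebra :: (nat \<Rightarrow> 'g) measure)"
    by (rule measurable_PiM_single') (auto intro: measurable_component_singleton)
  note [measurable] = \<phi>(1)
  have K: "(\<lambda>\<omega>. walk_law \<mu> (\<omega> m)) \<in> path_algebra \<rightarrow>\<^sub>M prob_algebra path_algebra"
    by (rule measurable_comp_coordinate[OF walk_law_prob_algebra]) simp
  have h: "(\<lambda>\<omega>. \<integral>\<eta>. \<phi> \<eta> \<partial>walk_law \<mu> (\<omega> m)) \<in> borel_measurable path_algebra"
    by (rule measurable_compose[OF measurable_prob_algebraD[OF K] integral_measurable_subprob_algebra[OF \<phi>(1)]])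
  have "(\<integral>\<omega>\<in>A. \<phi> (\<lambda>n. \<omega> (m + n)) \<partial>walk_law \<mu> g) =
      (\<integral>\<omega>. \<phi> (\<lambda>n. \<omega> (m + n)) \<partial>density (walk_law \<mu> g) (indicator A))"
    by (rule integral_density_indicator[symmetric]) auto
  also have "\<dots> = (\<integral>\<eta>. \<phi> \<eta> \<partial>distr (density (walk_law \<mu> g) (indicator A)) path_algebra (\<lambda>\<omega> n. \<omega> (m + n)))"
    by (rule integral_distr[symmetric]) auto
  also have "\<dots> = (\<integral>\<omega>. (\<integral>\<eta>. \<phi> \<eta> \<partial>walk_law \<mu> (\<omega> m)) \<partial>density (walk_law \<mu> g) (indicator A))"
    unfolding markov_property[OF A]
    by (rule integral_bind_bounded[where K=K and N=path_algebra, OF finite_measure_walk_law_on[OF AM]]) (use K \<phi> in auto)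
  also have "\<dots> = (\<integral>\<omega>\<in>A. (\<integral>\<eta>. \<phi> \<eta> \<partial>walk_law \<mu> (\<omega> m)) \<partial>walk_law \<mu> g)"
    by (rule integral_density_indicator) (use h in auto)
  finally show ?thesis .
qed

lemma integral_start:
  fixes u :: "'g \<Rightarrow> real"
  assumes [measurable]: "u \<in> borel_measurable borel"
  shows "(\<integral>\<omega>. u (\<omega> 0) \<partial>walk_law \<mu> g) = u g"
proof -
  have "distr (walk_law \<mu> g) borel (\<lambda>\<omega>. \<omega> 0) = return borel g"
  proof (rule measure_eqI)
    fix B assume "B \<in> sets (distr (walk_law \<mu> g) borel (\<lambda>\<omega>. \<omega> 0))"
    then have B [measurable]: "B \<in> sets borel" by simp
    have "emeasure (distr (walk_law \<mu> g) borel (\<lambda>\<omega>. \<omega> 0)) B = (\<integral>\<^sup>+\<omega>. indicator B (\<omega> 0) \<partial>walk_law \<mu> g)"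
      by (simp add: nn_integral_indicator[symmetric] nn_integral_distr del: nn_integral_indicator)
    then show "emeasure (distr (walk_law \<mu> g) borel (\<lambda>\<omega>. \<omega> 0)) B = emeasure (return borel g) B"
      by (simp add: nn_integral_start)
  qed simp
  then have "(\<integral>x. u x \<partial>distr (walk_law \<mu> g) borel (\<lambda>\<omega>. \<omega> 0)) = u g"
    by (simp add: integral_return)
  then show ?thesis by (subst (asm) integral_distr) auto
qed

lemma integral_first_step:
  fixes u :: "'g \<Rightarrow> real"
  assumes u [measurable]: "u \<in> borel_measurable borel" and K: "\<And>y. \<bar>u y\<bar> \<le> K"
  shows "(\<integral>\<omega>. u (\<omega> (Suc 0)) \<partial>walk_law \<mu> g) = (\<integral>s. u (g + s) \<partial>\<mu>)"
proof -
  have "distr (walk_law \<mu> g) borel (\<lambda>\<omega>. \<omega> (Suc 0)) = transition \<mu> g"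
  proof (rule measure_eqI)
    show "sets (distr (walk_law \<mu> g) borel (\<lambda>\<omega>. \<omega> (Suc 0))) = sets (transition \<mu> g)" by (simp add: transition_def)
    fix B assume "B \<in> sets (distr (walk_law \<mu> g) borel (\<lambda>\<omega>. \<omega> (Suc 0)))"
    then have B [measurable]: "B \<in> sets borel" by simp
    have U: "UNIV \<in> sets (past (Suc 0))" using sets.top[of "past (Suc 0)"] by simp
    have "emeasure (distr (walk_law \<mu> g) borel (\<lambda>\<omega>. \<omega> (Suc 0))) B = (\<integral>\<^sup>+\<omega>. indicator B (\<omega> (Suc 0)) \<partial>walk_law \<mu> g)"
      by (simp add: nn_integral_indicator[symmetric] nn_integral_distr del: nn_integral_indicator)
    also have "\<dots> = (\<integral>\<^sup>+\<omega>. (\<integral>\<^sup>+y. indicator B y \<partial>transition \<mu> (\<omega> 0)) \<partial>walk_law \<mu> g)"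
      using nn_integral_step[OF U, of "indicator B" g] by simp
    also have "\<dots> = (\<integral>\<^sup>+y. indicator B y \<partial>transition \<mu> g)"
      by (rule nn_integral_start)
        (rule measurable_compose[OF measurable_transition[OF regular] nn_integral_measurable_subprob_algebra], simp)
    finally show "emeasure (distr (walk_law \<mu> g) borel (\<lambda>\<omega>. \<omega> (Suc 0))) B = emeasure (transition \<mu> g) B"
      by (simp add: transition_def)
  qed
  then have "(\<integral>x. u x \<partial>distr (walk_law \<mu> g) borel (\<lambda>\<omega>. \<omega> (Suc 0))) = (\<integral>x. u x \<partial>transition \<mu> g)" by simp
  then show ?thesis unfolding transition_def by (simp add: integral_distr)
qed

end

section \<open>Shift invariance and properties holding universally almost everywhere\<close>

lemma sigma_algebra_invariant_sets: "sigma_algebra UNIV (invariant_sets :: (nat \<Rightarrow> 'g::topological_space) set set)"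
proof (rule sigma_algebra_iff2[THEN iffD2], intro conjI ballI allI impI)
  show "{} \<in> invariant_sets" by (simp add: invariant_sets_def)
  fix A :: "(nat \<Rightarrow> 'g) set" assume "A \<in> invariant_sets"
  then show "UNIV - A \<in> invariant_sets"
    using sets.compl_sets[of A path_algebra] by (auto simp: invariant_sets_def)
next
  fix A :: "nat \<Rightarrow> (nat \<Rightarrow> 'g) set" assume "range A \<subseteq> invariant_sets"
  then show "(\<Union>i. A i) \<in> invariant_sets" by (auto simp: invariant_sets_def)
qed auto

lemma space_invariant_algebra [simp]: "space invariant_algebra = UNIV"
  by (simp add: invariant_algebra_def space_measure_of_conv)

lemma sets_invariant_algebra [simp]: "sets invariant_algebra = invariant_sets"
  unfolding invariant_algebra_def using sigma_algebra.sets_measure_of_eq[OF sigma_algebra_invariant_sets] by simp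

lemma measurable_invariant_imp_path:
  "f \<in> invariant_algebra \<rightarrow>\<^sub>M N \<Longrightarrow> f \<in> path_algebra \<rightarrow>\<^sub>M N"
  unfolding measurable_def by (auto simp: invariant_sets_def)

text \<open>
  Points of the range are closed, so the level sets of a function measurable for the invariant algebra
  are invariant; that forces exact, not just almost sure, invariance of the function.
\<close>

lemma borel_measurable_invariant_iff:
  fixes f :: "(nat \<Rightarrow> 'g::topological_space) \<Rightarrow> 'b::t1_space"
  shows "f \<in> borel_measurable invariant_algebra \<longleftrightarrow>
    f \<in> borel_measurable path_algebra \<and> (\<forall>\<omega>. f (shift \<omega>) = f \<omega>)"
proof (intro iffI conjI allI)
  assume f: "f \<in> borel_measurable invariant_algebra"
  show "f \<in> borel_measurable path_algebra" by (rule measurable_invariant_imp_path[OF f])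
  fix \<omega>
  have "f -` {f \<omega>} \<inter> space invariant_algebra \<in> sets invariant_algebra"
    by (rule measurable_sets[OF f]) simp
  then have "shift -` (f -` {f \<omega>}) = f -` {f \<omega>}" by (simp add: invariant_sets_def)
  then have "\<omega> \<in> shift -` (f -` {f \<omega>})" by simp
  then show "f (shift \<omega>) = f \<omega>" by simp
next
  assume *: "f \<in> borel_measurable path_algebra \<and> (\<forall>\<omega>. f (shift \<omega>) = f \<omega>)"
  then show "f \<in> borel_measurable invariant_algebra"
    using measurable_sets[of f path_algebra borel]
    by (auto simp: measurable_def invariant_sets_def)
qed

lemma shift_funpow: "(\<lambda>n. \<omega> (m + n)) = (shift ^^ m) \<omega>"
  by (induction m arbitrary: \<omega>) (auto simp: shift_def funpow_swap1)

lemma invariant_drop: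
  assumes "\<And>\<omega>. f (shift \<omega>) = f \<omega>" shows "f (\<lambda>n. \<omega> (m + n)) = f \<omega>"
  unfolding shift_funpow by (induction m) (auto simp: assms)

lemma shift_translate: "shift (translate g \<omega>) = translate g (shift \<omega>)"
  by (simp add: shift_def translate_def)

context random_walk
begin

lemma uae_imp_AE: assumes "uae \<mu> P" shows "AE \<omega> in walk_law \<mu> g. P \<omega>"
proof -
  interpret prob_space "walk_law \<mu> g" by (rule prob_space_walk_law)
  from assms obtain A where A: "A \<in> invariant_sets" "emeasure (walk_law \<mu> g) A = 1" "\<And>\<omega>. \<omega> \<in> A \<Longrightarrow> P \<omega>"
    unfolding uae_def universally_conull_def by auto
  then have "AE \<omega> in walk_law \<mu> g. \<omega> \<in> A"
    by (intro AE_prob_1) (auto simp: emeasure_eq_measure invariant_sets_def)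
  then show ?thesis using A(3) by (auto elim: eventually_mono)
qed

lemma uaeI:
  assumes "A \<in> invariant_sets" "\<And>g. AE \<omega> in walk_law \<mu> g. \<omega> \<in> A" "\<And>\<omega>. \<omega> \<in> A \<Longrightarrow> P \<omega>"
  shows "uae \<mu> P"
  unfolding uae_def universally_conull_def
proof (intro bexI[of _ A] ballI)
  have "emeasure (walk_law \<mu> g) A = 1" for g
  proof -
    interpret prob_space "walk_law \<mu> g" by (rule prob_space_walk_law)
    show ?thesis using assms(1,2) by (intro emeasure_eq_1_AE) (auto simp: invariant_sets_def)
  qed
  then show "A \<in> {A \<in> invariant_sets. \<forall>g. emeasure (walk_law \<mu> g) A = 1}" using assms(1) by auto
qed (use assms(3) in auto)

lemma uae_mono: "uae \<mu> P \<Longrightarrow> (\<And>\<omega>. P \<omega> \<Longrightarrow> Q \<omega>) \<Longrightarrow> uae \<mu> Q"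
  unfolding uae_def by blast

lemma uae_True: "(\<And>\<omega>. P \<omega>) \<Longrightarrow> uae \<mu> P"
  by (rule uaeI[of UNIV]) (auto simp: invariant_sets_def)

lemma uae_conj:
  assumes "uae \<mu> P" "uae \<mu> Q" shows "uae \<mu> (\<lambda>\<omega>. P \<omega> \<and> Q \<omega>)"
proof -
  from assms obtain A B where AB: "A \<in> universally_conull \<mu>" "B \<in> universally_conull \<mu>" "\<And>\<omega>. \<omega> \<in> A \<Longrightarrow> P \<omega>" "\<And>\<omega>. \<omega> \<in> B \<Longrightarrow> Q \<omega>"
    unfolding uae_def by blast
  have "AE \<omega> in walk_law \<mu> g. \<omega> \<in> A" "AE \<omega> in walk_law \<mu> g. \<omega> \<in> B" for g
    using AB(1,2) by (auto intro!: uae_imp_AE simp: uae_def)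
  then show ?thesis
    using AB by (intro uaeI[of "A \<inter> B"]) (auto simp: universally_conull_def invariant_sets_def)
qed

lemma uae_not_null: assumes "\<Delta> \<in> universally_null \<mu>" shows "uae \<mu> (\<lambda>\<omega>. \<omega> \<notin> \<Delta>)"
proof (rule uaeI[of "- \<Delta>"])
  show "- \<Delta> \<in> invariant_sets"
    using assms sets.compl_sets[of \<Delta> path_algebra] by (auto simp: universally_null_def invariant_sets_def Compl_eq_Diff_UNIV)
  have "\<Delta> \<in> null_sets (walk_law \<mu> g)" for g
    using assms by (auto simp: universally_null_def invariant_sets_def null_sets_def)
  then show "AE \<omega> in walk_law \<mu> g. \<omega> \<in> - \<Delta>" for g using AE_not_in by fastforce
qed auto

lemma uae_obtain_null:
  assumes "uae \<mu> P" obtains \<Delta> where "\<Delta> \<in> universally_null \<mu>" "\<And>\<omega>. \<omega> \<notin> \<Delta> \<Longrightarrow> P \<omega>"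
proof -
  from assms obtain A where A: "A \<in> universally_conull \<mu>" "\<And>\<omega>. \<omega> \<in> A \<Longrightarrow> P \<omega>" unfolding uae_def by auto
  have "emeasure (walk_law \<mu> g) (- A) = 0" for g
  proof -
    interpret prob_space "walk_law \<mu> g" by (rule prob_space_walk_law)
    have "emeasure (walk_law \<mu> g) A = 1" "A \<in> events"
      using A(1) by (auto simp: universally_conull_def invariant_sets_def)
    then have "prob A = 1" by (simp add: measure_def)
    then have "prob (space (walk_law \<mu> g) - A) = 0" using \<open>A \<in> events\<close> by (simp only: prob_compl)
    then show ?thesis by (simp add: emeasure_eq_measure Compl_eq_Diff_UNIV)
  qed
  moreover have "- A \<in> invariant_sets"
    using A(1) sets.compl_sets[of A path_algebra] by (auto simp: universally_conull_def invariant_sets_def Compl_eq_Diff_UNIV)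
  ultimately show ?thesis using A(2) by (intro that[of "- A"]) (auto simp: universally_null_def)
qed

lemma uae_translate: assumes "uae \<mu> P" shows "uae \<mu> (\<lambda>\<omega>. P (translate g \<omega>))"
proof -
  from assms obtain A where A: "A \<in> invariant_sets" "\<And>\<omega>. \<omega> \<in> A \<Longrightarrow> P \<omega>" "A \<in> universally_conull \<mu>"
    unfolding uae_def universally_conull_def by auto
  show ?thesis
  proof (rule uaeI[of "translate g -` A"])
    have "translate g -` A \<inter> space path_algebra \<in> sets path_algebra"
      using A(1) by (intro measurable_sets[OF measurable_translate]) (auto simp: invariant_sets_def)
    moreover have "shift -` (translate g -` A) = translate g -` A"
    proof -
      have "shift -` (translate g -` A) = translate g -` (shift -` A)" by (auto simp: shift_translate)
      then show ?thesis using A(1) by (simp add: invariant_sets_def)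
    qed
    ultimately show "translate g -` A \<in> invariant_sets" by (simp add: invariant_sets_def)
    show "AE \<omega> in walk_law \<mu> h. \<omega> \<in> translate g -` A" for h
    proof -
      have "AE \<omega> in distr (walk_law \<mu> h) path_algebra (translate g). \<omega> \<in> A"
        unfolding distr_walk_law_translate by (rule uae_imp_AE) (use A(3) in \<open>auto simp: uae_def\<close>)
      then show ?thesis
        using A(1) by (subst (asm) AE_distr_iff) (auto simp: invariant_sets_def)
    qed
  qed (use A in auto)
qed

section \<open>Harmonic functions along the walk\<close>

text \<open>
  For a bounded invariant \<open>\<phi>\<close> this is the harmonic function on the group with boundary values \<open>\<phi>\<close>.
\<close>

definition poisson_integral :: "((nat \<Rightarrow> 'g) \<Rightarrow> 'b::{banach, second_countable_topology}) \<Rightarrow> 'g \<Rightarrow> 'b" where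
  "poisson_integral \<phi> g = (\<integral>\<omega>. \<phi> \<omega> \<partial>walk_law \<mu> g)"

lemma measurable_poisson:
  fixes \<phi> :: "(nat \<Rightarrow> 'g) \<Rightarrow> 'b::{banach, second_countable_topology}"
  assumes "\<phi> \<in> borel_measurable path_algebra"
  shows "poisson_integral \<phi> \<in> borel_measurable borel"
  unfolding poisson_integral_def
  by (rule measurable_compose[OF measurable_prob_algebraD[OF walk_law_prob_algebra] integral_measurable_subprob_algebra[OF assms]])

text \<open>
  The mean value property says that the expectation of \<open>u\<close> after one more step from \<open>h\<close> is \<open>u h\<close>; the
  Markov property carries this to any time and any past event.
\<close>

lemma martingale_along_walk:
  fixes u :: "'g \<Rightarrow> real"
  assumes u: "u \<in> borel_measurable borel" "\<And>g. \<bar>u g\<bar> \<le> K" and mean: "\<And>g. (\<integral>s. u (g + s) \<partial>\<mu>) = u g"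
  shows "bounded_martingale (walk_law \<mu> g) (\<lambda>n. past (Suc n)) (\<lambda>n \<omega>. u (\<omega> n)) K"
proof -
  interpret prob_space "walk_law \<mu> g" by (rule prob_space_walk_law)
  show ?thesis
  proof
    show "subalgebra (walk_law \<mu> g) (past (Suc n))" for n
      using subalgebra_past[of "Suc n"] by (simp add: subalgebra_def)
    show "sets (past (Suc m)) \<subseteq> sets (past (Suc n))" if "m \<le> n" for m n
      using that by (intro sets_past_mono) simp
    show "(\<lambda>\<omega>. u (\<omega> n)) \<in> borel_measurable (past (Suc n))" for n
      by (rule measurable_compose[OF measurable_coordinate_past u(1)]) simp
    show "\<bar>u (\<omega> n)\<bar> \<le> K" for \<omega> n by (rule u)
    fix A :: "(nat \<Rightarrow> 'g) set" and n assume A: "A \<in> sets (past (Suc n))"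
    have m: "(\<lambda>\<eta>. u (\<eta> 1)) \<in> borel_measurable path_algebra"
      by (rule measurable_comp_coordinate[OF u(1)]) simp
    have "(\<integral>\<eta>. u (\<eta> 1) \<partial>walk_law \<mu> h) = u h" for h
      using integral_first_step[OF u, of h] mean by simp
    then show "(\<integral>\<omega>\<in>A. u (\<omega> (Suc n)) \<partial>walk_law \<mu> g) = (\<integral>\<omega>\<in>A. u (\<omega> n) \<partial>walk_law \<mu> g)"
      using set_integral_markov[OF A m u(2), of g] by simp
  qed
qed

lemma AE_convergent_harmonic:
  fixes u :: "'g \<Rightarrow> 'k::euclidean_space"
  assumes u: "u \<in> borel_measurable borel" "\<And>g. norm (u g) \<le> K" and mean: "\<And>g. (\<integral>s. u (g + s) \<partial>\<mu>) = u g"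
  shows "AE \<omega> in walk_law \<mu> g. convergent (\<lambda>n. u (\<omega> n))"
proof -
  interpret \<mu>: prob_space \<mu> by (rule prob_space_\<mu>)
  have int: "integrable \<mu> (\<lambda>s. u (g + s))" for g
    using u measurable_compose[OF measurable_add_left u(1)]
    by (intro \<mu>.integrable_const_bound[where B=K]) auto
  have comp: "AE \<omega> in walk_law \<mu> g. convergent (\<lambda>n. u (\<omega> n) \<bullet> b)" if b: "b \<in> Basis" for b
  proof (rule bounded_martingale.AE_convergent, rule martingale_along_walk)
    show "(\<lambda>g. u g \<bullet> b) \<in> borel_measurable borel" using u by measurable
    show "\<bar>u g \<bullet> b\<bar> \<le> K" for g using u(2)[of g] Basis_le_norm[OF b, of "u g"] by linarith
    show "(\<integral>s. u (g + s) \<bullet> b \<partial>\<mu>) = u g \<bullet> b" for g using int[of g] mean[of g] by simp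
  qed
  have "AE \<omega> in walk_law \<mu> g. \<forall>b\<in>Basis. convergent (\<lambda>n. u (\<omega> n) \<bullet> b)"
    by (rule AE_finite_allI) (auto intro: comp)
  then show ?thesis
  proof eventually_elim
    case (elim \<omega>)
    then obtain L where L: "\<And>b. b \<in> Basis \<Longrightarrow> (\<lambda>n. u (\<omega> n) \<bullet> b) \<longlonglongrightarrow> L b" unfolding convergent_def by metis
    have "(\<lambda>n. \<Sum>b\<in>Basis. (u (\<omega> n) \<bullet> b) *\<^sub>R b) \<longlonglongrightarrow> (\<Sum>b\<in>Basis. L b *\<^sub>R b)"
      using L by (intro tendsto_intros) auto
    then show ?case by (auto simp: euclidean_representation convergent_def)
  qed
qed

lemma integral_along_walk:
  fixes u :: "'g \<Rightarrow> 'k::euclidean_space"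
  assumes u: "u \<in> borel_measurable borel" "\<And>g. norm (u g) \<le> K" and mean: "\<And>g. (\<integral>s. u (g + s) \<partial>\<mu>) = u g"
  shows "(\<integral>\<omega>. u (\<omega> n) \<partial>walk_law \<mu> g) = u g"
proof (rule euclidean_eqI)
  fix b :: 'k assume b: "b \<in> Basis"
  interpret \<mu>: prob_space \<mu> by (rule prob_space_\<mu>)
  interpret Q: prob_space "walk_law \<mu> g" by (rule prob_space_walk_law)
  have int: "integrable \<mu> (\<lambda>s. u (g + s))" for g
    using u measurable_compose[OF measurable_add_left u(1)]
    by (intro \<mu>.integrable_const_bound[where B=K]) auto
  have intQ: "integrable (walk_law \<mu> g) (\<lambda>\<omega>. u (\<omega> n))"
    using u measurable_comp_coordinate[OF u(1), of n UNIV]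
    by (intro Q.integrable_const_bound[where B=K]) auto
  have ub: "(\<lambda>g. u g \<bullet> b) \<in> borel_measurable borel" using u by measurable
  interpret bounded_martingale "walk_law \<mu> g" "\<lambda>n. past (Suc n)" "\<lambda>n \<omega>. u (\<omega> n) \<bullet> b" K
  proof (rule martingale_along_walk[of "\<lambda>g. u g \<bullet> b", OF ub])
    show "\<bar>u g \<bullet> b\<bar> \<le> K" for g using u(2)[of g] Basis_le_norm[OF b, of "u g"] by linarith
    show "(\<integral>s. u (g + s) \<bullet> b \<partial>\<mu>) = u g \<bullet> b" for g using int[of g] mean[of g] by simp
  qed
  have "(\<integral>\<omega>. 1 * (u (\<omega> n) \<bullet> b) \<partial>walk_law \<mu> g) = (\<integral>\<omega>. 1 * (u (\<omega> 0) \<bullet> b) \<partial>walk_law \<mu> g)"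
    by (rule integral_mult_adapted[where K=1]) auto
  then show "(\<integral>\<omega>. u (\<omega> n) \<partial>walk_law \<mu> g) \<bullet> b = u g \<bullet> b"
    using integral_start[OF ub, of g] intQ by simp
qed

text \<open>
  For invariant \<open>\<phi>\<close> the Markov property makes the Poisson integral at \<open>\<omega>\<^sub>n\<close> the conditional expectation of
  \<open>\<phi>\<close> given the path up to time \<open>n\<close>. At \<open>n = 1\<close> and on the whole space this is the mean value property, and
  for \<open>n \<rightarrow> \<infinity>\<close> Levy's theorem applies.
\<close>

lemma poisson_integral_invariant_real:
  fixes \<phi> :: "(nat \<Rightarrow> 'g) \<Rightarrow> real"
  assumes \<phi>: "\<phi> \<in> borel_measurable path_algebra" "\<And>\<omega>. \<bar>\<phi> \<omega>\<bar> \<le> K" "\<And>\<omega>. \<phi> (shift \<omega>) = \<phi> \<omega>"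
  shows poisson_integral_mean_value_real: "(\<integral>s. poisson_integral \<phi> (g + s) \<partial>\<mu>) = poisson_integral \<phi> g"
    and poisson_integral_tendsto_real: "AE \<omega> in walk_law \<mu> g. (\<lambda>n. poisson_integral \<phi> (\<omega> n)) \<longlonglongrightarrow> \<phi> \<omega>"
proof -
  have bd: "\<bar>poisson_integral \<phi> g\<bar> \<le> K" for g
  proof -
    interpret prob_space "walk_law \<mu> g" by (rule prob_space_walk_law)
    have "integrable (walk_law \<mu> g) \<phi>" using \<phi> by (intro integrable_const_bound[where B=K]) auto
    then have "- K \<le> (\<integral>\<omega>. \<phi> \<omega> \<partial>walk_law \<mu> g)" "(\<integral>\<omega>. \<phi> \<omega> \<partial>walk_law \<mu> g) \<le> K"
      using \<phi>(2) by (auto intro!: integral_ge_const integral_le_const AE_I2 simp: abs_le_iff minus_le_iff)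
    then show ?thesis unfolding poisson_integral_def by simp
  qed
  have condexp: "(\<integral>\<omega>\<in>A. poisson_integral \<phi> (\<omega> n) \<partial>walk_law \<mu> g) = (\<integral>\<omega>\<in>A. \<phi> \<omega> \<partial>walk_law \<mu> g)"
    if "A \<in> sets (past (Suc n))" for A n g
    using set_integral_markov[OF that \<phi>(1,2), of g] by (simp add: invariant_drop[of \<phi>, OF \<phi>(3)] poisson_integral_def)
  show mean: "(\<integral>s. poisson_integral \<phi> (g + s) \<partial>\<mu>) = poisson_integral \<phi> g" for g
  proof -
    have "UNIV \<in> sets (past (Suc 1))" using sets.top[of "past (Suc 1)"] by simp
    from condexp[OF this, of g] show ?thesis
      using integral_first_step[OF measurable_poisson[OF \<phi>(1)] bd, of g]
      by (simp add: set_lebesgue_integral_def poisson_integral_def[of \<phi> g])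
  qed
  show "AE \<omega> in walk_law \<mu> g. (\<lambda>n. poisson_integral \<phi> (\<omega> n)) \<longlonglongrightarrow> \<phi> \<omega>"
  proof (rule levy_upward[OF martingale_along_walk[OF measurable_poisson[OF \<phi>(1)] bd mean]])
    show "sets (walk_law \<mu> g) = sigma_sets (space (walk_law \<mu> g)) (\<Union>n. sets (past (Suc n)))"
    proof -
      have "(\<Union>n. sets (past n)) = (\<Union>n. sets (past (Suc n)) :: (nat \<Rightarrow> 'g) set set)"
        using sets_past_mono[of _ "Suc _"] by (auto intro: lessI less_imp_le)
      then show ?thesis by (simp add: sets_path_eq_sigma_past)
    qed
    show "AE \<omega> in walk_law \<mu> g. \<bar>\<phi> \<omega>\<bar> \<le> K" using \<phi>(2) by simp
  qed (use \<phi>(1) condexp in auto)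
qed

text \<open>
  Reduction to the real case by coordinates. The real case requires a bound at every path, so the
  coordinates are first set to \<open>0\<close> where \<open>\<phi>\<close> exceeds its almost sure bound; this keeps them invariant.
\<close>

lemma poisson_integral_invariant:
  fixes \<phi> :: "(nat \<Rightarrow> 'g) \<Rightarrow> 'k::euclidean_space"
  assumes \<phi>: "\<phi> \<in> borel_measurable invariant_algebra" and bd: "uae \<mu> (\<lambda>\<omega>. norm (\<phi> \<omega>) \<le> K)"
  shows poisson_integral_mean_value: "(\<integral>s. poisson_integral \<phi> (g + s) \<partial>\<mu>) = poisson_integral \<phi> g"
    and poisson_integral_tendsto: "AE \<omega> in walk_law \<mu> g. (\<lambda>n. poisson_integral \<phi> (\<omega> n)) \<longlonglongrightarrow> \<phi> \<omega>"
proof -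
  have \<phi>m [measurable]: "\<phi> \<in> borel_measurable path_algebra" and \<phi>s: "\<And>\<omega>. \<phi> (shift \<omega>) = \<phi> \<omega>"
    using \<phi> unfolding borel_measurable_invariant_iff by auto
  interpret \<mu>: prob_space \<mu> by (rule prob_space_\<mu>)
  have AEbd: "AE \<omega> in walk_law \<mu> g. norm (\<phi> \<omega>) \<le> K" for g by (rule uae_imp_AE[OF bd])
  have int: "integrable (walk_law \<mu> g) \<phi>" for g
  proof -
    interpret prob_space "walk_law \<mu> g" by (rule prob_space_walk_law)
    show ?thesis by (rule integrable_const_bound[OF AEbd]) simp
  qed
  have normE: "norm (poisson_integral \<phi> g) \<le> K" for g
  proof -
    interpret prob_space "walk_law \<mu> g" by (rule prob_space_walk_law)
    have "norm (poisson_integral \<phi> g) \<le> (\<integral>\<omega>. norm (\<phi> \<omega>) \<partial>walk_law \<mu> g)"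
      unfolding poisson_integral_def by (rule integral_norm_bound)
    also have "\<dots> \<le> K" using int AEbd by (intro integral_le_const) auto
    finally show ?thesis .
  qed
  define \<psi> where "\<psi> b \<omega> = (if norm (\<phi> \<omega>) \<le> K then \<phi> \<omega> \<bullet> b else 0)" for b \<omega>
  have \<psi>m: "\<psi> b \<in> borel_measurable path_algebra" for b unfolding \<psi>_def by measurable
  have \<psi>s: "\<psi> b (shift \<omega>) = \<psi> b \<omega>" for b \<omega> by (simp add: \<psi>_def \<phi>s)
  have \<psi>b: "\<bar>\<psi> b \<omega>\<bar> \<le> \<bar>K\<bar>" if "b \<in> Basis" for b \<omega>
    using Basis_le_norm[OF that, of "\<phi> \<omega>"] by (auto simp: \<psi>_def)
  have \<psi>\<phi>: "AE \<omega> in walk_law \<mu> g. \<psi> b \<omega> = \<phi> \<omega> \<bullet> b" for b g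
    using AEbd by eventually_elim (simp add: \<psi>_def)
  have E: "poisson_integral (\<psi> b) g = poisson_integral \<phi> g \<bullet> b" for b g
  proof -
    have "poisson_integral (\<psi> b) g = (\<integral>\<omega>. \<phi> \<omega> \<bullet> b \<partial>walk_law \<mu> g)"
      unfolding poisson_integral_def by (rule integral_cong_AE[OF _ _ \<psi>\<phi>]) (use \<psi>m in auto)
    then show ?thesis using int by (simp add: poisson_integral_def)
  qed
  show "(\<integral>s. poisson_integral \<phi> (g + s) \<partial>\<mu>) = poisson_integral \<phi> g"
  proof (rule euclidean_eqI)
    fix b :: 'k assume b: "b \<in> Basis"
    have "integrable \<mu> (\<lambda>s. poisson_integral \<phi> (g + s))"
      using normE measurable_compose[OF measurable_add_left measurable_poisson[OF \<phi>m]]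
      by (intro \<mu>.integrable_const_bound[where B=K]) auto
    then show "(\<integral>s. poisson_integral \<phi> (g + s) \<partial>\<mu>) \<bullet> b = poisson_integral \<phi> g \<bullet> b"
      using poisson_integral_mean_value_real[OF \<psi>m \<psi>b[OF b] \<psi>s, of g] by (simp add: E)
  qed
  have "AE \<omega> in walk_law \<mu> g. \<forall>b\<in>Basis. (\<lambda>n. poisson_integral \<phi> (\<omega> n) \<bullet> b) \<longlonglongrightarrow> \<phi> \<omega> \<bullet> b"
  proof (rule AE_finite_allI)
    fix b :: 'k assume b: "b \<in> Basis"
    show "AE \<omega> in walk_law \<mu> g. (\<lambda>n. poisson_integral \<phi> (\<omega> n) \<bullet> b) \<longlonglongrightarrow> \<phi> \<omega> \<bullet> b"
      using poisson_integral_tendsto_real[OF \<psi>m \<psi>b[OF b] \<psi>s, of g] \<psi>\<phi>[of b g]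
      by eventually_elim (simp add: E)
  qed simp
  then show "AE \<omega> in walk_law \<mu> g. (\<lambda>n. poisson_integral \<phi> (\<omega> n)) \<longlonglongrightarrow> \<phi> \<omega>"
    by eventually_elim (simp add: tendsto_componentwise_iff[where f="\<lambda>n. poisson_integral \<phi> (_ n)"])
qed

end

section \<open>The weak* topology of the dual of a separable space\<close>

lemma limitin_strong_operator_topology:
  "limitin strong_operator_topology X l F \<longleftrightarrow> (\<forall>v. ((\<lambda>n. blinfun_apply (X n) v) \<longlongrightarrow> blinfun_apply l v) F)"
proof -
  have "limitin strong_operator_topology X l F \<longleftrightarrow> limitin euclidean (\<lambda>n. blinfun_apply (X n)) (blinfun_apply l) F"
    unfolding limitin_def strong_operator_topology_def topspace_pullback_topology
    by (auto simp: openin_pullback_topology)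
  also have "\<dots> \<longleftrightarrow> (\<forall>v. ((\<lambda>n. blinfun_apply (X n) v) \<longlongrightarrow> blinfun_apply l v) F)"
    unfolding euclidean_product_topology[symmetric] limitin_componentwise by auto
  finally show ?thesis .
qed

lemma limitin_weak_star:
  assumes "\<And>n. X n \<in> dual smul"
  shows "limitin (weak_star smul) X l F \<longleftrightarrow>
    l \<in> dual smul \<and> (\<forall>v. ((\<lambda>n. blinfun_apply (X n) v) \<longlongrightarrow> blinfun_apply l v) F)"
  using assms unfolding weak_star_def limitin_subtopology limitin_strong_operator_topology by auto

lemma openin_weak_star_imp_dual: "openin (weak_star smul) U \<Longrightarrow> U \<subseteq> dual smul"
  unfolding weak_star_def by (auto simp: openin_subtopology)

lemma space_weak_star_borel [simp]: "space (weak_star_borel smul) = dual smul"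
  unfolding weak_star_borel_def by (rule space_measure_of) (auto dest: openin_weak_star_imp_dual)

lemma sets_weak_star_borel: "sets (weak_star_borel smul) = sigma_sets (dual smul) {U. openin (weak_star smul) U}"
  unfolding weak_star_borel_def by (rule sets_measure_of) (auto dest: openin_weak_star_imp_dual)

lemma measurable_evaluation:
  fixes smul :: "'k::real_normed_field \<Rightarrow> 'a::real_normed_vector \<Rightarrow> 'a"
  shows "(\<lambda>x. blinfun_apply x v) \<in> borel_measurable (weak_star_borel smul)"
proof (rule borel_measurableI)
  fix S :: "'k set" assume "open S"
  have "openin strong_operator_topology {x \<in> topspace strong_operator_topology. blinfun_apply x v \<in> S}"
    using \<open>open S\<close> strong_operator_topology_continuous_evaluation[of v] unfolding continuous_map_def by auto
  then have "openin (weak_star smul) ((\<lambda>x. blinfun_apply x v) -` S \<inter> dual smul)"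
    unfolding weak_star_def openin_subtopology by (auto simp: strong_operator_topology_topspace vimage_def)
  then show "(\<lambda>x. blinfun_apply x v) -` S \<inter> space (weak_star_borel smul) \<in> sets (weak_star_borel smul)"
    unfolding sets_weak_star_borel by auto
qed

lemma dense_sequence:
  fixes D :: "'a::real_normed_vector set"
  assumes D: "countable D" "closure D = UNIV"
  shows "(\<forall>d\<in>D. Q d) \<longleftrightarrow> (\<forall>i. Q (from_nat_into D i))"
proof -
  have "D \<noteq> {}" using D(2) by auto
  then have r: "range (from_nat_into D) = D" using D(1) by (rule range_from_nat_into)
  have "(\<forall>d\<in>D. Q d) \<longleftrightarrow> (\<forall>d\<in>range (from_nat_into D). Q d)" by (simp only: r)
  then show "(\<forall>d\<in>D. Q d) \<longleftrightarrow> (\<forall>i. Q (from_nat_into D i))" by simp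
qed

lemma norm_le_iff_dense:
  fixes x :: "'a::real_normed_vector \<Rightarrow>\<^sub>L 'b::real_normed_vector"
  assumes D: "closure D = UNIV" and c: "0 \<le> c"
  shows "norm x \<le> c \<longleftrightarrow> (\<forall>d\<in>D. norm (blinfun_apply x d) \<le> c * norm d)"
proof
  assume "norm x \<le> c"
  then show "\<forall>d\<in>D. norm (blinfun_apply x d) \<le> c * norm d"
    by (meson norm_blinfun mult_right_mono norm_ge_zero order_trans)
next
  assume *: "\<forall>d\<in>D. norm (blinfun_apply x d) \<le> c * norm d"
  have "closed {v. norm (blinfun_apply x v) \<le> c * norm v}"
    by (intro closed_Collect_le continuous_intros)
  then have "closure D \<subseteq> {v. norm (blinfun_apply x v) \<le> c * norm v}"
    using * by (intro closure_minimal) auto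
  then show "norm x \<le> c" using D c by (intro norm_blinfun_bound) auto
qed

text \<open>
  On a ball the weak* topology has a countable base: evaluations at finitely many vectors can be replaced
  by evaluations at nearby vectors of the dense set \<open>D\<close>, because functionals of norm at most \<open>n\<close> vary by
  at most \<open>n\<delta>\<close> over a distance \<open>\<delta>\<close>.
\<close>

lemma weak_star_open_ball_basis:
  fixes smul :: "'k::{real_normed_field, euclidean_space} \<Rightarrow> 'a::real_normed_vector \<Rightarrow> 'a"
  assumes D: "closure D = UNIV" and B: "topological_basis B"
    and U: "openin (weak_star smul) U" and x: "x \<in> U" "norm x \<le> real n"
  obtains P where "finite P" "P \<subseteq> D \<times> B" "\<forall>(d, V)\<in>P. blinfun_apply x d \<in> V"
    "\<And>y. y \<in> dual smul \<Longrightarrow> norm y \<le> real n \<Longrightarrow> \<forall>(d, V)\<in>P. blinfun_apply y d \<in> V \<Longrightarrow> y \<in> U"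
proof -
  obtain U' where U': "open U'" "U = {y \<in> dual smul. blinfun_apply y \<in> U'}"
    using U unfolding weak_star_def openin_subtopology strong_operator_topology_def openin_pullback_topology
    by auto
  have op: "openin (product_topology (\<lambda>_::'a. euclidean :: 'k topology) UNIV) U'"
    unfolding euclidean_product_topology using U'(1) by (simp only: open_openin[symmetric])
  obtain X where X: "blinfun_apply x \<in> Pi\<^sub>E UNIV X" "\<And>i. open (X i)" "finite {i. X i \<noteq> UNIV}" "Pi\<^sub>E UNIV X \<subseteq> U'"
    using product_topology_open_contains_basis[OF op, of "blinfun_apply x"] U'(2) x(1) by auto
  define I where "I = {i. X i \<noteq> UNIV}"
  have fin: "finite I" using X(3) unfolding I_def .
  have "\<exists>d V. d \<in> D \<and> V \<in> B \<and> blinfun_apply x d \<in> V \<and>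
      (\<forall>y. norm y \<le> real n \<longrightarrow> blinfun_apply y d \<in> V \<longrightarrow> blinfun_apply y i \<in> X i)" for i
  proof -
    have "blinfun_apply x i \<in> X i" using X(1) by auto
    then obtain e where e: "0 < e" "ball (blinfun_apply x i) e \<subseteq> X i"
      using X(2) open_contains_ball by blast
    \<comment> \<open>three errors of \<open>e / 3\<close>; \<open>n + 1\<close> instead of \<open>n\<close> because \<open>n\<close> may be \<open>0\<close>\<close>
    define \<delta> where "\<delta> = e / (3 * (real n + 1))"
    have \<delta>: "0 < \<delta>" "real n * \<delta> \<le> e / 3"
      using e(1) by (auto simp: \<delta>_def field_simps)
    have "i \<in> closure D" using D by simp
    then obtain d where d: "d \<in> D" "dist d i < \<delta>" using \<delta>(1) closure_approachable by blast
    obtain V where V: "V \<in> B" "blinfun_apply x d \<in> V" "V \<subseteq> ball (blinfun_apply x d) (e/3)"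
      using topological_basisE[OF B, of "ball (blinfun_apply x d) (e/3)" "blinfun_apply x d"] e(1) by auto
    have approx: "norm (blinfun_apply y i - blinfun_apply y d) \<le> e / 3" if "norm y \<le> real n"
      for y :: "'a \<Rightarrow>\<^sub>L 'k"
    proof -
      have "norm (blinfun_apply y i - blinfun_apply y d) \<le> norm y * norm (i - d)"
        by (simp add: blinfun.diff_right[symmetric] norm_blinfun)
      also have "\<dots> \<le> real n * \<delta>"
        using that d(2) by (intro mult_mono) (auto simp: dist_norm norm_minus_commute)
      finally show ?thesis using \<delta>(2) by simp
    qed
    have "blinfun_apply y i \<in> X i" if y: "norm y \<le> real n" "blinfun_apply y d \<in> V" for y
    proof -
      have "norm (blinfun_apply x d - blinfun_apply y d) < e / 3"
        using V(3) y(2) by (auto simp: dist_norm)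
      then have "norm (blinfun_apply x i - blinfun_apply y i) < e"
        using approx[OF y(1)] approx[OF x(2)]
          norm_triangle_ineq[of "blinfun_apply x i - blinfun_apply x d" "blinfun_apply x d - blinfun_apply y i"]
          norm_triangle_ineq[of "blinfun_apply x d - blinfun_apply y d" "blinfun_apply y d - blinfun_apply y i"]
        by (simp add: norm_minus_commute)
      then show ?thesis using e(2) by (auto simp: dist_norm)
    qed
    then show ?thesis using d V by blast
  qed
  then obtain d V where dV: "\<And>i. d i \<in> D" "\<And>i. V i \<in> B" "\<And>i. blinfun_apply x (d i) \<in> V i"
    "\<And>i y. norm y \<le> real n \<Longrightarrow> blinfun_apply y (d i) \<in> V i \<Longrightarrow> blinfun_apply y i \<in> X i"
    by metis
  show ?thesis
  proof (rule that[of "(\<lambda>i. (d i, V i)) ` I"])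
    fix y :: "'a \<Rightarrow>\<^sub>L 'k"
    assume y: "y \<in> dual smul" "norm y \<le> real n" "\<forall>(d, V)\<in>(\<lambda>i. (d i, V i)) ` I. blinfun_apply y d \<in> V"
    have "blinfun_apply y i \<in> X i" for i
      using dV(4)[OF y(2), of i] y(3) by (cases "i \<in> I") (auto simp: I_def)
    then have "blinfun_apply y \<in> U'" using X(4) by auto
    then show "y \<in> U" using U' y by simp
  qed (use fin dV in auto)
qed

text \<open>
  A weak* open set need not be a countable union of basic open sets, but its intersection with each ball
  is, relative to the ball. The balls exhaust the dual, and \<open>norm (f \<omega>) \<le> n\<close> is a countable condition
  on evaluations at \<open>D\<close>, so measurable evaluations suffice.
\<close>

lemma measurable_weak_star_borel_iff:
  fixes smul :: "'k::{real_normed_field, euclidean_space} \<Rightarrow> 'a::real_normed_vector \<Rightarrow> 'a" and D :: "'a set"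
  assumes D: "countable D" "closure D = UNIV"
  shows "f \<in> M \<rightarrow>\<^sub>M weak_star_borel smul \<longleftrightarrow>
    (\<forall>\<omega>\<in>space M. f \<omega> \<in> dual smul) \<and> (\<forall>v. (\<lambda>\<omega>. blinfun_apply (f \<omega>) v) \<in> borel_measurable M)"
proof (intro iffI conjI ballI allI)
  assume f: "f \<in> M \<rightarrow>\<^sub>M weak_star_borel smul"
  show "f \<omega> \<in> dual smul" if "\<omega> \<in> space M" for \<omega> using measurable_space[OF f that] by simp
  show "(\<lambda>\<omega>. blinfun_apply (f \<omega>) v) \<in> borel_measurable M" for v
    by (rule measurable_compose[OF f measurable_evaluation])
next
  assume "(\<forall>\<omega>\<in>space M. f \<omega> \<in> dual smul) \<and> (\<forall>v. (\<lambda>\<omega>. blinfun_apply (f \<omega>) v) \<in> borel_measurable M)"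
  then have f: "\<And>\<omega>. \<omega> \<in> space M \<Longrightarrow> f \<omega> \<in> dual smul"
    and [measurable]: "\<And>v. (\<lambda>\<omega>. blinfun_apply (f \<omega>) v) \<in> borel_measurable M" by auto
  obtain B :: "'k set set" where B: "countable B" "topological_basis B" using ex_countable_basis by blast
  show "f \<in> M \<rightarrow>\<^sub>M weak_star_borel smul"
    unfolding weak_star_borel_def
  proof (rule measurable_measure_of)
    show "{U. openin (weak_star smul) U} \<subseteq> Pow (dual smul)" by (auto dest: openin_weak_star_imp_dual)
    show "f \<in> space M \<rightarrow> dual smul" using f by auto
    fix U assume "U \<in> {U. openin (weak_star smul) U}"
    then have U: "openin (weak_star smul) U" by simp
    define C where "C n P = {\<omega> \<in> space M. norm (f \<omega>) \<le> real n} \<inter> {\<omega> \<in> space M. \<forall>(d, V)\<in>P. blinfun_apply (f \<omega>) d \<in> V}" for n and P :: "('a \<times> 'k set) set"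
    define \<P> :: "nat \<Rightarrow> ('a \<times> 'k set) set set" where "\<P> n = {P. finite P \<and> P \<subseteq> D \<times> B \<and>
      (\<forall>y\<in>dual smul. norm y \<le> real n \<longrightarrow> (\<forall>(d, V)\<in>P. blinfun_apply y d \<in> V) \<longrightarrow> y \<in> U)}" for n
    have cP: "countable (\<P> n)" for n
    proof (rule countable_subset)
      show "\<P> n \<subseteq> {P. finite P \<and> P \<subseteq> D \<times> B}" unfolding \<P>_def by auto
      show "countable {P. finite P \<and> P \<subseteq> D \<times> B}"
        using D(1) B(1) by (intro countable_Collect_finite_subset) auto
    qed
    have "C n P \<in> sets M" if "P \<in> \<P> n" for n P
    proof -
      have P: "finite P" "P \<subseteq> D \<times> B" using that unfolding \<P>_def by blast+
      have "{\<omega> \<in> space M. norm (f \<omega>) \<le> real n} = {\<omega> \<in> space M. \<forall>d\<in>D. norm (blinfun_apply (f \<omega>) d) \<le> real n * norm d}"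
        by (simp add: norm_le_iff_dense[OF D(2)])
      also have "\<dots> = {\<omega> \<in> space M. \<forall>i. norm (blinfun_apply (f \<omega>) (from_nat_into D i)) \<le> real n * norm (from_nat_into D i)}"
        by (simp add: dense_sequence[OF D])
      also have "\<dots> \<in> sets M" by measurable
      finally have 1: "{\<omega> \<in> space M. norm (f \<omega>) \<le> real n} \<in> sets M" .
      have "{\<omega> \<in> space M. blinfun_apply (f \<omega>) (fst p) \<in> snd p} \<in> sets M" if "p \<in> P" for p
      proof -
        have "open (snd p)" using that P(2) topological_basis_open[OF B(2)] by auto
        then have [measurable]: "snd p \<in> sets borel" by simp
        show ?thesis by measurable
      qed
      then have "{\<omega> \<in> space M. \<forall>p\<in>P. blinfun_apply (f \<omega>) (fst p) \<in> snd p} \<in> sets M"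
        using P(1) by (rule sets.sets_Collect_finite_All)
      with 1 show ?thesis unfolding C_def case_prod_unfold by (rule sets.Int)
    qed
    then have "(\<Union>P\<in>\<P> n. C n P) \<in> sets M" for n
      by (intro sets.countable_UN''[OF cP]) auto
    then have "(\<Union>n. \<Union>P\<in>\<P> n. C n P) \<in> sets M"
      by (intro sets.countable_UN) auto
    moreover have "(\<Union>n. \<Union>P\<in>\<P> n. C n P) = f -` U \<inter> space M"
    proof (intro subset_antisym subsetI)
      fix \<omega> assume "\<omega> \<in> (\<Union>n. \<Union>P\<in>\<P> n. C n P)"
      then show "\<omega> \<in> f -` U \<inter> space M" using f by (auto simp: C_def \<P>_def)
    next
      fix \<omega> assume \<omega>: "\<omega> \<in> f -` U \<inter> space M"
      obtain n where n: "norm (f \<omega>) \<le> real n" using real_arch_simple by blast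
      obtain P where P: "finite P" "P \<subseteq> D \<times> B" "\<forall>(d, V)\<in>P. blinfun_apply (f \<omega>) d \<in> V"
        "\<And>y. y \<in> dual smul \<Longrightarrow> norm y \<le> real n \<Longrightarrow> \<forall>(d, V)\<in>P. blinfun_apply y d \<in> V \<Longrightarrow> y \<in> U"
        by (rule weak_star_open_ball_basis[OF D(2) B(2) U _ n]) (use \<omega> in auto)
      then have "P \<in> \<P> n" "\<omega> \<in> C n P" using n \<omega> by (auto simp: \<P>_def C_def)
      then show "\<omega> \<in> (\<Union>n. \<Union>P\<in>\<P> n. C n P)" by blast
    qed
    ultimately show "f -` U \<inter> space M \<in> sets M" by simp
  qed
qed

text \<open>
  Bounded functionals are uniformly Lipschitz, so convergence at the points of a dense set spreads
  to all vectors, and the limit inherits linearity and the bound.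
\<close>

lemma weak_star_Cauchy_dense:
  fixes X :: "nat \<Rightarrow> 'a::real_normed_vector \<Rightarrow>\<^sub>L 'b::banach"
  assumes D: "closure D = UNIV" and c: "\<And>n. norm (X n) \<le> c"
    and conv: "\<And>d. d \<in> D \<Longrightarrow> convergent (\<lambda>n. blinfun_apply (X n) d)"
  obtains l where "norm l \<le> c" "\<And>v. (\<lambda>n. blinfun_apply (X n) v) \<longlonglongrightarrow> blinfun_apply l v"
proof -
  have c0: "0 \<le> c" using c[of 0] norm_ge_zero order_trans by blast
  have app: "norm (blinfun_apply (X n) v) \<le> c * norm v" for n v
    using norm_blinfun[of "X n" v] mult_right_mono[OF c norm_ge_zero] by (rule order_trans)
  have "Cauchy (\<lambda>n. blinfun_apply (X n) v)" for v
  proof (rule metric_CauchyI)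
    fix e :: real assume e: "0 < e"
    \<comment> \<open>half of \<open>e\<close> for the passage from \<open>v\<close> to \<open>d\<close> and back; \<open>c + 1\<close> instead of \<open>c\<close> because \<open>c\<close> may be \<open>0\<close>\<close>
    define \<delta> where "\<delta> = e / (4 * (c + 1))"
    have \<delta>: "0 < \<delta>" "c * \<delta> \<le> e / 4" using e c0 by (auto simp: \<delta>_def field_simps)
    have "v \<in> closure D" using D by simp
    then obtain d where d: "d \<in> D" "dist d v < \<delta>" using \<delta>(1) closure_approachable by blast
    have "Cauchy (\<lambda>n. blinfun_apply (X n) d)" using conv[OF d(1)] by (rule convergent_Cauchy)
    then obtain N where N: "\<And>m n. m \<ge> N \<Longrightarrow> n \<ge> N \<Longrightarrow> dist (blinfun_apply (X m) d) (blinfun_apply (X n) d) < e / 2"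
      using metric_CauchyD[of _ "e/2"] e by (metis half_gt_zero)
    have near: "dist (blinfun_apply (X n) v) (blinfun_apply (X n) d) \<le> e / 4" for n
    proof -
      have "dist (blinfun_apply (X n) v) (blinfun_apply (X n) d) \<le> c * norm (v - d)"
        using app[of n "v - d"] by (simp add: dist_norm blinfun.diff_right)
      also have "\<dots> \<le> c * \<delta>" using d(2) c0 by (intro mult_left_mono) (auto simp: dist_norm norm_minus_commute)
      finally show ?thesis using \<delta>(2) by simp
    qed
    have "dist (blinfun_apply (X m) v) (blinfun_apply (X n) v) < e" if "m \<ge> N" "n \<ge> N" for m n
      using N[OF that] near[of m] near[of n]
        dist_triangle[of "blinfun_apply (X m) v" "blinfun_apply (X n) v" "blinfun_apply (X m) d"]
        dist_triangle[of "blinfun_apply (X m) d" "blinfun_apply (X n) v" "blinfun_apply (X n) d"]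
        dist_commute[of "blinfun_apply (X n) d" "blinfun_apply (X n) v"] by linarith
    then show "\<exists>M. \<forall>m\<ge>M. \<forall>n\<ge>M. dist (blinfun_apply (X m) v) (blinfun_apply (X n) v) < e" by blast
  qed
  then have "\<exists>L. (\<lambda>n. blinfun_apply (X n) v) \<longlonglongrightarrow> L" for v
    using Cauchy_convergent unfolding convergent_def by blast
  then obtain L where L: "\<And>v. (\<lambda>n. blinfun_apply (X n) v) \<longlonglongrightarrow> L v" by metis
  have Lb: "norm (L v) \<le> c * norm v" for v
    by (rule LIMSEQ_le_const2[OF tendsto_norm[OF L]]) (use app in auto)
  have "bounded_linear L"
  proof (rule bounded_linear_intro)
    show "L (v + w) = L v + L w" for v w
      using L[of "v + w"] tendsto_add[OF L[of v] L[of w]] by (auto simp: blinfun.add_right intro: LIMSEQ_unique)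
    show "L (r *\<^sub>R v) = r *\<^sub>R L v" for r v
      using L[of "r *\<^sub>R v"] tendsto_scaleR[OF tendsto_const L[of v]]
      by (auto simp: blinfun.scaleR_right intro: LIMSEQ_unique)
    show "norm (L v) \<le> norm v * c" for v using Lb[of v] by (simp add: mult.commute)
  qed
  then have app_L: "blinfun_apply (Blinfun L) = L" by (rule bounded_linear_Blinfun_apply)
  show ?thesis
  proof
    show "norm (Blinfun L) \<le> c" by (rule norm_blinfun_bound[OF c0]) (simp add: app_L Lb)
    show "(\<lambda>n. blinfun_apply (X n) v) \<longlonglongrightarrow> blinfun_apply (Blinfun L) v" for v using L by (simp add: app_L)
  qed
qed

lemma weak_star_tendsto_dense:
  fixes X :: "nat \<Rightarrow> 'a::real_normed_vector \<Rightarrow>\<^sub>L 'b::banach"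
  assumes D: "closure D = UNIV" and c: "\<And>n. norm (X n) \<le> c"
    and lim: "\<And>d. d \<in> D \<Longrightarrow> (\<lambda>n. blinfun_apply (X n) d) \<longlonglongrightarrow> blinfun_apply l d"
  shows "(\<lambda>n. blinfun_apply (X n) v) \<longlonglongrightarrow> blinfun_apply l v"
proof -
  have "convergent (\<lambda>n. blinfun_apply (X n) d)" if "d \<in> D" for d
    using lim[OF that] by (rule convergentI)
  then obtain l' where l': "\<And>v. (\<lambda>n. blinfun_apply (X n) v) \<longlonglongrightarrow> blinfun_apply l' v"
    using weak_star_Cauchy_dense[OF D, of X c, OF c] by blast
  have eq: "blinfun_apply l' d = blinfun_apply l d" if "d \<in> D" for d
    using LIMSEQ_unique[OF l' lim[OF that]] .
  have "closed {v. blinfun_apply l' v = blinfun_apply l v}"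
    by (intro closed_Collect_eq continuous_intros)
  then have "closure D \<subseteq> {v. blinfun_apply l' v = blinfun_apply l v}"
    using eq by (intro closure_minimal) auto
  then have "blinfun_apply l' v = blinfun_apply l v" using D by blast
  then show ?thesis using l'[of v] by simp
qed

lemma dual_limit:
  assumes "\<And>n. X n \<in> dual smul" "\<And>v. (\<lambda>n. blinfun_apply (X n) v) \<longlonglongrightarrow> blinfun_apply l v"
  shows "l \<in> dual smul"
  unfolding dual_def
proof (intro CollectI allI)
  fix c v
  have "(\<lambda>n. blinfun_apply (X n) (smul c v)) \<longlonglongrightarrow> c * blinfun_apply l v"
    using tendsto_mult[OF tendsto_const assms(2)[of v], of c] assms(1) by (simp add: dual_def)
  then show "blinfun_apply l (smul c v) = c * blinfun_apply l v"
    using assms(2)[of "smul c v"] by (rule LIMSEQ_unique[rotated])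
qed

lemma weak_star_integral:
  fixes smul :: "'k::{real_normed_field, euclidean_space} \<Rightarrow> 'a::real_normed_vector \<Rightarrow> 'a"
  assumes M: "prob_space M"
    and f: "\<And>v. (\<lambda>\<omega>. blinfun_apply (f \<omega>) v) \<in> borel_measurable M" "AE \<omega> in M. norm (f \<omega>) \<le> K"
  shows weak_star_integral_apply: "blinfun_apply (weak_star_integral M f) v = (\<integral>\<omega>. blinfun_apply (f \<omega>) v \<partial>M)"
    and norm_weak_star_integral: "norm (weak_star_integral M f) \<le> K"
    and weak_star_integral_dual: "(\<And>\<omega>. \<omega> \<in> space M \<Longrightarrow> f \<omega> \<in> dual smul) \<Longrightarrow> weak_star_integral M f \<in> dual smul"
proof -
  interpret prob_space M by fact
  have bd: "AE \<omega> in M. norm (blinfun_apply (f \<omega>) v) \<le> K * norm v" for v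
    using f(2) by eventually_elim (meson norm_blinfun mult_right_mono norm_ge_zero order_trans)
  have int: "integrable M (\<lambda>\<omega>. blinfun_apply (f \<omega>) v)" for v
    by (rule integrable_const_bound[OF bd f(1)])
  have nb: "norm (\<integral>\<omega>. blinfun_apply (f \<omega>) v \<partial>M) \<le> K * norm v" for v
  proof -
    have "norm (\<integral>\<omega>. blinfun_apply (f \<omega>) v \<partial>M) \<le> (\<integral>\<omega>. norm (blinfun_apply (f \<omega>) v) \<partial>M)"
      by (rule integral_norm_bound)
    also have "\<dots> \<le> K * norm v"
      using bd int by (intro integral_le_const) auto
    finally show ?thesis .
  qed
  have lin: "bounded_linear (\<lambda>v. \<integral>\<omega>. blinfun_apply (f \<omega>) v \<partial>M)"
    by (rule bounded_linear_intro[where K=K])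
      (use int nb in \<open>auto simp: blinfun.add_right blinfun.scaleR_right mult.commute\<close>)
  show app: "blinfun_apply (weak_star_integral M f) v = (\<integral>\<omega>. blinfun_apply (f \<omega>) v \<partial>M)" for v
    unfolding weak_star_integral_def using lin by (simp add: bounded_linear_Blinfun_apply)
  have "\<exists>\<omega>. norm (f \<omega>) \<le> K"
  proof (rule ccontr)
    assume "\<nexists>\<omega>. norm (f \<omega>) \<le> K"
    then have "AE \<omega> in M. False" using f(2) by simp
    then show False by simp
  qed
  then have K: "0 \<le> K" using norm_ge_zero order_trans by blast
  show "norm (weak_star_integral M f) \<le> K"
    by (rule norm_blinfun_bound[OF K]) (simp add: app nb)
  show "weak_star_integral M f \<in> dual smul" if d: "\<And>\<omega>. \<omega> \<in> space M \<Longrightarrow> f \<omega> \<in> dual smul"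
  proof -
    have "(\<integral>\<omega>. blinfun_apply (f \<omega>) (smul c v) \<partial>M) = c * (\<integral>\<omega>. blinfun_apply (f \<omega>) v \<partial>M)" for c v
    proof -
      have "(\<integral>\<omega>. blinfun_apply (f \<omega>) (smul c v) \<partial>M) = (\<integral>\<omega>. c * blinfun_apply (f \<omega>) v \<partial>M)"
        using d by (intro Bochner_Integration.integral_cong) (auto simp: dual_def)
      then show ?thesis using int by simp
    qed
    then show ?thesis by (simp add: dual_def app)
  qed
qed

section \<open>Boundary functions and harmonic vectors\<close>

text \<open>
  The separability of the predual enters through a fixed countable dense set \<open>D\<close>, so that
  statements about all vectors reduce to countably many.
\<close>

locale boundary_representation =
  isometric_representation smul rep + random_walk \<mu>
  for smul :: "'k::{real_normed_field, euclidean_space} \<Rightarrow> 'a::banach \<Rightarrow> 'a"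
    and rep :: "'g::{topological_group_add, t2_space} \<Rightarrow> 'a \<Rightarrow>\<^sub>L 'a"
    and \<mu> :: "'g measure" +
  fixes D :: "'a set"
  assumes countable_D: "countable D" and dense_D: "closure D = UNIV"
begin

lemma adjoint_rep_apply: "blinfun_apply (adjoint_rep rep g x) v = blinfun_apply x (blinfun_apply (rep (- g)) v)"
  by (simp add: adjoint_rep_def)

lemma adjoint_rep_dual: "x \<in> dual smul \<Longrightarrow> adjoint_rep rep g x \<in> dual smul"
  by (simp add: dual_def adjoint_rep_apply rep_scale)

lemma adjoint_rep_add: "adjoint_rep rep (g + h) x = adjoint_rep rep g (adjoint_rep rep h x)"
proof (rule blinfun_eqI)
  have "rep (- (g + h)) = rep (- h) o\<^sub>L rep (- g)" by (simp only: minus_add rep_add)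
  then show "blinfun_apply (adjoint_rep rep (g + h) x) v = blinfun_apply (adjoint_rep rep g (adjoint_rep rep h x)) v" for v
    by (simp add: adjoint_rep_apply)
qed

lemma adjoint_rep_zero: "adjoint_rep rep 0 x = x"
  by (rule blinfun_eqI) (simp add: adjoint_rep_apply rep_zero)

lemma adjoint_rep_scale: "adjoint_rep rep g (scale_dual c x) = scale_dual c (adjoint_rep rep g x)"
  by (rule blinfun_eqI) (simp add: adjoint_rep_apply scale_dual_def)

lemma adjoint_rep_plus: "adjoint_rep rep g (x + y) = adjoint_rep rep g x + adjoint_rep rep g y"
  by (rule blinfun_eqI) (simp add: adjoint_rep_apply blinfun.add_left)

lemma norm_adjoint_rep_apply: "norm (blinfun_apply (adjoint_rep rep g x) v) \<le> norm x * norm v"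
  using norm_blinfun[of x "blinfun_apply (rep (- g)) v"] by (simp add: adjoint_rep_apply norm_rep)

lemma norm_adjoint_rep: "norm (adjoint_rep rep g x) \<le> norm x"
  by (rule norm_blinfun_bound) (auto simp: norm_adjoint_rep_apply)

lemma measurable_coefficient: "(\<lambda>g. blinfun_apply (adjoint_rep rep g x) v) \<in> borel_measurable borel"
proof (rule borel_measurable_continuous_onI)
  have "continuous_on UNIV (\<lambda>g. blinfun_apply (rep (- g)) v)"
    by (rule continuous_on_compose2[OF continuous_rep, of UNIV uminus]) (auto intro!: continuous_intros)
  then show "continuous_on UNIV (\<lambda>g. blinfun_apply (adjoint_rep rep g x) v)"
    unfolding adjoint_rep_apply by (rule bounded_linear.continuous_on[OF blinfun.bounded_linear_right])
qed

lemma rep_measure_apply: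
  "blinfun_apply (rep_measure rep \<mu> x) v = (\<integral>s. blinfun_apply (adjoint_rep rep s x) v \<partial>\<mu>)"
  unfolding rep_measure_def
  using measurable_coefficient measurable_cong_sets[OF sets_\<mu> refl]
  by (intro weak_star_integral_apply[OF prob_space_\<mu>, where K="norm x"]) (auto intro!: norm_adjoint_rep)

lemma harmonic_iff: "x \<in> harmonic smul rep \<mu> \<longleftrightarrow>
  x \<in> dual smul \<and> (\<forall>v. (\<integral>s. blinfun_apply (adjoint_rep rep s x) v \<partial>\<mu>) = blinfun_apply x v)"
  unfolding harmonic_def by (auto simp: rep_measure_apply[symmetric] intro: blinfun_eqI)

lemma harmonic_mean_value:
  assumes "x \<in> harmonic smul rep \<mu>"
  shows "(\<integral>s. blinfun_apply (adjoint_rep rep (g + s) x) v \<partial>\<mu>) = blinfun_apply (adjoint_rep rep g x) v"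
  using assms unfolding harmonic_iff adjoint_rep_add adjoint_rep_apply[of g] by blast

lemma measurable_iff:
  "f \<in> M \<rightarrow>\<^sub>M weak_star_borel smul \<longleftrightarrow>
    (\<forall>\<omega>\<in>space M. f \<omega> \<in> dual smul) \<and> (\<forall>v. (\<lambda>\<omega>. blinfun_apply (f \<omega>) v) \<in> borel_measurable M)"
  by (rule measurable_weak_star_borel_iff[OF countable_D dense_D])

lemma norm_u_le:
  assumes "uae \<mu> (\<lambda>\<omega>. norm (f \<omega>) \<le> K)" shows "norm_u \<mu> f \<le> ennreal K"
proof -
  obtain \<Delta> where \<Delta>: "\<Delta> \<in> universally_null \<mu>" "\<And>\<omega>. \<omega> \<notin> \<Delta> \<Longrightarrow> norm (f \<omega>) \<le> K"
    using uae_obtain_null[OF assms] by blast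
  then have "(SUP \<omega>\<in>- \<Delta>. ennreal (norm (f \<omega>))) \<le> ennreal K"
    by (intro SUP_least ennreal_leI) auto
  then show ?thesis unfolding norm_u_def using \<Delta>(1) by (rule INF_lower2[rotated])
qed

lemma uae_bound_of_SUP:
  assumes "\<Delta> \<in> universally_null \<mu>" "(SUP \<omega>\<in>- \<Delta>. ennreal (norm (f \<omega>))) = ennreal K" "0 \<le> K"
  shows "uae \<mu> (\<lambda>\<omega>. norm (f \<omega>) \<le> K)"
proof (rule uae_mono[OF uae_not_null[OF assms(1)]])
  fix \<omega> assume "\<omega> \<notin> \<Delta>"
  then have "ennreal (norm (f \<omega>)) \<le> ennreal K" unfolding assms(2)[symmetric] by (intro SUP_upper) auto
  then show "norm (f \<omega>) \<le> K" using assms(3) by simp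
qed

lemma le_norm_u:
  assumes "\<And>K. 0 \<le> K \<Longrightarrow> uae \<mu> (\<lambda>\<omega>. norm (f \<omega>) \<le> K) \<Longrightarrow> c \<le> K"
  shows "ennreal c \<le> norm_u \<mu> f"
  unfolding norm_u_def
proof (rule INF_greatest)
  fix \<Delta> assume \<Delta>: "\<Delta> \<in> universally_null \<mu>"
  show "ennreal c \<le> (SUP \<omega>\<in>- \<Delta>. ennreal (norm (f \<omega>)))"
  proof (cases "SUP \<omega>\<in>- \<Delta>. ennreal (norm (f \<omega>))" rule: ennreal_cases)
    case (real K)
    then have "c \<le> K" using uae_bound_of_SUP[OF \<Delta>] by (intro assms) auto
    then show ?thesis using real by (simp add: ennreal_leI)
  next
    case top
    then show ?thesis by (simp only: top_greatest)
  qed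
qed

text \<open>
  Membership unfolded into conditions on scalar functions.
\<close>

lemma Linf_fun_iff:
  "f \<in> Linf_fun smul \<mu> \<longleftrightarrow> (\<forall>\<omega>. f \<omega> \<in> dual smul) \<and>
    (\<forall>v. (\<lambda>\<omega>. blinfun_apply (f \<omega>) v) \<in> borel_measurable invariant_algebra) \<and>
    (\<exists>K\<ge>0. uae \<mu> (\<lambda>\<omega>. norm (f \<omega>) \<le> K))"
proof -
  have "norm_u \<mu> f < \<infinity> \<longleftrightarrow> (\<exists>K\<ge>0. uae \<mu> (\<lambda>\<omega>. norm (f \<omega>) \<le> K))"
  proof
    assume "norm_u \<mu> f < \<infinity>"
    then obtain \<Delta> where \<Delta>: "\<Delta> \<in> universally_null \<mu>" "(SUP \<omega>\<in>- \<Delta>. ennreal (norm (f \<omega>))) < \<infinity>"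
      unfolding norm_u_def INF_less_iff by auto
    then show "\<exists>K\<ge>0. uae \<mu> (\<lambda>\<omega>. norm (f \<omega>) \<le> K)"
      using uae_bound_of_SUP[OF \<Delta>(1)] by (cases "SUP \<omega>\<in>- \<Delta>. ennreal (norm (f \<omega>))") auto
  next
    assume "\<exists>K\<ge>0. uae \<mu> (\<lambda>\<omega>. norm (f \<omega>) \<le> K)"
    then obtain K where "norm_u \<mu> f \<le> ennreal K" using norm_u_le by auto
    then show "norm_u \<mu> f < \<infinity>" using ennreal_less_top[of K] by (auto intro: le_less_trans)
  qed
  then show ?thesis unfolding Linf_fun_def by (auto simp: measurable_iff)
qed

lemma Linf_fun_shift:
  assumes "f \<in> Linf_fun smul \<mu>" shows "f (shift \<omega>) = f \<omega>"
  using assms unfolding Linf_fun_iff borel_measurable_invariant_iff by (intro blinfun_eqI) auto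

lemma measurable_evaluation_path:
  assumes "f \<in> Linf_fun smul \<mu>" shows "(\<lambda>\<omega>. blinfun_apply (f \<omega>) v) \<in> borel_measurable path_algebra"
  using assms unfolding Linf_fun_iff borel_measurable_invariant_iff by blast

lemma measurable_evaluation_walk:
  assumes "f \<in> Linf_fun smul \<mu>" shows "(\<lambda>\<omega>. blinfun_apply (f \<omega>) v) \<in> borel_measurable (walk_law \<mu> g)"
  using measurable_evaluation_path[OF assms] by (simp cong: measurable_cong_sets)

definition R :: "((nat \<Rightarrow> 'g) \<Rightarrow> 'a \<Rightarrow>\<^sub>L 'k) \<Rightarrow> 'a \<Rightarrow>\<^sub>L 'k" where
  "R f = weak_star_integral (walk_law \<mu> 0) f"

lemma R_props:
  assumes "f \<in> Linf_fun smul \<mu>"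
  shows R_apply: "blinfun_apply (R f) v = (\<integral>\<omega>. blinfun_apply (f \<omega>) v \<partial>walk_law \<mu> 0)"
    and R_dual: "R f \<in> dual smul"
    and norm_R_le: "uae \<mu> (\<lambda>\<omega>. norm (f \<omega>) \<le> K) \<Longrightarrow> norm (R f) \<le> K"
proof -
  have m: "(\<lambda>\<omega>. blinfun_apply (f \<omega>) v) \<in> borel_measurable (walk_law \<mu> 0)" for v
    by (rule measurable_evaluation_walk[OF assms])
  obtain K0 where "uae \<mu> (\<lambda>\<omega>. norm (f \<omega>) \<le> K0)" using assms unfolding Linf_fun_iff by auto
  then have K0: "AE \<omega> in walk_law \<mu> 0. norm (f \<omega>) \<le> K0" by (rule uae_imp_AE)
  note W = prob_space_walk_law[of 0] m
  show "blinfun_apply (R f) v = (\<integral>\<omega>. blinfun_apply (f \<omega>) v \<partial>walk_law \<mu> 0)"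
    unfolding R_def by (rule weak_star_integral_apply[OF W K0])
  show "R f \<in> dual smul"
    unfolding R_def by (rule weak_star_integral_dual[OF W K0]) (use assms in \<open>auto simp: Linf_fun_iff\<close>)
  show "norm (R f) \<le> K" if "uae \<mu> (\<lambda>\<omega>. norm (f \<omega>) \<le> K)"
    unfolding R_def by (rule norm_weak_star_integral[OF W uae_imp_AE[OF that]])
qed

lemma integrable_evaluation:
  assumes "f \<in> Linf_fun smul \<mu>" shows "integrable (walk_law \<mu> g) (\<lambda>\<omega>. blinfun_apply (f \<omega>) v)"
proof -
  interpret prob_space "walk_law \<mu> g" by (rule prob_space_walk_law)
  obtain K where "uae \<mu> (\<lambda>\<omega>. norm (f \<omega>) \<le> K)" using assms unfolding Linf_fun_iff by auto
  from uae_imp_AE[OF this, of g] have "AE \<omega> in walk_law \<mu> g. norm (blinfun_apply (f \<omega>) v) \<le> K * norm v"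
    by eventually_elim (meson norm_blinfun mult_right_mono norm_ge_zero order_trans)
  then show ?thesis
    by (rule integrable_const_bound[OF _ measurable_evaluation_walk[OF assms]])
qed

text \<open>
  Start the walk at the identity and translate by \<open>g\<close>; equivariance moves the translation from the path to
  the vector \<open>v\<close>.
\<close>

lemma poisson_integral_evaluation:
  assumes f: "f \<in> L_fun smul rep \<mu>"
  shows "poisson_integral (\<lambda>\<omega>. blinfun_apply (f \<omega>) v) g = blinfun_apply (adjoint_rep rep g (R f)) v"
proof -
  have fL: "f \<in> Linf_fun smul \<mu>" and eq: "uae \<mu> (\<lambda>\<omega>. f (translate g \<omega>) = adjoint_rep rep g (f \<omega>))"
    using f unfolding L_fun_def by auto
  have m [measurable]: "(\<lambda>\<omega>. blinfun_apply (f \<omega>) v) \<in> borel_measurable path_algebra" for v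
    by (rule measurable_evaluation_path[OF fL])
  have "poisson_integral (\<lambda>\<omega>. blinfun_apply (f \<omega>) v) g =
      (\<integral>\<omega>. blinfun_apply (f \<omega>) v \<partial>distr (walk_law \<mu> 0) path_algebra (translate g))"
    unfolding poisson_integral_def distr_walk_law_translate by simp
  also have "\<dots> = (\<integral>\<omega>. blinfun_apply (f (translate g \<omega>)) v \<partial>walk_law \<mu> 0)"
    by (rule integral_distr) auto
  also have "\<dots> = (\<integral>\<omega>. blinfun_apply (f \<omega>) (blinfun_apply (rep (- g)) v) \<partial>walk_law \<mu> 0)"
  proof (rule integral_cong_AE)
    show "AE \<omega> in walk_law \<mu> 0. blinfun_apply (f (translate g \<omega>)) v = blinfun_apply (f \<omega>) (blinfun_apply (rep (- g)) v)"
      using uae_imp_AE[OF eq] by eventually_elim (simp add: adjoint_rep_apply)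
  qed measurable
  also have "\<dots> = blinfun_apply (adjoint_rep rep g (R f)) v"
    by (simp add: R_apply[OF fL] adjoint_rep_apply)
  finally show ?thesis .
qed

lemma R_harmonic:
  assumes f: "f \<in> L_fun smul rep \<mu>" shows "R f \<in> harmonic smul rep \<mu>"
  unfolding harmonic_iff
proof (intro conjI allI)
  have fL: "f \<in> Linf_fun smul \<mu>" using f unfolding L_fun_def by auto
  then show "R f \<in> dual smul" by (rule R_dual)
  obtain K where K: "uae \<mu> (\<lambda>\<omega>. norm (f \<omega>) \<le> K)" using fL unfolding Linf_fun_iff by auto
  fix v
  have "uae \<mu> (\<lambda>\<omega>. norm (blinfun_apply (f \<omega>) v) \<le> K * norm v)"
    using K by (rule uae_mono) (meson norm_blinfun mult_right_mono norm_ge_zero order_trans)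
  moreover have "(\<lambda>\<omega>. blinfun_apply (f \<omega>) v) \<in> borel_measurable invariant_algebra"
    using fL unfolding Linf_fun_iff by auto
  ultimately have "(\<integral>s. poisson_integral (\<lambda>\<omega>. blinfun_apply (f \<omega>) v) (0 + s) \<partial>\<mu>) = poisson_integral (\<lambda>\<omega>. blinfun_apply (f \<omega>) v) 0"
    by (intro poisson_integral_mean_value)
  then show "(\<integral>s. blinfun_apply (adjoint_rep rep s (R f)) v \<partial>\<mu>) = blinfun_apply (R f) v"
    by (simp add: poisson_integral_evaluation[OF f] adjoint_rep_zero)
qed

lemma invariant_sets_Collect:
  assumes "{\<omega>. P \<omega>} \<in> sets path_algebra" "\<And>\<omega>. P (shift \<omega>) = P \<omega>"
  shows "{\<omega>. P \<omega>} \<in> invariant_sets"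
  using assms unfolding invariant_sets_def by auto

lemma tendsto_shift_iff: "(\<lambda>n. u (shift \<omega> n)) \<longlonglongrightarrow> l \<longleftrightarrow> (\<lambda>n. u (\<omega> n)) \<longlonglongrightarrow> l"
  unfolding shift_def by (rule filterlim_sequentially_Suc)

text \<open>
  Levy's theorem yields the convergence for one vector \<open>v\<close> at a time. The exceptional set must not depend
  on \<open>v\<close>, and must belong to the invariant algebra, so the conull set is defined by the vectors of \<open>D\<close> only.
\<close>

lemma uae_limit:
  assumes f: "f \<in> L_fun smul rep \<mu>"
  shows "uae \<mu> (\<lambda>\<omega>. \<forall>v. (\<lambda>n. blinfun_apply (adjoint_rep rep (\<omega> n) (R f)) v) \<longlonglongrightarrow> blinfun_apply (f \<omega>) v)"
proof -
  have fL: "f \<in> Linf_fun smul \<mu>" using f unfolding L_fun_def by auto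
  have fi: "(\<lambda>\<omega>. blinfun_apply (f \<omega>) v) \<in> borel_measurable invariant_algebra" for v
    using fL unfolding Linf_fun_iff by auto
  have m [measurable]: "(\<lambda>\<omega>. blinfun_apply (f \<omega>) v) \<in> borel_measurable path_algebra" for v
    by (rule measurable_evaluation_path[OF fL])
  have c [measurable]: "(\<lambda>\<omega>. blinfun_apply (adjoint_rep rep (\<omega> n) (R f)) v) \<in> borel_measurable path_algebra" for n v
    by (rule measurable_comp_coordinate[OF measurable_coefficient]) simp
  obtain K where K: "uae \<mu> (\<lambda>\<omega>. norm (f \<omega>) \<le> K)" using fL unfolding Linf_fun_iff by auto
  define P where "P \<omega> \<longleftrightarrow> (\<forall>d\<in>D. (\<lambda>n. blinfun_apply (adjoint_rep rep (\<omega> n) (R f)) d) \<longlonglongrightarrow> blinfun_apply (f \<omega>) d)" for \<omega>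
  have P_iff: "P \<omega> \<longleftrightarrow> (\<forall>i. (\<lambda>n. blinfun_apply (adjoint_rep rep (\<omega> n) (R f)) (from_nat_into D i)
      - blinfun_apply (f \<omega>) (from_nat_into D i)) \<longlonglongrightarrow> 0)" for \<omega>
    unfolding P_def dense_sequence[OF countable_D dense_D] LIM_zero_iff ..
  show ?thesis
  proof (rule uaeI[of "{\<omega>. P \<omega>}"])
    show "{\<omega>. P \<omega>} \<in> invariant_sets"
    proof (rule invariant_sets_Collect)
      have "{\<omega> \<in> space path_algebra. P \<omega>} \<in> sets path_algebra" unfolding P_iff by measurable
      then show "{\<omega>. P \<omega>} \<in> sets path_algebra" by simp
      show "P (shift \<omega>) = P \<omega>" for \<omega>
        unfolding P_def Linf_fun_shift[OF fL]
        using tendsto_shift_iff[of "\<lambda>g. blinfun_apply (adjoint_rep rep g (R f)) _" \<omega>] by simp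
    qed
    show "AE \<omega> in walk_law \<mu> g. \<omega> \<in> {\<omega>. P \<omega>}" for g
    proof -
      have "AE \<omega> in walk_law \<mu> g. (\<lambda>n. blinfun_apply (adjoint_rep rep (\<omega> n) (R f)) v) \<longlonglongrightarrow> blinfun_apply (f \<omega>) v" for v
      proof -
        have "uae \<mu> (\<lambda>\<omega>. norm (blinfun_apply (f \<omega>) v) \<le> K * norm v)"
          using K by (rule uae_mono) (meson norm_blinfun mult_right_mono norm_ge_zero order_trans)
        from poisson_integral_tendsto[OF fi this, of g] show ?thesis by (simp only: poisson_integral_evaluation[OF f])
      qed
      then have "AE \<omega> in walk_law \<mu> g. \<forall>d\<in>D. (\<lambda>n. blinfun_apply (adjoint_rep rep (\<omega> n) (R f)) d) \<longlonglongrightarrow> blinfun_apply (f \<omega>) d"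
        using countable_D by (simp add: AE_ball_countable)
      then show ?thesis by (simp add: P_def)
    qed
    fix \<omega> assume "\<omega> \<in> {\<omega>. P \<omega>}"
    then have "(\<lambda>n. blinfun_apply (adjoint_rep rep (\<omega> n) (R f)) d) \<longlonglongrightarrow> blinfun_apply (f \<omega>) d" if "d \<in> D" for d
      using that unfolding P_def by blast
    then show "\<forall>v. (\<lambda>n. blinfun_apply (adjoint_rep rep (\<omega> n) (R f)) v) \<longlonglongrightarrow> blinfun_apply (f \<omega>) v"
      using weak_star_tendsto_dense[OF dense_D, of "\<lambda>n. adjoint_rep rep (\<omega> n) (R f)", OF norm_adjoint_rep] by blast
  qed
qed

lemma uae_norm_le:
  assumes f: "f \<in> L_fun smul rep \<mu>" shows "uae \<mu> (\<lambda>\<omega>. norm (f \<omega>) \<le> norm (R f))"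
  using uae_limit[OF f]
proof (rule uae_mono)
  fix \<omega> assume *: "\<forall>v. (\<lambda>n. blinfun_apply (adjoint_rep rep (\<omega> n) (R f)) v) \<longlonglongrightarrow> blinfun_apply (f \<omega>) v"
  show "norm (f \<omega>) \<le> norm (R f)"
  proof (rule norm_blinfun_bound)
    show "norm (blinfun_apply (f \<omega>) v) \<le> norm (R f) * norm v" for v
      by (rule LIMSEQ_le_const2[OF tendsto_norm[OF *[rule_format, of v]]]) (auto simp: norm_adjoint_rep_apply)
  qed simp
qed

text \<open>
  The weak* limit of vectors of norm at most \<open>\<parallel>R f\<parallel>\<close> has norm at most \<open>\<parallel>R f\<parallel>\<close>, and an average of vectors of norm at
  most \<open>K\<close> has norm at most \<open>K\<close>.
\<close>

lemma norm_u_eq: assumes f: "f \<in> L_fun smul rep \<mu>" shows "norm_u \<mu> f = ennreal (norm (R f))"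
proof (rule antisym)
  show "norm_u \<mu> f \<le> ennreal (norm (R f))" by (rule norm_u_le[OF uae_norm_le[OF f]])
  show "ennreal (norm (R f)) \<le> norm_u \<mu> f"
    using f by (intro le_norm_u norm_R_le) (auto simp: L_fun_def)
qed

text \<open>
  The boundary function is the weak* limit of \<open>\<pi>(\<omega>\<^sub>n)x\<close> on the set \<open>C\<close> of paths where the coefficients
  at the vectors of \<open>D\<close> converge, and \<open>0\<close> elsewhere. The set \<open>C\<close> is exactly invariant under the shift and
  under translations, so every identity for \<open>f\<close> need only be checked for limits.
\<close>

lemma boundary_function_exists:
  assumes x: "x \<in> harmonic smul rep \<mu>"
  obtains f where "f \<in> L_fun smul rep \<mu>" "R f = x"
proof -
  have xd: "x \<in> dual smul" using x unfolding harmonic_def by auto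
  let ?X = "\<lambda>\<omega> n. adjoint_rep rep (\<omega> n) x"
  have Xm [measurable]: "(\<lambda>\<omega>. blinfun_apply (?X \<omega> n) v) \<in> borel_measurable path_algebra" for n v
    by (rule measurable_comp_coordinate[OF measurable_coefficient]) simp
  define C where "C = {\<omega>. \<forall>d\<in>D. convergent (\<lambda>n. blinfun_apply (?X \<omega> n) d)}"
  define f where "f \<omega> = (if \<omega> \<in> C then (SOME l. norm l \<le> norm x \<and> (\<forall>v. (\<lambda>n. blinfun_apply (?X \<omega> n) v) \<longlonglongrightarrow> blinfun_apply l v)) else 0)" for \<omega>
  have f_C: "norm (f \<omega>) \<le> norm x" "(\<lambda>n. blinfun_apply (?X \<omega> n) v) \<longlonglongrightarrow> blinfun_apply (f \<omega>) v" if "\<omega> \<in> C" for \<omega> v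
  proof -
    have conv: "\<And>d. d \<in> D \<Longrightarrow> convergent (\<lambda>n. blinfun_apply (?X \<omega> n) d)"
      using that unfolding C_def by auto
    obtain l where l: "norm l \<le> norm x" "\<And>v. (\<lambda>n. blinfun_apply (?X \<omega> n) v) \<longlonglongrightarrow> blinfun_apply l v"
      using weak_star_Cauchy_dense[OF dense_D, of "?X \<omega>" "norm x", OF norm_adjoint_rep conv] by blast
    then have "norm (f \<omega>) \<le> norm x \<and> (\<forall>v. (\<lambda>n. blinfun_apply (?X \<omega> n) v) \<longlonglongrightarrow> blinfun_apply (f \<omega>) v)"
      using that someI[of "\<lambda>l. norm l \<le> norm x \<and> (\<forall>v. (\<lambda>n. blinfun_apply (?X \<omega> n) v) \<longlonglongrightarrow> blinfun_apply l v)" l]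
      unfolding f_def by auto
    then show "norm (f \<omega>) \<le> norm x" "(\<lambda>n. blinfun_apply (?X \<omega> n) v) \<longlonglongrightarrow> blinfun_apply (f \<omega>) v" by auto
  qed
  have norm_f: "norm (f \<omega>) \<le> norm x" for \<omega> using f_C(1)[of \<omega>] by (cases "\<omega> \<in> C") (auto simp: f_def)
  have f_dual: "f \<omega> \<in> dual smul" for \<omega>
  proof (cases "\<omega> \<in> C")
    case True
    show ?thesis by (rule dual_limit[OF _ f_C(2)[OF True]]) (rule adjoint_rep_dual[OF xd])
  qed (simp add: f_def dual_def)
  have f_lim: "blinfun_apply (f \<omega>) v = (if \<omega> \<in> C then lim (\<lambda>n. blinfun_apply (?X \<omega> n) v) else 0)" for \<omega> v
    using limI[OF f_C(2)[of \<omega> v]] by (auto simp: f_def)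
  have C_eq: "C = {\<omega> \<in> space path_algebra. \<forall>i. Cauchy (\<lambda>n. blinfun_apply (?X \<omega> n) (from_nat_into D i))}"
    unfolding C_def dense_sequence[OF countable_D dense_D] Cauchy_convergent_iff by simp
  have C_sets [measurable]: "C \<in> sets path_algebra"
    unfolding C_eq by (intro sets.sets_Collect_countable_All sets_Collect_Cauchy) measurable
  have shift_conv: "convergent (\<lambda>n. blinfun_apply (?X (shift \<omega>) n) v) = convergent (\<lambda>n. blinfun_apply (?X \<omega> n) v)" for \<omega> v
    unfolding convergent_def tendsto_shift_iff[of "\<lambda>g. blinfun_apply (adjoint_rep rep g x) v"] ..
  have C_shift: "shift \<omega> \<in> C \<longleftrightarrow> \<omega> \<in> C" for \<omega> unfolding C_def by (simp add: shift_conv)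
  have C_inv: "C \<in> invariant_sets" using C_sets C_shift unfolding invariant_sets_def by auto
  have u: "(\<lambda>g. blinfun_apply (adjoint_rep rep g x) v) \<in> borel_measurable borel"
    "norm (blinfun_apply (adjoint_rep rep g x) v) \<le> norm x * norm v"
    "(\<integral>s. blinfun_apply (adjoint_rep rep (g + s) x) v \<partial>\<mu>) = blinfun_apply (adjoint_rep rep g x) v" for g v
    by (rule measurable_coefficient norm_adjoint_rep_apply harmonic_mean_value[OF x])+
  have C_AE: "AE \<omega> in walk_law \<mu> g. \<omega> \<in> C" for g
  proof -
    have "AE \<omega> in walk_law \<mu> g. convergent (\<lambda>n. blinfun_apply (?X \<omega> n) d)" for d
      by (rule AE_convergent_harmonic[OF u])
    then have "AE \<omega> in walk_law \<mu> g. \<forall>d\<in>D. convergent (\<lambda>n. blinfun_apply (?X \<omega> n) d)"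
      using countable_D by (simp add: AE_ball_countable)
    then show ?thesis by (simp add: C_def)
  qed
  have fi: "(\<lambda>\<omega>. blinfun_apply (f \<omega>) v) \<in> borel_measurable invariant_algebra" for v
    unfolding borel_measurable_invariant_iff
  proof (intro conjI allI)
    show "(\<lambda>\<omega>. blinfun_apply (f \<omega>) v) \<in> borel_measurable path_algebra" unfolding f_lim by measurable
    show "blinfun_apply (f (shift \<omega>)) v = blinfun_apply (f \<omega>) v" for \<omega>
    proof (cases "\<omega> \<in> C")
      case True
      have "(\<lambda>n. blinfun_apply (?X (shift \<omega>) n) v) \<longlonglongrightarrow> blinfun_apply (f \<omega>) v"
        using f_C(2)[OF True, of v] tendsto_shift_iff[of "\<lambda>g. blinfun_apply (adjoint_rep rep g x) v" \<omega>] by simp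
      then show ?thesis using f_C(2)[of "shift \<omega>" v] True by (auto simp: C_shift intro: LIMSEQ_unique)
    qed (simp add: f_def C_shift)
  qed
  have fL: "f \<in> Linf_fun smul \<mu>"
    unfolding Linf_fun_iff using f_dual fi norm_f by (auto intro!: exI[of _ "norm x"] uae_True)
  have equiv: "f (translate g \<omega>) = adjoint_rep rep g (f \<omega>)" if \<omega>: "\<omega> \<in> C" for g \<omega>
  proof -
    have X: "blinfun_apply (?X (translate g \<omega>) n) v = blinfun_apply (?X \<omega> n) (blinfun_apply (rep (- g)) v)" for n v
      by (simp add: translate_def adjoint_rep_add adjoint_rep_apply[of g])
    have lim: "(\<lambda>n. blinfun_apply (?X (translate g \<omega>) n) v) \<longlonglongrightarrow> blinfun_apply (adjoint_rep rep g (f \<omega>)) v" for v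
      unfolding X adjoint_rep_apply[of g "f \<omega>"] by (rule f_C(2)[OF \<omega>])
    then have "translate g \<omega> \<in> C" unfolding C_def convergent_def by auto
    from f_C(2)[OF this] lim show ?thesis by (intro blinfun_eqI) (rule LIMSEQ_unique)
  qed
  have "f \<in> L_fun smul rep \<mu>"
    unfolding L_fun_def using fL by (auto intro!: uaeI[OF C_inv C_AE] equiv)
  moreover have "R f = x"
  proof (rule blinfun_eqI)
    fix v
    interpret prob_space "walk_law \<mu> 0" by (rule prob_space_walk_law)
    have "(\<lambda>n. \<integral>\<omega>. blinfun_apply (?X \<omega> n) v \<partial>walk_law \<mu> 0) \<longlonglongrightarrow> (\<integral>\<omega>. blinfun_apply (f \<omega>) v \<partial>walk_law \<mu> 0)"
    proof (rule integral_dominated_convergence[where w="\<lambda>_. norm x * norm v"])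
      show "AE \<omega> in walk_law \<mu> 0. (\<lambda>n. blinfun_apply (?X \<omega> n) v) \<longlonglongrightarrow> blinfun_apply (f \<omega>) v"
        using C_AE by eventually_elim (rule f_C(2))
      show "(\<lambda>\<omega>. blinfun_apply (f \<omega>) v) \<in> borel_measurable (walk_law \<mu> 0)"
        by (rule measurable_evaluation_walk[OF fL])
    qed (auto simp: norm_adjoint_rep_apply)
    moreover have "(\<integral>\<omega>. blinfun_apply (?X \<omega> n) v \<partial>walk_law \<mu> 0) = blinfun_apply (adjoint_rep rep 0 x) v" for n
      by (rule integral_along_walk[OF u])
    ultimately show "blinfun_apply (R f) v = blinfun_apply x v"
      unfolding R_apply[OF fL] by (simp add: LIMSEQ_const_iff adjoint_rep_zero)
  qed
  ultimately show ?thesis by (rule that)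
qed

end

section \<open>Equivalence classes as fibres of the mean\<close>

context boundary_representation
begin

lemma uae_eq_iff: "(f, h) \<in> uae_eq smul \<mu> \<longleftrightarrow>
    f \<in> Linf_fun smul \<mu> \<and> h \<in> Linf_fun smul \<mu> \<and> uae \<mu> (\<lambda>\<omega>. f \<omega> = h \<omega>)"
  by (simp add: uae_eq_def)

lemma L_fun_uae_eq:
  assumes f: "f \<in> L_fun smul rep \<mu>" and fh: "(f, h) \<in> uae_eq smul \<mu>"
  shows "h \<in> L_fun smul rep \<mu>"
  unfolding L_fun_def
proof (intro CollectI conjI allI)
  show "h \<in> Linf_fun smul \<mu>" using fh by (simp add: uae_eq_iff)
  fix g
  have eq: "uae \<mu> (\<lambda>\<omega>. f \<omega> = h \<omega>)" using fh by (simp add: uae_eq_iff)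
  have "uae \<mu> (\<lambda>\<omega>. f (translate g \<omega>) = adjoint_rep rep g (f \<omega>))" using f by (simp add: L_fun_def)
  from uae_conj[OF uae_conj[OF eq uae_translate[OF eq, of g]] this]
  show "uae \<mu> (\<lambda>\<omega>. h (translate g \<omega>) = adjoint_rep rep g (h \<omega>))"
    by (rule uae_mono) auto
qed

text \<open>
  If the means agree, both functions are the weak* limit of the same sequence \<open>\<pi>(\<omega>\<^sub>n)R f\<close>.
\<close>

lemma R_eq_iff:
  assumes f: "f \<in> L_fun smul rep \<mu>" and h: "h \<in> L_fun smul rep \<mu>"
  shows "(f, h) \<in> uae_eq smul \<mu> \<longleftrightarrow> R f = R h"
proof
  have L: "f \<in> Linf_fun smul \<mu>" "h \<in> Linf_fun smul \<mu>" using f h by (auto simp: L_fun_def)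
  {
    assume "(f, h) \<in> uae_eq smul \<mu>"
    then have eq: "AE \<omega> in walk_law \<mu> 0. f \<omega> = h \<omega>" by (intro uae_imp_AE) (simp add: uae_eq_iff)
    show "R f = R h"
    proof (rule blinfun_eqI)
      fix v
      show "blinfun_apply (R f) v = blinfun_apply (R h) v"
        unfolding R_apply[OF L(1)] R_apply[OF L(2)]
      proof (rule integral_cong_AE)
        show "AE \<omega> in walk_law \<mu> 0. blinfun_apply (f \<omega>) v = blinfun_apply (h \<omega>) v"
          using eq by eventually_elim simp
      qed (rule measurable_evaluation_walk[OF L(1)] measurable_evaluation_walk[OF L(2)])+
    qed
  }
  assume "R f = R h"
  with uae_conj[OF uae_limit[OF f] uae_limit[OF h]]
  have "uae \<mu> (\<lambda>\<omega>. f \<omega> = h \<omega>)"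
    by (elim uae_mono) (auto intro!: blinfun_eqI intro: LIMSEQ_unique)
  then show "(f, h) \<in> uae_eq smul \<mu>" using L by (simp add: uae_eq_iff)
qed

text \<open>
  Classes are fibres of \<open>R\<close>. So whatever is determined by \<open>R\<close>, in particular the norm and
  the linear operations, is independent of representatives.
\<close>

lemma class_eq_fibre:
  assumes "f \<in> L_fun smul rep \<mu>"
  shows "uae_eq smul \<mu> `` {f} = {h \<in> L_fun smul rep \<mu>. R h = R f}"
proof -
  have "(f, h) \<in> uae_eq smul \<mu> \<longleftrightarrow> h \<in> L_fun smul rep \<mu> \<and> R h = R f" for h
    using L_fun_uae_eq[OF assms, of h] R_eq_iff[OF assms, of h] by metis
  then show ?thesis by auto
qed

lemma L_space_iff: "F \<in> L_space smul rep \<mu> \<longleftrightarrow>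
    (\<exists>f\<in>L_fun smul rep \<mu>. F = {h \<in> L_fun smul rep \<mu>. R h = R f})"
  unfolding L_space_def quotient_def by (auto simp: class_eq_fibre)

lemma R_map_fibre: "f \<in> L_fun smul rep \<mu> \<Longrightarrow> R_map \<mu> {h \<in> L_fun smul rep \<mu>. R h = R f} = R f"
proof -
  assume "f \<in> L_fun smul rep \<mu>"
  then have "R ` {h \<in> L_fun smul rep \<mu>. R h = R f} = {R f}" by auto
  then show ?thesis unfolding R_map_def R_def[abs_def] by simp
qed

lemma class_norm_fibre:
  assumes f: "f \<in> L_fun smul rep \<mu>"
  shows "class_norm \<mu> {h \<in> L_fun smul rep \<mu>. R h = R f} = norm (R f)"
proof -
  have "(\<lambda>h. enn2real (norm_u \<mu> h)) ` {h \<in> L_fun smul rep \<mu>. R h = R f} = {norm (R f)}"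
    using f norm_u_eq by force
  then show ?thesis unfolding class_norm_def by simp
qed

lemma scale_dual_apply: "blinfun_apply (scale_dual c (x :: 'a \<Rightarrow>\<^sub>L 'k)) v = c * blinfun_apply x v"
  by (simp add: scale_dual_def)

lemma L_fun_add:
  assumes f: "f \<in> L_fun smul rep \<mu>" and h: "h \<in> L_fun smul rep \<mu>"
  shows "(\<lambda>\<omega>. f \<omega> + h \<omega>) \<in> L_fun smul rep \<mu>" and R_add: "R (\<lambda>\<omega>. f \<omega> + h \<omega>) = R f + R h"
proof -
  have L: "f \<in> Linf_fun smul \<mu>" "h \<in> Linf_fun smul \<mu>" using f h by (auto simp: L_fun_def)
  obtain K1 K2 where K: "0 \<le> K1" "0 \<le> K2" "uae \<mu> (\<lambda>\<omega>. norm (f \<omega>) \<le> K1)" "uae \<mu> (\<lambda>\<omega>. norm (h \<omega>) \<le> K2)"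
    using L unfolding Linf_fun_iff by blast
  have "uae \<mu> (\<lambda>\<omega>. norm (f \<omega> + h \<omega>) \<le> K1 + K2)"
    using uae_conj[OF K(3,4)] by (rule uae_mono) (auto intro: norm_triangle_mono)
  moreover have "f \<omega> + h \<omega> \<in> dual smul" for \<omega>
    using L unfolding Linf_fun_iff by (auto simp: dual_def blinfun.add_left distrib_left)
  moreover have "(\<lambda>\<omega>. blinfun_apply (f \<omega> + h \<omega>) v) \<in> borel_measurable invariant_algebra" for v
  proof -
    have [measurable]: "(\<lambda>\<omega>. blinfun_apply (f \<omega>) v) \<in> borel_measurable invariant_algebra"
      "(\<lambda>\<omega>. blinfun_apply (h \<omega>) v) \<in> borel_measurable invariant_algebra"
      using L unfolding Linf_fun_iff by blast+
    show ?thesis unfolding blinfun.add_left by measurable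
  qed
  ultimately have fhL: "(\<lambda>\<omega>. f \<omega> + h \<omega>) \<in> Linf_fun smul \<mu>"
    unfolding Linf_fun_iff using K(1,2) by (intro conjI allI exI[of _ "K1 + K2"]) auto
  have "uae \<mu> (\<lambda>\<omega>. f (translate g \<omega>) + h (translate g \<omega>) = adjoint_rep rep g (f \<omega> + h \<omega>))" for g
  proof -
    have "uae \<mu> (\<lambda>\<omega>. f (translate g \<omega>) = adjoint_rep rep g (f \<omega>))"
      "uae \<mu> (\<lambda>\<omega>. h (translate g \<omega>) = adjoint_rep rep g (h \<omega>))"
      using f h by (auto simp: L_fun_def)
    from uae_conj[OF this] show ?thesis by (rule uae_mono) (simp add: adjoint_rep_plus)
  qed
  with fhL show "(\<lambda>\<omega>. f \<omega> + h \<omega>) \<in> L_fun smul rep \<mu>" by (simp add: L_fun_def)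
  show "R (\<lambda>\<omega>. f \<omega> + h \<omega>) = R f + R h"
    by (rule blinfun_eqI)
      (simp add: R_apply[OF fhL] R_apply[OF L(1)] R_apply[OF L(2)] blinfun.add_left
        integrable_evaluation[OF L(1)] integrable_evaluation[OF L(2)])
qed

lemma L_fun_scale:
  assumes f: "f \<in> L_fun smul rep \<mu>"
  shows "(\<lambda>\<omega>. scale_dual c (f \<omega>)) \<in> L_fun smul rep \<mu>"
    and R_scale: "R (\<lambda>\<omega>. scale_dual c (f \<omega>)) = scale_dual c (R f)"
proof -
  have L: "f \<in> Linf_fun smul \<mu>" using f by (auto simp: L_fun_def)
  obtain K where K: "0 \<le> K" "uae \<mu> (\<lambda>\<omega>. norm (f \<omega>) \<le> K)"
    using L unfolding Linf_fun_iff by blast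
  have "norm (scale_dual c x) \<le> norm c * norm x" for x :: "'a \<Rightarrow>\<^sub>L 'k"
    by (rule norm_blinfun_bound)
      (auto simp: scale_dual_apply norm_mult mult.assoc intro!: mult_left_mono norm_blinfun)
  then have "uae \<mu> (\<lambda>\<omega>. norm (scale_dual c (f \<omega>)) \<le> norm c * K)"
    by (intro uae_mono[OF K(2)]) (meson mult_left_mono norm_ge_zero order_trans)
  moreover have "scale_dual c (f \<omega>) \<in> dual smul" for \<omega>
    using L unfolding Linf_fun_iff by (auto simp: dual_def scale_dual_apply)
  moreover have "(\<lambda>\<omega>. blinfun_apply (scale_dual c (f \<omega>)) v) \<in> borel_measurable invariant_algebra" for v
  proof -
    have [measurable]: "(\<lambda>\<omega>. blinfun_apply (f \<omega>) v) \<in> borel_measurable invariant_algebra"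
      using L unfolding Linf_fun_iff by blast
    show ?thesis unfolding scale_dual_apply by measurable
  qed
  ultimately have cL: "(\<lambda>\<omega>. scale_dual c (f \<omega>)) \<in> Linf_fun smul \<mu>"
    unfolding Linf_fun_iff using K(1) by (intro conjI allI exI[of _ "norm c * K"]) auto
  have "uae \<mu> (\<lambda>\<omega>. scale_dual c (f (translate g \<omega>)) = adjoint_rep rep g (scale_dual c (f \<omega>)))" for g
  proof -
    have "uae \<mu> (\<lambda>\<omega>. f (translate g \<omega>) = adjoint_rep rep g (f \<omega>))" using f by (auto simp: L_fun_def)
    then show ?thesis by (rule uae_mono) (simp add: adjoint_rep_scale)
  qed
  with cL show "(\<lambda>\<omega>. scale_dual c (f \<omega>)) \<in> L_fun smul rep \<mu>" by (simp add: L_fun_def)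
  show "R (\<lambda>\<omega>. scale_dual c (f \<omega>)) = scale_dual c (R f)"
    by (rule blinfun_eqI) (simp add: R_apply[OF cL] R_apply[OF L] scale_dual_apply)
qed

lemma class_add_fibre:
  assumes f: "f \<in> L_fun smul rep \<mu>" and h: "h \<in> L_fun smul rep \<mu>"
  shows "class_add smul \<mu> {f' \<in> L_fun smul rep \<mu>. R f' = R f} {h' \<in> L_fun smul rep \<mu>. R h' = R h} =
    {k \<in> L_fun smul rep \<mu>. R k = R (\<lambda>\<omega>. f \<omega> + h \<omega>)}"
proof -
  have "uae_eq smul \<mu> `` {\<lambda>\<omega>. f' \<omega> + h' \<omega>} = {k \<in> L_fun smul rep \<mu>. R k = R f + R h}"
    if "f' \<in> L_fun smul rep \<mu>" "R f' = R f" "h' \<in> L_fun smul rep \<mu>" "R h' = R h" for f' h'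
    using that by (simp add: class_eq_fibre[OF L_fun_add(1)] R_add)
  then show ?thesis unfolding class_add_def R_add[OF f h] using f h by fastforce
qed

lemma class_scale_fibre:
  assumes f: "f \<in> L_fun smul rep \<mu>"
  shows "class_scale smul \<mu> c {f' \<in> L_fun smul rep \<mu>. R f' = R f} =
    {k \<in> L_fun smul rep \<mu>. R k = R (\<lambda>\<omega>. scale_dual c (f \<omega>))}"
proof -
  have "uae_eq smul \<mu> `` {\<lambda>\<omega>. scale_dual c (f' \<omega>)} = {k \<in> L_fun smul rep \<mu>. R k = scale_dual c (R f)}"
    if "f' \<in> L_fun smul rep \<mu>" "R f' = R f" for f'
    using that by (simp add: class_eq_fibre[OF L_fun_scale(1)] R_scale)
  then show ?thesis unfolding class_scale_def R_scale[OF f] using f by fastforce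
qed

lemma bij_betw_R_map: "bij_betw (R_map \<mu>) (L_space smul rep \<mu>) (harmonic smul rep \<mu>)"
proof (rule bij_betw_imageI)
  show "inj_on (R_map \<mu>) (L_space smul rep \<mu>)"
    by (rule inj_onI) (auto simp: L_space_iff R_map_fibre)
  show "R_map \<mu> ` L_space smul rep \<mu> = harmonic smul rep \<mu>"
  proof (intro subset_antisym subsetI)
    show "x \<in> harmonic smul rep \<mu>" if "x \<in> R_map \<mu> ` L_space smul rep \<mu>" for x
      using that R_harmonic by (auto simp: L_space_iff R_map_fibre)
    fix x assume "x \<in> harmonic smul rep \<mu>"
    then obtain f where f: "f \<in> L_fun smul rep \<mu>" "R f = x" by (rule boundary_function_exists)
    then show "x \<in> R_map \<mu> ` L_space smul rep \<mu>"
      by (intro image_eqI[of _ _ "{h \<in> L_fun smul rep \<mu>. R h = R f}"]) (auto simp: L_space_iff R_map_fibre)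
  qed
qed

lemma boundary_limit:
  assumes "x \<in> harmonic smul rep \<mu>" "f \<in> the_inv_into (L_space smul rep \<mu>) (R_map \<mu>) x"
  shows "uae \<mu> (\<lambda>\<omega>. limitin (weak_star smul) (\<lambda>n. adjoint_rep rep (\<omega> n) x) (f \<omega>) sequentially)"
proof -
  let ?F = "the_inv_into (L_space smul rep \<mu>) (R_map \<mu>) x"
  have xd: "x \<in> dual smul" using assms(1) by (simp add: harmonic_def)
  have "?F \<in> L_space smul rep \<mu>" "R_map \<mu> ?F = x"
    using bij_betw_R_map assms(1) the_inv_into_into[of "R_map \<mu>" "L_space smul rep \<mu>" x]
      f_the_inv_into_f[of "R_map \<mu>" "L_space smul rep \<mu>" x]
    by (auto simp: bij_betw_def)
  then have f: "f \<in> L_fun smul rep \<mu>" "R f = x"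
    using assms(2) by (auto simp: L_space_iff R_map_fibre)
  have "f \<omega> \<in> dual smul" for \<omega> using f(1) by (auto simp: L_fun_def Linf_fun_iff)
  with uae_limit[OF f(1)] show ?thesis
    unfolding f(2) by (elim uae_mono) (simp add: limitin_weak_star adjoint_rep_dual xd)
qed

end

theorem theorem6p1:
  fixes smul :: "'k::{real_normed_field, euclidean_space} \<Rightarrow> 'a::banach \<Rightarrow> 'a"
    and rep :: "'g::{topological_group_add, t2_space} \<Rightarrow> 'a \<Rightarrow>\<^sub>L 'a"
    and \<mu> :: "'g measure"
  assumes "locally_compact_space (euclidean :: 'g topology)"
    and "regular_borel_prob \<mu>"
    and "separable_space (euclidean :: 'a topology)"
    and "isometric_representation smul rep"
  shows "bij_betw (R_map \<mu>) (L_space smul rep \<mu>) (harmonic smul rep \<mu>) \<and>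
    (\<forall>F\<in>L_space smul rep \<mu>. \<forall>F'\<in>L_space smul rep \<mu>.
      class_add smul \<mu> F F' \<in> L_space smul rep \<mu> \<and>
      R_map \<mu> (class_add smul \<mu> F F') = R_map \<mu> F + R_map \<mu> F') \<and>
    (\<forall>c. \<forall>F\<in>L_space smul rep \<mu>.
      class_scale smul \<mu> c F \<in> L_space smul rep \<mu> \<and>
      R_map \<mu> (class_scale smul \<mu> c F) = scale_dual c (R_map \<mu> F)) \<and>
    (\<forall>F\<in>L_space smul rep \<mu>. norm (R_map \<mu> F) = class_norm \<mu> F) \<and>
    (\<forall>x\<in>harmonic smul rep \<mu>.
      \<forall>f\<in>the_inv_into (L_space smul rep \<mu>) (R_map \<mu>) x.
        uae \<mu> (\<lambda>\<omega>. limitin (weak_star smul) (\<lambda>n. adjoint_rep rep (\<omega> n) x) (f \<omega>) sequentially))"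
proof -
  obtain D :: "'a set" where D: "countable D" "closure D = UNIV"
    using assms(3) unfolding separable_space_def by auto
  interpret isometric_representation smul rep by fact
  interpret boundary_representation smul rep \<mu> D
    by unfold_locales (use assms(2) D in auto)
  have add: "class_add smul \<mu> F F' \<in> L_space smul rep \<mu> \<and>
      R_map \<mu> (class_add smul \<mu> F F') = R_map \<mu> F + R_map \<mu> F'"
    if F: "F \<in> L_space smul rep \<mu>" and F': "F' \<in> L_space smul rep \<mu>" for F F'
  proof -
    obtain f where f: "f \<in> L_fun smul rep \<mu>" "F = {h \<in> L_fun smul rep \<mu>. R h = R f}"
      using F unfolding L_space_iff by blast
    obtain f' where f': "f' \<in> L_fun smul rep \<mu>" "F' = {h \<in> L_fun smul rep \<mu>. R h = R f'}"
      using F' unfolding L_space_iff by blast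
    have "class_add smul \<mu> F F' \<in> L_space smul rep \<mu>"
      unfolding f(2) f'(2) class_add_fibre[OF f(1) f'(1)] L_space_iff
      using L_fun_add(1)[OF f(1) f'(1)] by (rule bexI[rotated]) (rule refl)
    moreover have "R_map \<mu> (class_add smul \<mu> F F') = R_map \<mu> F + R_map \<mu> F'"
      unfolding f(2) f'(2) class_add_fibre[OF f(1) f'(1)] R_map_fibre[OF f(1)] R_map_fibre[OF f'(1)]
        R_map_fibre[OF L_fun_add(1)[OF f(1) f'(1)]] by (rule R_add[OF f(1) f'(1)])
    ultimately show ?thesis ..
  qed
  have scale: "class_scale smul \<mu> c F \<in> L_space smul rep \<mu> \<and>
      R_map \<mu> (class_scale smul \<mu> c F) = scale_dual c (R_map \<mu> F)"
    if F: "F \<in> L_space smul rep \<mu>" for c F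
  proof -
    obtain f where f: "f \<in> L_fun smul rep \<mu>" "F = {h \<in> L_fun smul rep \<mu>. R h = R f}"
      using F unfolding L_space_iff by blast
    have "class_scale smul \<mu> c F \<in> L_space smul rep \<mu>"
      unfolding f(2) class_scale_fibre[OF f(1)] L_space_iff
      using L_fun_scale(1)[OF f(1)] by (rule bexI[rotated]) (rule refl)
    moreover have "R_map \<mu> (class_scale smul \<mu> c F) = scale_dual c (R_map \<mu> F)"
      unfolding f(2) class_scale_fibre[OF f(1)] R_map_fibre[OF f(1)]
        R_map_fibre[OF L_fun_scale(1)[OF f(1)]] by (rule R_scale[OF f(1)])
    ultimately show ?thesis ..
  qed
  have "norm (R_map \<mu> F) = class_norm \<mu> F" if "F \<in> L_space smul rep \<mu>" for F
    using that unfolding L_space_iff by (auto simp: R_map_fibre class_norm_fibre)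
  then show ?thesis using bij_betw_R_map add scale boundary_limit by blast
qed

end
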